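(* Let $A \in \mathbb{C}^{n\times p}$, $B \in \mathbb{C}^{m\times q}$, $C \in \mathbb{C}^{n\times q}$ be given and let $\phi(X) = (AXB + C)(AXB + C)^{*} - I_n$ for $X \in \mathbb{C}^{p\times m}$. Define $$N_1 = \begin{bmatrix} CC^{*} - I_n & A \\ A^{*} & 0\end{bmatrix},\ N_2 = \begin{bmatrix} CC^{*} - I_n & CB^{*} & A \\ A^{*} & 0 & 0\end{bmatrix},\ N_3 = \begin{bmatrix} CC^{*} - I_n & CB^{*} \\ BC^{*} & BB^{*}\end{bmatrix},\ N_4 = \begin{bmatrix} CC^{*} - I_n & CB^{*} & A \\ BC^{*} & BB^{*} & 0\end{bmatrix},$$ and $s_1 = r(N_1) - 2r(N_2)$, $s_2 = r(N_3) - 2r(N_4)$, $s_3 = i_{+}(N_1) + i_{-}(N_3) - r(N_2) - r(N_4)$, $s_4 = i_{-}(N_1) + i_{+}(N_3) - r(N_2) - r(N_4)$. Then \begin{align*} \max_{X} r[\phi(X)] &= \min\{ r[\,CC^{*} - I_n,\, CB^{*},\, A\,],\ r(N_1),\ r(N_3)\},\\ \min_{X} r[\phi(X)] &= 2r[\,CC^{*} - I_n,\, CB^{*},\, A\,] + \max\{s_1, s_2, s_3, s_4\},\\ \max_{X} i_{\pm}[\phi(X)] &= \min\{ i_{\pm}(N_1),\ i_{\pm}(N_3)\},\\ \min_{X} i_{\pm}[\phi(X)] &= r[\,CC^{*} - I_n,\, CB^{*},\, A\,] + \max\{ i_{\pm}(N_1) - r(N_2),\ i_{\pm}(N_3) -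 r(N_4)\}, \end{align*} where all extrema are over $X \in \mathbb{C}^{p\times m}$.
   Context: $r$ is rank; $i_{\pm}(H)$ are the numbers of positive/negative eigenvalues of a Hermitian matrix $H$; $[\,U,V,W\,]$ is a row block matrix. *)

theory Defs
  imports "Jordan_Normal_Form.Jordan_Normal_Form" "Jordan_Normal_Form.Schur_Decomposition"
    "Jordan_Normal_Form.DL_Rank"
begin

definition mrank :: "complex mat \<Rightarrow> nat" where
  "mrank M = vec_space.rank (dim_row M) M"

definition hcat :: "'a::zero mat \<Rightarrow> 'a mat \<Rightarrow> 'a mat" where
  "hcat M1 M2 = mat (dim_row M1) (dim_col M1 + dim_col M2)
     (\<lambda>(i,j). if j < dim_col M1 then M1 $$ (i,j) else M2 $$ (i, j - dim_col M1))"

text \<open>Numbers of positive / negative eigenvalues (counted with algebraic multiplicity)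
  of a square complex matrix (used for Hermitian matrices, whose eigenvalues are real).\<close>
definition ipos :: "complex mat \<Rightarrow> nat" where
  "ipos H = (\<Sum>a\<in>{a. poly (char_poly H) a = 0 \<and> a \<in> \<real> \<and> Re a > 0}. Polynomial.order a (char_poly H))"

definition ineg :: "complex mat \<Rightarrow> nat" where
  "ineg H = (\<Sum>a\<in>{a. poly (char_poly H) a = 0 \<and> a \<in> \<real> \<and> Re a < 0}. Polynomial.order a (char_poly H))"

end

theory Submission
  imports Defs "HOL-Library.Function_Algebras"
begin

text \<open>The matrix \<open>(AXB + C)(AXB + C)\<^sup>* - I\<close> is a Schur complement in the Hermitian block matrix with
  diagonal blocks \<open>- I\<close>, \<open>- I\<close> and off-diagonal block \<open>AXB + C\<close>. This linearizes the problem: the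
  Hermitian forms obtained from all \<open>X\<close> on a space \<open>W\<close> agree on two subspaces \<open>K\<close> and \<open>L\<close> (the kernel
  of \<open>A\<^sup>*\<close> in one coordinate, of \<open>B\<close> in the other), and the family is closed under adding
  \<open>f g\<^sup>* + g f\<^sup>*\<close> for functionals \<open>f\<close>, \<open>g\<close> that vanish on \<open>K\<close> and on \<open>L\<close>, respectively.

  For any subspace \<open>K\<close>, the inertia of a form on \<open>W\<close> is that of its restrictions to \<open>K\<close> and to the
  orthogonal complement of \<open>K\<close>, corrected by the dimensions of two radicals. This yields all bounds. They
  are attained at extremal members of the family: for the minima take a form with the largest radical, and
  among these one whose radical meets \<open>K\<close> and \<open>L\<close> in the largest dimension; for each maximum take a form
  that maximizes the quantity in question. If such a form missed its bound, then vectors in the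
  orthogonal complements of \<open>K\<close> and \<open>L\<close>, or in the radical, would provide \<open>f\<close> and \<open>g\<close> whose update improves it.\<close>

section \<open>Finite-dimensional subspaces\<close>

text \<open>In \<open>\<phi> X\<close> the matrix \<open>X\<close> enters quadratically; in the
  block form it enters affinely and only through \<open>A\<^sup>*\<close> and \<open>B\<close>,
  which is why two fixed subspaces suffice. The obstacle is degeneracy: the forms and their
  restrictions to \<open>K\<close> and \<open>L\<close> may all have radicals, so these must be
  carried along in every dimension count. They are what the nonsquare matrices measure. Up to the
  ranks of \<open>A\<close> and \<open>B\<close>, the coranks of \<open>N2\<close> and
  \<open>N4\<close> are the dimensions of the radicals on \<open>K\<close> and on \<open>L\<close>,
  each cut with the other space; the corank of the row block is that of the radical inside
  \<open>K \<inter> L\<close>, which no choice of \<open>X\<close> alters. \<open>N1\<close> and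
  \<open>N3\<close> carry the inertia on \<open>K\<close> and \<open>L\<close>, shifted by
  \<open>rank A\<close> or \<open>rank B\<close> and, in the negative index, by the \<open>q\<close>
  dimensions of the block \<open>- I\<^sub>q\<close>. One form minimizes both indices at once, so
  the minimal rank is a sum of two maxima of two terms each; expanding it gives the four numbers
  s_1, ..., s_4. The rank has an upper bound of its own, given by the common radical, and is
  maximized separately.\<close>

locale complex_vector_space = vector_space scale
  for scale :: "complex \<Rightarrow> 'b::ab_group_add \<Rightarrow> 'b" (infixr "*s" 75)
begin

text \<open>Finite dimension is a property of subsets, since the ambient space will be the
  infinite-dimensional \<open>nat \<Rightarrow> complex\<close>.\<close>

definition fin_dim :: "'b set \<Rightarrow> bool" where
  "fin_dim S \<longleftrightarrow> (\<exists>B. finite B \<and> S \<subseteq> span B)"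

lemma fin_dim_subset: "fin_dim T \<Longrightarrow> S \<subseteq> T \<Longrightarrow> fin_dim S"
  unfolding fin_dim_def by blast

lemma fin_dim_span: "fin_dim S \<Longrightarrow> fin_dim (span S)"
  unfolding fin_dim_def by (metis span_minimal subspace_span)

lemma fin_dim_Un:
  assumes "fin_dim S" "fin_dim T" shows "fin_dim (S \<union> T)"
proof -
  obtain A B where "finite A" "S \<subseteq> span A" "finite B" "T \<subseteq> span B"
    using assms unfolding fin_dim_def by blast
  then have "finite (A \<union> B)" "S \<union> T \<subseteq> span (A \<union> B)"
    using span_mono[of A "A \<union> B"] span_mono[of B "A \<union> B"] by auto
  then show ?thesis unfolding fin_dim_def by blast
qed

lemma fin_dim_finite: "finite S \<Longrightarrow> fin_dim S"
  unfolding fin_dim_def by (meson span_superset)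

lemma fin_dim_basis:
  assumes "subspace S" "fin_dim S"
  obtains B where "finite B" "independent B" "B \<subseteq> S" "span B = S" "card B = dim S"
proof -
  obtain B where B: "B \<subseteq> S" "independent B" "S \<subseteq> span B" "card B = dim S"
    using basis_exists by blast
  obtain D where D: "finite D" "S \<subseteq> span D" using assms(2) unfolding fin_dim_def by blast
  have "finite B" using independent_span_bound[OF D(1) B(2)] B(1) D(2) by blast
  moreover have "span B = S" using B assms(1) by (simp add: span_minimal subset_antisym)
  ultimately show ?thesis using that B by blast
qed

text \<open>\<open>dim\<close> is the cardinality of a basis, and that is 0 for an infinite basis;
  hence monotonicity is a statement about finite-dimensional \<open>T\<close>.\<close>

lemma dim_mono_fin_dim:
  assumes "S \<subseteq> T" "fin_dim T" shows "dim S \<le> dim T"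
proof -
  obtain B where B: "finite B" "span B = span T" "card B = dim T"
    using fin_dim_basis[OF subspace_span fin_dim_span[OF assms(2)]] dim_span by metis
  have "S \<subseteq> span B" using assms(1) B(2) span_superset by blast
  then show ?thesis using dim_le_card B by metis
qed

lemma independent_card_le_dim_fin_dim:
  assumes "B \<subseteq> T" "independent B" "fin_dim T" shows "card B \<le> dim T"
  using dim_mono_fin_dim[OF assms(1,3)] dim_eq_card_independent[OF assms(2)] by simp

lemma subspace_eq_of_dim:
  assumes "subspace S" "subspace T" "S \<subseteq> T" "fin_dim T" "dim T \<le> dim S"
  shows "S = T"
proof (rule ccontr)
  assume "S \<noteq> T"
  then obtain x where x: "x \<in> T" "x \<notin> S" using assms by blast
  obtain B where B: "finite B" "independent B" "B \<subseteq> S" "span B = S" "card B = dim S"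
    using fin_dim_basis[OF assms(1) fin_dim_subset[OF assms(4,3)]] .
  have "independent (insert x B)" using B x by (simp add: independent_insertI)
  moreover have "insert x B \<subseteq> T" using x B assms by blast
  ultimately have "card (insert x B) \<le> dim T"
    using independent_card_le_dim_fin_dim assms(4) by blast
  moreover have "x \<notin> B" using x B by blast
  ultimately show False using B assms(5) by simp
qed

lemma dim_zero_subspace [simp]: "dim {0} = 0"
  using dim_span[of "{}"] dim_eq_card_independent[OF independent_empty] by simp

lemma complement_exists:
  assumes "subspace S" "subspace T" "S \<subseteq> T" "fin_dim T"
  obtains C where "subspace C" "C \<subseteq> T" "S \<inter> C = {0}" "span (S \<union> C) = T"
proof -
  obtain B where B: "finite B" "independent B" "B \<subseteq> S" "span B = S"
    using fin_dim_basis[OF assms(1) fin_dim_subset[OF assms(4,3)]] by metis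
  have "B \<subseteq> T" using B assms by blast
  from maximal_independent_subset_extend[OF this B(2)]
  obtain D where D: "B \<subseteq> D" "D \<subseteq> T" "independent D" "T \<subseteq> span D" by blast
  let ?C = "span (D - B)"
  have "S \<inter> ?C \<subseteq> {0}"
  proof
    fix x assume x: "x \<in> S \<inter> ?C"
    have 1: "representation D x = representation B x"
      using x B D by (intro representation_extend) auto
    have 2: "representation D x = representation (D - B) x"
      using x B D by (intro representation_extend) auto
    \<comment> \<open>The coordinates of \<open>x\<close> in \<open>D\<close> vanish off
      \<open>B\<close> and also off \<open>D - B\<close>, hence everywhere.\<close>
    have "representation D x b = 0" for b
      using representation_ne_zero[of B x b] representation_ne_zero[of "D - B" x b]
      by (metis 1 2 DiffD2)
    moreover have "x \<in> span D" using x B D assms by blast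
    ultimately show "x \<in> {0}"
      using sum_nonzero_representation_eq[OF D(3), of x] by simp
  qed
  moreover have "0 \<in> S \<inter> ?C" using assms(1) by (simp add: subspace_0 span_zero)
  moreover have CT: "?C \<subseteq> T" using D assms by (intro span_minimal) auto
  moreover have "span (S \<union> ?C) = T"
  proof
    show "span (S \<union> ?C) \<subseteq> T"
      using assms(2,3) CT by (intro span_minimal) auto
    have "span D \<subseteq> span (S \<union> ?C)"
      using B D by (intro span_minimal) (auto intro!: span_base)
    then show "T \<subseteq> span (S \<union> ?C)" using D by blast
  qed
  ultimately show ?thesis using that[of ?C] subspace_span by blast
qed

lemma dim_direct_sum:
  assumes "subspace S" "subspace T" "fin_dim S" "fin_dim T" "S \<inter> T = {0}"
  shows "dim (span (S \<union> T)) = dim S + dim T"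
proof -
  obtain B where B: "finite B" "independent B" "B \<subseteq> S" "span B = S" "card B = dim S"
    using fin_dim_basis[OF assms(1,3)] .
  obtain D where D: "finite D" "independent D" "D \<subseteq> T" "span D = T" "card D = dim T"
    using fin_dim_basis[OF assms(2,4)] .
  have "independent (B \<union> D')" if "D' \<subseteq> D" for D'
    using finite_subset[OF that D(1)] that
  proof (induction D' rule: finite_induct)
    case empty then show ?case using B by simp
  next
    case (insert x F)
    have "x \<notin> span (B \<union> F)"
    proof
      assume "x \<in> span (B \<union> F)"
      then obtain s d where sd: "x = s + d" "s \<in> span B" "d \<in> span F"
        unfolding span_Un by blast
      have "d \<in> T" using sd insert.prems D span_mono[of F D] by blast
      moreover have "x \<in> T" using insert.prems D by blast
      ultimately have "s \<in> T" using subspace_diff[OF assms(2), of x d] sd by simp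
      then have "s = 0" using sd B assms(5) by blast
      then have "x \<in> span F" using sd by simp
      moreover have "F \<subseteq> D - {x}" using insert by blast
      ultimately have "x \<in> span (D - {x})" using span_mono by blast
      then show False using D(2) insert.prems dependent_def by blast
    qed
    then show ?case using insert independent_insertI by simp
  qed
  then have "independent (B \<union> D)" by blast
  moreover have "B \<inter> D = {}"
  proof -
    have "0 \<notin> B" using B(2) dependent_zero by blast
    moreover have "B \<inter> D \<subseteq> {0}" using assms(5) B(3) D(3) by blast
    ultimately show ?thesis by blast
  qed
  moreover have "span (S \<union> T) = span (B \<union> D)"
  proof -
    have "span S = span B" "span T = span D"
      using assms(1,2) B(4) D(4) by (simp_all only: span_eq_iff)
    then show ?thesis unfolding span_Un by simp
  qed
  ultimately show ?thesis using B D
    by (simp add: dim_eq_card_independent card_Un_disjoint)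
qed

text \<open>A complement \<open>C\<close> of \<open>S \<inter> T\<close> in \<open>T\<close> is also
  a complement of \<open>S\<close> in the sum of \<open>S\<close> and \<open>T\<close>.\<close>

lemma dim_span_Un_Int:
  assumes "subspace S" "subspace T" "fin_dim S" "fin_dim T"
  shows "dim (span (S \<union> T)) + dim (S \<inter> T) = dim S + dim T"
proof -
  have sI: "subspace (S \<inter> T)" using assms by (simp add: subspace_inter)
  obtain C where C: "subspace C" "C \<subseteq> T" "S \<inter> T \<inter> C = {0}" "span (S \<inter> T \<union> C) = T"
    using complement_exists[OF sI assms(2) Int_lower2 assms(4)] .
  have fC: "fin_dim C" "fin_dim (S \<inter> T)"
    using fin_dim_subset[OF assms(4)] C(2) by auto
  have "span (S \<union> T) = span (S \<union> C)"
  proof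
    have "span (S \<inter> T \<union> C) \<subseteq> span (S \<union> C)" by (intro span_mono) blast
    then have "T \<subseteq> span (S \<union> C)" using C(4) by simp
    then show "span (S \<union> T) \<subseteq> span (S \<union> C)"
      by (intro span_minimal) (auto intro: span_base)
    show "span (S \<union> C) \<subseteq> span (S \<union> T)" using C by (intro span_mono) blast
  qed
  moreover have "S \<inter> C = {0}" using C(2,3) by blast
  ultimately have "dim (span (S \<union> T)) = dim S + dim C"
    using dim_direct_sum assms C fC by simp
  moreover have "dim T = dim (S \<inter> T) + dim C"
    using dim_direct_sum[OF sI C(1) fC(2,1) C(3)] C(4) by simp
  ultimately show ?thesis by simp
qed

lemma dim_span_insert_le: "fin_dim S \<Longrightarrow> dim (span (insert v S)) \<le> Suc (dim S)"
proof -
  assume "fin_dim S"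
  then obtain B where B: "finite B" "span B = span S" "card B = dim S"
    using fin_dim_basis[OF subspace_span fin_dim_span] dim_span by metis
  have "span (insert v S) \<subseteq> span (insert v B)"
  proof (rule span_minimal)
    have "S \<subseteq> span B" using B(2) span_superset by blast
    then show "insert v S \<subseteq> span (insert v B)"
      using span_mono[of B "insert v B"] by (auto intro: span_base)
  qed simp
  then have "dim (span (insert v S)) \<le> card (insert v B)"
    using dim_le_card B(1) by (metis finite_insert)
  also have "\<dots> \<le> Suc (dim S)" using B by (simp add: card_insert_if)
  finally show ?thesis .
qed

lemma dim_span_insert:
  assumes "subspace S" "fin_dim S" "v \<notin> S"
  shows "dim (span (insert v S)) = Suc (dim S)"
proof (rule antisym)
  show "dim (span (insert v S)) \<le> Suc (dim S)" using dim_span_insert_le assms by blast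
  obtain B where B: "finite B" "independent B" "B \<subseteq> S" "span B = S" "card B = dim S"
    using fin_dim_basis[OF assms(1,2)] .
  have "independent (insert v B)" using B assms by (simp add: independent_insertI)
  moreover have "insert v B \<subseteq> span (insert v S)" using B by (auto intro: span_base)
  moreover have "fin_dim (span (insert v S))"
    using assms(2) fin_dim_span fin_dim_Un[OF fin_dim_finite[of "{v}"]] by simp
  moreover have "v \<notin> B" using B assms by blast
  ultimately show "Suc (dim S) \<le> dim (span (insert v S))"
    using independent_card_le_dim_fin_dim B by (metis card_insert_disjoint)
qed

text \<open>\<open>C\<close> is a complement of the kernel of \<open>f\<close> in \<open>S\<close>,
  so \<open>f\<close> has a section over its image with values in \<open>C\<close>. The last
  equation is rank-nullity; \<open>C\<close> itself serves to lift definite subspaces along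
  \<open>f\<close>.\<close>

lemma linear_section:
  assumes f: "Vector_Spaces.linear scale scale f" and S: "subspace S" "fin_dim S"
  obtains C where "subspace C" "C \<subseteq> S" "inj_on f C" "f ` C = f ` S" "dim C = dim (f ` S)"
    "dim S = dim C + dim {x \<in> S. f x = 0}"
proof -
  interpret f: Vector_Spaces.linear scale scale f by fact
  interpret vector_space_pair scale scale ..
  let ?N = "{x \<in> S. f x = 0}"
  have N: "subspace ?N"
    using S(1) by (auto simp: subspace_def f.add f.scale f.zero)
  obtain C where C: "subspace C" "C \<subseteq> S" "?N \<inter> C = {0}" "span (?N \<union> C) = S"
    using complement_exists[OF N S(1) _ S(2)] by (metis (lifting) mem_Collect_eq subsetI)
  have inj: "inj_on f C"
  proof (rule inj_onI)
    fix x y assume xy: "x \<in> C" "y \<in> C" "f x = f y"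
    have "x - y \<in> C" using subspace_diff[OF C(1) xy(1,2)] .
    then have "x - y \<in> ?N \<inter> C" using C(2) xy(3) f.diff[of x y] by auto
    then show "x = y" using C(3) by auto
  qed
  have im: "f ` C = f ` S"
  proof
    show "f ` C \<subseteq> f ` S" using C by blast
    show "f ` S \<subseteq> f ` C"
    proof
      fix y assume "y \<in> f ` S"
      then obtain x where x: "x \<in> S" "y = f x" by blast
      have "x \<in> span (?N \<union> C)" using x(1) C(4) by simp
      moreover have "span ?N = ?N" "span C = C"
        using N C(1) by (simp_all only: span_eq_iff)
      ultimately obtain a b where "x = a + b" "a \<in> ?N" "b \<in> C"
        unfolding span_Un by auto
      then show "y \<in> f ` C" using x f.add by auto
    qed
  qed
  have fC: "fin_dim C" "fin_dim ?N"
    using fin_dim_subset[OF S(2)] C(2) by auto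
  obtain B where B: "finite B" "independent B" "B \<subseteq> C" "span B = C" "card B = dim C"
    using fin_dim_basis[OF C(1) fC(1)] .
  have "independent (f ` B)" using f.independent_injective_image[OF B(2)] inj B by simp
  moreover have "card (f ` B) = card B" using inj B by (meson card_image inj_on_subset)
  moreover have "span (f ` B) = f ` C" using f.span_image B by simp
  ultimately have "dim (f ` C) = dim C" using B dim_span_eq_card_independent by metis
  moreover have "dim S = dim C + dim ?N"
    using dim_direct_sum[OF N C(1) fC(2,1) C(3)] C(4) by simp
  ultimately show ?thesis using that[OF C(1,2) inj im] im by simp
qed

lemma fin_dim_image:
  assumes "Vector_Spaces.linear scale scale f" "fin_dim S" shows "fin_dim (f ` S)"
proof -
  interpret f: Vector_Spaces.linear scale scale f by fact
  obtain B where "finite B" "S \<subseteq> span B" using assms unfolding fin_dim_def by blast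
  then have "f ` S \<subseteq> span (f ` B)" "finite (f ` B)" using f.span_image by auto
  then show ?thesis unfolding fin_dim_def by blast
qed

section \<open>Linear functionals\<close>

definition functional :: "('b \<Rightarrow> complex) \<Rightarrow> bool" where
  "functional f \<longleftrightarrow> (\<forall>x y. f (x + y) = f x + f y) \<and> (\<forall>c x. f (c *s x) = c * f x)"

lemma functional_add: "functional f \<Longrightarrow> f (x + y) = f x + f y"
  and functional_scale: "functional f \<Longrightarrow> f (c *s x) = c * f x"
  unfolding functional_def by simp_all

lemma functional_zero: "functional f \<Longrightarrow> f 0 = 0"
  using functional_scale[of f 0 0] by simp

lemma functional_diff: "functional f \<Longrightarrow> f (x - y) = f x - f y"
  using functional_add[of f "x - y" y] by simp

lemma subspace_kernel: "functional f \<Longrightarrow> subspace S \<Longrightarrow> subspace {x \<in> S. f x = 0}"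
  by (simp add: subspace_def functional_add functional_scale functional_zero)

lemma dim_kernel_functional:
  assumes f: "functional f" and S: "subspace S" "fin_dim S"
  shows "dim S \<le> Suc (dim {x \<in> S. f x = 0})"
proof (cases "\<exists>v\<in>S. f v \<noteq> 0")
  case True
  obtain v where v: "v \<in> S" "f v \<noteq> 0" using True by blast
  let ?N = "{x \<in> S. f x = 0}"
  have "S \<subseteq> span (insert v ?N)"
  proof
    fix x assume x: "x \<in> S"
    let ?c = "f x / f v"
    have "x - ?c *s v \<in> ?N"
      using x v S(1) by (simp add: subspace_diff subspace_scale functional_diff[OF f] functional_scale[OF f])
    then have "(x - ?c *s v) + ?c *s v \<in> span (insert v ?N)"
      by (intro span_add span_scale) (auto intro: span_base)
    then show "x \<in> span (insert v ?N)" by simp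
  qed
  moreover have "fin_dim ?N" by (rule fin_dim_subset[OF S(2)]) blast
  moreover have "fin_dim (insert v ?N)"
    using fin_dim_Un[OF fin_dim_finite[of "{v}"] \<open>fin_dim ?N\<close>] by simp
  ultimately show ?thesis
    using dim_mono_fin_dim[OF _ fin_dim_span, of S "insert v ?N"] dim_span_insert_le[of ?N v] by linarith
next
  case False
  then have "{x \<in> S. f x = 0} = S" by auto
  then show ?thesis by simp
qed

text \<open>\<open>f\<close> is the coordinate along \<open>r\<close> in a basis of the whole space
  that contains \<open>r\<close> and a basis of \<open>S\<close>. Such functionals supply updates
  where the form itself provides none, notably at vectors of the radical.\<close>

lemma functional_separating:
  assumes "subspace S" "r \<notin> S"
  obtains f where "functional f" "\<And>x. x \<in> S \<Longrightarrow> f x = 0" "f r = 1"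
proof -
  obtain B where B: "B \<subseteq> S" "independent B" "S \<subseteq> span B"
    by (rule basis_exists[of S])
  have sB: "span B = S" using B assms(1) by (simp add: span_minimal subset_antisym)
  have i: "independent (insert r B)" using B(2) assms(2) sB independent_insertI by simp
  define D where "D = extend_basis (insert r B)"
  have D: "independent D" "span D = UNIV" "insert r B \<subseteq> D"
    unfolding D_def
    using independent_extend_basis[OF i] span_extend_basis[OF i] extend_basis_superset[OF i] by auto
  define f where "f x = representation D x r" for x
  have "functional f"
    unfolding functional_def f_def using D by (simp add: representation_add representation_scale)
  moreover have "f x = 0" if "x \<in> S" for x
  proof -
    have "representation D x = representation B x"
      using that D sB by (intro representation_extend) auto
    moreover have "r \<notin> B" using B(1) assms(2) by blast
    ultimately show ?thesis unfolding f_def using representation_ne_zero by metis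
  qed
  moreover have "f r = 1" unfolding f_def using D by (simp add: representation_basis)
  ultimately show ?thesis using that by blast
qed

text \<open>If \<open>a\<close> outside \<open>K\<close> lies in \<open>L\<close> and
  \<open>b\<close> outside \<open>L\<close> lies in \<open>K\<close>, then \<open>a + b\<close>
  avoids both: a vector space is not the union of two proper subspaces.\<close>

lemma subspace_union_proper:
  assumes "subspace K" "subspace L" "subspace S" "\<not> S \<subseteq> K" "\<not> S \<subseteq> L"
  obtains r where "r \<in> S" "r \<notin> K" "r \<notin> L"
proof -
  obtain a b where ab: "a \<in> S" "a \<notin> K" "b \<in> S" "b \<notin> L" using assms by blast
  show ?thesis
  proof (cases "a \<in> L \<and> b \<in> K")
    case True
    have "a + b \<notin> K" using ab True subspace_diff[OF assms(1), of "a + b" b] by auto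
    moreover have "a + b \<notin> L" using ab True subspace_diff[OF assms(2), of "a + b" a] by auto
    ultimately show ?thesis using that[of "a + b"] ab assms(3) subspace_add by blast
  qed (use ab that in blast)
qed

end

section \<open>Hermitian forms and their inertia\<close>

context complex_vector_space
begin

definition fsub :: "'b set \<Rightarrow> bool" where "fsub W \<longleftrightarrow> subspace W \<and> fin_dim W"

lemma fsub_subspace: "fsub W \<Longrightarrow> subspace W"
  and fsub_fin_dim: "fsub W \<Longrightarrow> fin_dim W"
  unfolding fsub_def by simp_all

lemma fsub_subset: "fsub T \<Longrightarrow> subspace S \<Longrightarrow> S \<subseteq> T \<Longrightarrow> fsub S"
  unfolding fsub_def by (auto intro: fin_dim_subset)

lemma fsub_zero: "fsub {0}"
  unfolding fsub_def by (simp add: fin_dim_finite)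

lemma fsub_span_Un: "fsub S \<Longrightarrow> fsub T \<Longrightarrow> fsub (span (S \<union> T))"
  unfolding fsub_def by (simp add: fin_dim_Un fin_dim_span)

lemma fsub_span_insert: "fsub S \<Longrightarrow> fsub (span (insert v S))"
  unfolding fsub_def using fin_dim_Un[OF fin_dim_finite[of "{v}"], of S] by (simp add: fin_dim_span)

lemma fsub_Int: "fsub S \<Longrightarrow> subspace T \<Longrightarrow> fsub (S \<inter> T)"
  by (rule fsub_subset[of S]) (auto simp: fsub_subspace subspace_inter)

lemma fsub_dim_mono: "fsub T \<Longrightarrow> S \<subseteq> T \<Longrightarrow> dim S \<le> dim T"
  by (rule dim_mono_fin_dim) (auto simp: fsub_fin_dim)

lemma fsub_eq_of_dim: "fsub T \<Longrightarrow> subspace S \<Longrightarrow> S \<subseteq> T \<Longrightarrow> dim T \<le> dim S \<Longrightarrow> S = T"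
  by (rule subspace_eq_of_dim) (auto simp: fsub_fin_dim fsub_subspace)

lemma fsub_dim_sum: "fsub S \<Longrightarrow> fsub T \<Longrightarrow> dim (span (S \<union> T)) + dim (S \<inter> T) = dim S + dim T"
  by (rule dim_span_Un_Int) (auto simp: fsub_fin_dim fsub_subspace)

lemma fsub_complement:
  assumes "fsub T" "subspace S" "S \<subseteq> T"
  obtains C where "fsub C" "C \<subseteq> T" "S \<inter> C = {0}" "span (S \<union> C) = T" "dim T = dim S + dim C"
proof -
  obtain C where C: "subspace C" "C \<subseteq> T" "S \<inter> C = {0}" "span (S \<union> C) = T"
    by (rule complement_exists[OF assms(2) fsub_subspace[OF assms(1)] assms(3) fsub_fin_dim[OF assms(1)]])
  have f: "fsub S" "fsub C" using fsub_subset[OF assms(1)] assms(2,3) C by auto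
  have "dim T = dim S + dim C" using fsub_dim_sum[OF f] C by simp
  then show ?thesis using that f(2) C by blast
qed

lemma span_Un_cases:
  assumes "x \<in> span (S \<union> T)" "subspace S" "subspace T"
  obtains a b where "x = a + b" "a \<in> S" "b \<in> T"
proof -
  have sp: "span S = S" "span T = T" using assms(2,3) by (simp_all only: span_eq_iff)
  obtain a b where "x = a + b" "a \<in> span S" "b \<in> span T"
    using assms(1) unfolding span_Un by blast
  then show ?thesis using that unfolding sp by blast
qed

lemma span_insert_cases:
  assumes "x \<in> span (insert v S)" "subspace S"
  obtains a c where "x = a + c *s v" "a \<in> S"
proof -
  have sS: "span S = S" using assms(2) by (simp only: span_eq_iff)
  obtain k where "x - k *s v \<in> S"
    using assms(1) sS by (auto simp: span_insert)
  then show ?thesis using that[of "x - k *s v" k] by simp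
qed

definition herm :: "('b \<Rightarrow> 'b \<Rightarrow> complex) \<Rightarrow> bool" where
  "herm h \<longleftrightarrow> (\<forall>x y z. h (x + y) z = h x z + h y z) \<and> (\<forall>c x y. h (c *s x) y = c * h x y)
     \<and> (\<forall>x y. h y x = cnj (h x y))"

lemma hermI:
  assumes "\<And>x y z. h (x + y) z = h x z + h y z" "\<And>c x y. h (c *s x) y = c * h x y"
    and "\<And>x y. h y x = cnj (h x y)"
  shows "herm h"
  unfolding herm_def using assms by (intro conjI allI)

lemma herm_add_left: "herm h \<Longrightarrow> h (x + y) z = h x z + h y z"
  unfolding herm_def by (elim conjE) blast

lemma herm_scale_left: "herm h \<Longrightarrow> h (c *s x) y = c * h x y"
  unfolding herm_def by (elim conjE) blast

lemma herm_sym: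
  assumes "herm h" shows "h y x = cnj (h x y)"
proof -
  have "\<forall>x y. h y x = cnj (h x y)" using assms unfolding herm_def by (elim conjE)
  then show ?thesis by blast
qed

lemma herm_add_right:
  assumes "herm h" shows "h z (x + y) = h z x + h z y"
  unfolding herm_sym[OF assms, of z "x + y"] herm_sym[OF assms, of z x] herm_sym[OF assms, of z y]
  by (simp add: herm_add_left[OF assms])

lemma herm_scale_right:
  assumes "herm h" shows "h x (c *s y) = cnj c * h x y"
  unfolding herm_sym[OF assms, of x "c *s y"] herm_sym[OF assms, of x y]
  by (simp add: herm_scale_left[OF assms])

lemma herm_zero_left: "herm h \<Longrightarrow> h 0 y = 0"
  using herm_scale_left[of h 0 0 y] by simp

lemma herm_zero_right: "herm h \<Longrightarrow> h y 0 = 0"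
  using herm_scale_right[of h y 0 0] by simp

lemma herm_diff_left: "herm h \<Longrightarrow> h (x - y) z = h x z - h y z"
  using herm_add_left[of h "x - y" y z] by simp

lemma herm_diff_right: "herm h \<Longrightarrow> h z (x - y) = h z x - h z y"
  using herm_add_right[of h z "x - y" y] by simp

lemma herm_minus_left: "herm h \<Longrightarrow> h (- x) z = - h x z"
  using herm_diff_left[of h 0 x z] herm_zero_left[of h z] by simp

lemma herm_minus_right: "herm h \<Longrightarrow> h z (- x) = - h z x"
  using herm_diff_right[of h z 0 x] herm_zero_right[of h z] by simp

lemmas herm_simps = herm_add_left herm_scale_left herm_add_right herm_scale_right
  herm_zero_left herm_zero_right herm_diff_left herm_diff_right herm_minus_left herm_minus_right

lemma herm_zero_sym: "herm h \<Longrightarrow> h x y = 0 \<Longrightarrow> h y x = 0"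
  using herm_sym[of h y x] by simp

lemma herm_self: "herm h \<Longrightarrow> h x x = of_real (Re (h x x))"
  using herm_sym[of h x x] by (simp add: complex_eq_iff)

lemma herm_self_eq_0: "herm h \<Longrightarrow> Re (h x x) = 0 \<Longrightarrow> h x x = 0"
  using herm_self[of h x] by simp

lemma herm_uminus:
  assumes "herm h" shows "herm (\<lambda>x y. - h x y)"
proof (rule hermI)
  show "- h y x = cnj (- h x y)" for x y using herm_sym[OF assms, of y x] by simp
qed (simp_all add: herm_simps[OF assms])

lemma functional_herm: "herm h \<Longrightarrow> functional (\<lambda>x. h x w)"
  unfolding functional_def by (simp add: herm_simps)

section \<open>Orthogonal complements and radicals\<close>

definition perp :: "('b \<Rightarrow> 'b \<Rightarrow> complex) \<Rightarrow> 'b set \<Rightarrow> 'b set \<Rightarrow> 'b set" where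
  "perp h K W = {x \<in> W. \<forall>y\<in>K. h x y = 0}"

abbreviation radical :: "('b \<Rightarrow> 'b \<Rightarrow> complex) \<Rightarrow> 'b set \<Rightarrow> 'b set" where
  "radical h W \<equiv> perp h W W"

lemma perp_subset: "perp h K W \<subseteq> W"
  unfolding perp_def by blast

lemma perp_uminus [simp]: "perp (\<lambda>x y. - h x y) K W = perp h K W"
  unfolding perp_def by simp

lemma subspace_perp: "herm h \<Longrightarrow> subspace W \<Longrightarrow> subspace (perp h K W)"
  unfolding perp_def subspace_def by (simp add: herm_simps)

lemma fsub_perp: "herm h \<Longrightarrow> fsub W \<Longrightarrow> fsub (perp h K W)"
  by (rule fsub_subset[OF _ _ perp_subset]) (simp_all add: subspace_perp fsub_subspace)

lemma perp_span: 
  assumes "herm h" shows "perp h (span B) W = perp h B W"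
proof -
  have "h x y = 0" if "\<forall>y\<in>B. h x y = 0" "y \<in> span B" for x y
    using that(2)
  proof (induction rule: span_induct)
    case base show ?case by (simp add: subspace_def herm_simps[OF assms])
  qed (use that in blast)
  then show ?thesis unfolding perp_def using span_base by blast
qed

text \<open>Each vector of a basis of \<open>T\<close> imposes one linear condition on
  \<open>S\<close> and so lowers the dimension by at most one.\<close>

lemma dim_perp_ge:
  assumes "herm h" "fsub S" "fsub T"
  shows "dim S \<le> dim (perp h T S) + dim T"
proof -
  obtain B where B: "finite B" "independent B" "B \<subseteq> T" "span B = T" "card B = dim T"
    by (rule fin_dim_basis[OF fsub_subspace[OF assms(3)] fsub_fin_dim[OF assms(3)]])
  have "dim S \<le> dim (perp h B S) + card B" using B(1)
  proof (induction B rule: finite_induct)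
    case empty
    then show ?case by (simp add: perp_def)
  next
    case (insert y F)
    have "perp h (insert y F) S = {x \<in> perp h F S. h x y = 0}" unfolding perp_def by auto
    then have "dim (perp h F S) \<le> Suc (dim (perp h (insert y F) S))"
      using dim_kernel_functional[OF functional_herm[OF assms(1)], of "perp h F S" y]
        fsub_perp[OF assms(1,2)] by (simp add: fsub_def)
    then show ?case using insert by simp
  qed
  then show ?thesis using perp_span[OF assms(1)] B by metis
qed

section \<open>Positive and negative index of inertia\<close>

definition pos_on :: "('b \<Rightarrow> 'b \<Rightarrow> complex) \<Rightarrow> 'b set \<Rightarrow> bool" where
  "pos_on h S \<longleftrightarrow> (\<forall>x\<in>S. x \<noteq> 0 \<longrightarrow> 0 < Re (h x x))"

definition nonpos_on :: "('b \<Rightarrow> 'b \<Rightarrow> complex) \<Rightarrow> 'b set \<Rightarrow> bool" where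
  "nonpos_on h S \<longleftrightarrow> (\<forall>x\<in>S. Re (h x x) \<le> 0)"

text \<open>Inertia is defined by definite subspaces rather than by eigenvalues. It then makes sense
  on every subspace without coordinates, and it depends only on the diagonal values
  \<open>h x x\<close>.\<close>

definition posi :: "('b \<Rightarrow> 'b \<Rightarrow> complex) \<Rightarrow> 'b set \<Rightarrow> nat" where
  "posi h W = Max {dim S |S. subspace S \<and> S \<subseteq> W \<and> pos_on h S}"

definition negi :: "('b \<Rightarrow> 'b \<Rightarrow> complex) \<Rightarrow> 'b set \<Rightarrow> nat" where
  "negi h W = posi (\<lambda>x y. - h x y) W"

lemma posi_set_finite: "fsub W \<Longrightarrow> finite {dim S |S. subspace S \<and> S \<subseteq> W \<and> pos_on h S}"
  by (rule finite_subset[of _ "{..dim W}"]) (use fsub_dim_mono in blast, simp)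

lemma posi_ge: "fsub W \<Longrightarrow> subspace S \<Longrightarrow> S \<subseteq> W \<Longrightarrow> pos_on h S \<Longrightarrow> dim S \<le> posi h W"
  unfolding posi_def by (intro Max_ge posi_set_finite) auto

lemma posi_attained:
  assumes "fsub W"
  obtains P where "fsub P" "P \<subseteq> W" "pos_on h P" "dim P = posi h W"
proof -
  let ?A = "{dim S |S. subspace S \<and> S \<subseteq> W \<and> pos_on h S}"
  have "dim {0} \<in> ?A"
    using subspace_0[OF fsub_subspace[OF assms]]
    by (intro CollectI exI[of _ "{0}"]) (simp add: pos_on_def)
  then have "Max ?A \<in> ?A" by (intro Max_in posi_set_finite[OF assms]) auto
  then obtain P where "subspace P" "P \<subseteq> W" "pos_on h P" "dim P = posi h W"
    unfolding posi_def by auto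
  then show ?thesis using that fsub_subset[OF assms] by blast
qed

lemma posi_mono:
  assumes "fsub W" "fsub V" "V \<subseteq> W" shows "posi h V \<le> posi h W"
proof -
  obtain P where "fsub P" "P \<subseteq> V" "pos_on h P" "dim P = posi h V"
    by (rule posi_attained[OF assms(2)])
  then show ?thesis using posi_ge[OF assms(1), of P h] assms(3) fsub_subspace by simp
qed

lemma posi_cong:
  assumes "\<And>x. x \<in> W \<Longrightarrow> h x x = h' x x" shows "posi h W = posi h' W"
proof -
  have "pos_on h S \<longleftrightarrow> pos_on h' S" if "S \<subseteq> W" for S
    unfolding pos_on_def using assms that by (metis subsetD)
  then show ?thesis unfolding posi_def by metis
qed

lemma negi_cong:
  assumes "\<And>x. x \<in> W \<Longrightarrow> h x x = h' x x" shows "negi h W = negi h' W"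
  unfolding negi_def using assms by (intro posi_cong) simp

lemma posi_le_dim:
  assumes "fsub W" shows "posi h W \<le> dim W"
proof -
  obtain P where "fsub P" "P \<subseteq> W" "pos_on h P" "dim P = posi h W"
    by (rule posi_attained[OF assms])
  then show ?thesis using fsub_dim_mono[OF assms, of P] by simp
qed

text \<open>A nonpositive and a positive subspace meet only in 0. Upper bounds on
  \<open>posi\<close> are obtained by exhibiting a large nonpositive space.\<close>

lemma nonpos_dim:
  assumes "fsub W" "subspace Q" "Q \<subseteq> W" "nonpos_on h Q"
  shows "dim Q + posi h W \<le> dim W"
proof -
  obtain P where P: "fsub P" "P \<subseteq> W" "pos_on h P" "dim P = posi h W"
    by (rule posi_attained[OF assms(1)])
  have Q: "fsub Q" using fsub_subset assms by blast
  have "x = 0" if "x \<in> Q \<inter> P" for x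
    using that P(3) assms(4) unfolding pos_on_def nonpos_on_def by fastforce
  then have "Q \<inter> P = {0}" using subspace_0 fsub_subspace P(1) assms(2) by blast
  then have "dim (span (Q \<union> P)) = dim Q + dim P"
    using fsub_dim_sum[OF Q P(1)] by simp
  moreover have "span (Q \<union> P) \<subseteq> W"
    using assms P by (intro span_minimal) (auto simp: fsub_subspace)
  ultimately show ?thesis using fsub_dim_mono[OF assms(1)] P(4) by metis
qed

lemma herm_self_add:
  assumes "herm h" shows "Re (h (x + y) (x + y)) = Re (h x x) + Re (h y y) + 2 * Re (h x y)"
  using herm_sym[OF assms, of y x] by (simp add: herm_simps[OF assms])

lemma herm_self_scale:
  assumes "herm h" shows "Re (h (c *s x) (c *s x)) = (cmod c)\<^sup>2 * Re (h x x)"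
proof -
  have "h (c *s x) (c *s x) = (c * cnj c) * h x x" by (simp add: herm_simps[OF assms])
  then show ?thesis unfolding complex_norm_square[symmetric] by simp
qed

lemma pos_on_nonneg: "herm h \<Longrightarrow> pos_on h S \<Longrightarrow> x \<in> S \<Longrightarrow> 0 \<le> Re (h x x)"
  unfolding pos_on_def by (cases "x = 0") (auto simp: herm_zero_left less_imp_le)

lemma pos_on_span_insert:
  assumes h: "herm h" and P: "subspace P" "pos_on h P"
    and x: "\<And>a. a \<in> P \<Longrightarrow> h x a = 0" "0 < Re (h x x)"
  shows "pos_on h (span (insert x P))"
  unfolding pos_on_def
proof (intro ballI impI)
  fix y assume y: "y \<in> span (insert x P)" "y \<noteq> 0"
  obtain a c where ac: "y = a + c *s x" "a \<in> P" by (rule span_insert_cases[OF y(1) P(1)])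
  have "h a x = 0" by (rule herm_zero_sym[OF h x(1)[OF ac(2)]])
  then have "h a (c *s x) = 0" by (simp add: herm_scale_right[OF h])
  then have e: "Re (h y y) = Re (h a a) + (cmod c)\<^sup>2 * Re (h x x)"
    by (simp add: ac(1) herm_self_add[OF h] herm_self_scale[OF h])
  show "0 < Re (h y y)"
  proof (cases "a = 0")
    case True
    then have "c \<noteq> 0" using y ac by auto
    then show ?thesis using e x(2) True herm_zero_left[OF h] by simp
  next
    case False
    then have "0 < Re (h a a)" using P(2) ac(2) unfolding pos_on_def by blast
    then show ?thesis using e x(2) by (simp add: add_pos_nonneg)
  qed
qed

text \<open>On \<open>P\<close> the form is definite, so \<open>P\<close> and its complement split
  \<open>W\<close>. A positive vector in the complement would extend \<open>P\<close> to a larger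
  positive subspace.\<close>

lemma maximal_positive_decompose:
  assumes h: "herm h" and W: "fsub W" and P: "fsub P" "P \<subseteq> W" "pos_on h P" "posi h W \<le> dim P"
  shows "P \<inter> perp h P W = {0}" "span (P \<union> perp h P W) = W" "nonpos_on h (perp h P W)"
    "dim (perp h P W) + posi h W = dim W"
proof -
  let ?Q = "perp h P W"
  have dP: "dim P = posi h W" using posi_ge[OF W fsub_subspace[OF P(1)] P(2,3)] P(4) by simp
  have fQ: "fsub ?Q" by (rule fsub_perp[OF h W])
  have "P \<inter> ?Q \<subseteq> {0}"
  proof
    fix x assume x: "x \<in> P \<inter> ?Q"
    then have "h x x = 0" unfolding perp_def by blast
    then show "x \<in> {0}" using x P(3) unfolding pos_on_def by force
  qed
  then show PQ: "P \<inter> ?Q = {0}"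
    using subspace_0[OF fsub_subspace[OF P(1)]] subspace_0[OF fsub_subspace[OF fQ]] by blast
  have sub: "span (P \<union> ?Q) \<subseteq> W"
    using P(2) perp_subset[of h P W] by (intro span_minimal fsub_subspace[OF W]) auto
  have ds: "dim (span (P \<union> ?Q)) = dim P + dim ?Q" using fsub_dim_sum[OF P(1) fQ] PQ by simp
  have dW: "dim W \<le> dim ?Q + dim P" by (rule dim_perp_ge[OF h W P(1)])
  show sp: "span (P \<union> ?Q) = W"
    by (rule fsub_eq_of_dim[OF W subspace_span sub]) (use ds dW in simp)
  then show "dim ?Q + posi h W = dim W" using ds dP by simp
  have "Re (h x x) \<le> 0" if x: "x \<in> ?Q" for x
  proof (rule ccontr)
    assume neg: "\<not> Re (h x x) \<le> 0"
    then have "x \<noteq> 0" using herm_zero_left[OF h] by force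
    then have xP: "x \<notin> P" using PQ x by blast
    have "pos_on h (span (insert x P))"
      using x neg by (intro pos_on_span_insert[OF h fsub_subspace[OF P(1)] P(3)]) (auto simp: perp_def)
    moreover have "x \<in> W" using x unfolding perp_def by blast
    then have "span (insert x P) \<subseteq> W" using P(2) by (intro span_minimal fsub_subspace[OF W]) auto
    ultimately have "dim (span (insert x P)) \<le> posi h W" by (intro posi_ge[OF W subspace_span])
    then show False
      using dim_span_insert[OF fsub_subspace[OF P(1)] fsub_fin_dim[OF P(1)] xP] dP by simp
  qed
  then show "nonpos_on h ?Q" unfolding nonpos_on_def by blast
qed

lemma posi_decompose:
  assumes "herm h" "fsub W"
  obtains P where "fsub P" "P \<subseteq> W" "pos_on h P" "dim P = posi h W" "P \<inter> perp h P W = {0}"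
    "span (P \<union> perp h P W) = W" "nonpos_on h (perp h P W)" "dim (perp h P W) + posi h W = dim W"
proof -
  obtain P where P: "fsub P" "P \<subseteq> W" "pos_on h P" "dim P = posi h W"
    by (rule posi_attained[OF assms(2)])
  show ?thesis by (rule that[OF P maximal_positive_decompose[OF assms P(1-3)]]) (simp_all add: P(4))
qed

text \<open>The equality case of Cauchy-Schwarz for a semidefinite form: if \<open>h x y\<close>
  were nonzero, the value of the form would be affine and unbounded on the line through
  \<open>y\<close> in the direction of a suitable multiple of \<open>x\<close>.\<close>

lemma nonpos_isotropic:
  assumes h: "herm h" and Q: "subspace Q" "nonpos_on h Q" "x \<in> Q" "y \<in> Q" and x: "h x x = 0"
  shows "h x y = 0"
proof (rule ccontr)
  assume c: "h x y \<noteq> 0"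
  let ?c = "h x y"
  \<comment> \<open>\<open>t\<close> is chosen to give the form the value 1 at
    \<open>z\<close>.\<close>
  define t where "t = (1 - Re (h y y)) / (2 * (cmod ?c)\<^sup>2)"
  define z where "z = y + (of_real t * cnj ?c) *s x"
  have "z \<in> Q" unfolding z_def using Q by (simp add: subspace_add subspace_scale)
  then have le: "Re (h z z) \<le> 0" using Q unfolding nonpos_on_def by blast
  have "h y x = cnj ?c" by (rule herm_sym[OF h])
  then have "h z z = h y y + 2 * of_real t * (?c * cnj ?c)"
    unfolding z_def by (simp add: herm_simps[OF h] x algebra_simps)
  also have "?c * cnj ?c = of_real ((cmod ?c)\<^sup>2)" by (rule complex_norm_square[symmetric])
  finally have "h z z = h y y + of_real (2 * t * (cmod ?c)\<^sup>2)" by simp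
  then have "Re (h z z) = Re (h y y) + 2 * t * (cmod ?c)\<^sup>2" by simp
  also have "\<dots> = 1" using c unfolding t_def by (simp add: field_simps)
  finally show False using le by simp
qed

text \<open>Sylvester's law. In the nonpositive complement of a maximal positive \<open>P\<close>,
  the isotropic vectors are exactly the radical of \<open>W\<close>. A complement \<open>N\<close>
  of the radical there is negative definite, while \<open>P\<close> plus the radical is nonnegative
  and bounds \<open>negi\<close> from above.\<close>

lemma inertia_sum:
  assumes h: "herm h" and W: "fsub W"
  shows "posi h W + negi h W + dim (radical h W) = dim W"
proof -
  obtain P where P: "fsub P" "P \<subseteq> W" "pos_on h P" "dim P = posi h W" "P \<inter> perp h P W = {0}"
    "span (P \<union> perp h P W) = W" "nonpos_on h (perp h P W)" "dim (perp h P W) + posi h W = dim W"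
    by (rule posi_decompose[OF h W])
  let ?Q = "perp h P W" and ?R = "radical h W"
  have fQ: "fsub ?Q" "fsub ?R" using fsub_perp h W by blast+
  have RQ: "?R \<subseteq> ?Q" using P unfolding perp_def by blast
  have R: "x \<in> ?R" if x: "x \<in> ?Q" "h x x = 0" for x
  proof -
    have "h x y = 0" if y: "y \<in> W" for y
    proof -
      have "y \<in> span (P \<union> ?Q)" using y P(6) by simp
      then obtain a b where ab: "y = a + b" "a \<in> P" "b \<in> ?Q"
        by (rule span_Un_cases[OF _ fsub_subspace[OF P(1)] fsub_subspace[OF fQ(1)]])
      have "h x b = 0"
        using nonpos_isotropic[OF h fsub_subspace[OF fQ(1)] P(7) x(1) ab(3) x(2)] .
      moreover have "h x a = 0" using x ab unfolding perp_def by blast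
      ultimately show ?thesis by (simp add: ab herm_simps[OF h])
    qed
    then show ?thesis using x unfolding perp_def by blast
  qed
  obtain N where N: "fsub N" "N \<subseteq> ?Q" "?R \<inter> N = {0}" "span (?R \<union> N) = ?Q" "dim ?Q = dim ?R + dim N"
    by (rule fsub_complement[OF fQ(1) fsub_subspace[OF fQ(2)] RQ])
  have "pos_on (\<lambda>x y. - h x y) N" unfolding pos_on_def
  proof (intro ballI impI)
    fix x assume x: "x \<in> N" "x \<noteq> 0"
    have "Re (h x x) \<le> 0" using x N P(7) unfolding nonpos_on_def by blast
    moreover have "Re (h x x) \<noteq> 0" using R[of x] x N herm_self_eq_0[OF h] by blast
    ultimately show "0 < Re (- h x x)" by simp
  qed
  moreover have "N \<subseteq> W" using N(2) perp_subset by blast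
  ultimately have 1: "dim N \<le> negi h W"
    unfolding negi_def using posi_ge[OF W fsub_subspace[OF N(1)]] by blast
  have "nonpos_on (\<lambda>x y. - h x y) (span (P \<union> ?R))" unfolding nonpos_on_def
  proof
    fix x assume "x \<in> span (P \<union> ?R)"
    then obtain a b where ab: "x = a + b" "a \<in> P" "b \<in> ?R"
      by (rule span_Un_cases[OF _ fsub_subspace[OF P(1)] fsub_subspace[OF fQ(2)]])
    have "h b a = 0" "h b b = 0" using ab P(2) unfolding perp_def by blast+
    moreover have "h a b = 0" using herm_zero_sym[OF h] \<open>h b a = 0\<close> .
    ultimately have "h x x = h a a" by (simp add: ab herm_simps[OF h])
    moreover have "0 \<le> Re (h a a)"
      using P(3) ab(2) herm_zero_left[OF h] unfolding pos_on_def by (cases "a = 0") force+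
    ultimately show "Re (- h x x) \<le> 0" by simp
  qed
  moreover have "span (P \<union> ?R) \<subseteq> W"
    using P(2) perp_subset W by (intro span_minimal) (auto simp: fsub_subspace)
  ultimately have "dim (span (P \<union> ?R)) + negi h W \<le> dim W"
    unfolding negi_def using nonpos_dim[OF W subspace_span] by blast
  moreover have "P \<inter> ?R = {0}" using P(5) RQ subspace_0[OF fsub_subspace[OF fQ(2)]] subspace_0[OF fsub_subspace[OF P(1)]] by blast
  ultimately show ?thesis using fsub_dim_sum[OF P(1) fQ(2)] 1 N(5) P(4,8) by simp
qed

text \<open>Vectors of \<open>K\<close> in the radical impose no condition; those of a complement
  \<open>D\<close> of them in \<open>K\<close> impose independent ones.\<close>

lemma dim_perp:
  assumes h: "herm h" and W: "fsub W" and K: "subspace K" "K \<subseteq> W"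
  shows "dim (perp h K W) + dim K = dim W + dim (K \<inter> radical h W)"
proof -
  let ?R = "radical h W"
  have fK: "fsub K" and fP: "fsub (perp h K W)" and sR: "subspace ?R"
    using fsub_subset fsub_perp subspace_perp assms fsub_subspace by blast+
  have sI: "subspace (K \<inter> ?R)" using K sR by (simp add: subspace_inter)
  obtain D where D: "fsub D" "D \<subseteq> K" "K \<inter> ?R \<inter> D = {0}" "span (K \<inter> ?R \<union> D) = K"
      "dim K = dim (K \<inter> ?R) + dim D"
    by (rule fsub_complement[OF fK sI]) blast+
  have "perp h D W \<subseteq> perp h K W"
  proof
    fix x assume x: "x \<in> perp h D W"
    have "h x y = 0" if "y \<in> K" for y
    proof -
      have "y \<in> span (K \<inter> ?R \<union> D)" using that D by simp
      then obtain a b where ab: "y = a + b" "a \<in> K \<inter> ?R" "b \<in> D"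
        by (rule span_Un_cases[OF _ sI fsub_subspace[OF D(1)]])
      have "h a x = 0" "h x b = 0" using ab x unfolding perp_def by blast+
      then show ?thesis using herm_zero_sym[OF h] by (simp add: ab herm_simps[OF h])
    qed
    then show "x \<in> perp h K W" using x unfolding perp_def by blast
  qed
  then have "dim W \<le> dim (perp h K W) + dim D"
    using dim_perp_ge[OF h W D(1)] fsub_dim_mono[OF fP] by (meson add_le_mono1 order_trans)
  moreover obtain C where C: "fsub C" "C \<subseteq> W" "perp h K W \<inter> C = {0}" "span (perp h K W \<union> C) = W"
      "dim W = dim (perp h K W) + dim C"
    by (rule fsub_complement[OF W fsub_subspace[OF fP] perp_subset])
  \<comment> \<open>\<open>D\<close> is paired nondegenerately with \<open>C\<close>: a vector of
    \<open>D\<close> is orthogonal to \<open>perp h K W\<close> because it lies in \<open>K\<close>,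
    so orthogonality to \<open>C\<close> as well puts it into the radical.\<close>
  moreover have "perp h C D \<subseteq> {0}"
  proof
    fix r assume r: "r \<in> perp h C D"
    have "h r y = 0" if "y \<in> W" for y
    proof -
      have "y \<in> span (perp h K W \<union> C)" using that C by simp
      then obtain a b where ab: "y = a + b" "a \<in> perp h K W" "b \<in> C"
        by (rule span_Un_cases[OF _ fsub_subspace[OF fP] fsub_subspace[OF C(1)]])
      have "r \<in> K" using r D(2) unfolding perp_def by blast
      then have "h a r = 0" "h r b = 0" using ab r unfolding perp_def by blast+
      then show ?thesis using herm_zero_sym[OF h] by (simp add: ab herm_simps[OF h])
    qed
    then have "r \<in> K \<inter> ?R \<inter> D" using r K D(2) unfolding perp_def by blast
    then show "r \<in> {0}" using D by blast
  qed
  then have "dim (perp h C D) \<le> 0" using fsub_dim_mono[OF fsub_zero] dim_zero_subspace by metis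
  then have "dim D \<le> dim C" using dim_perp_ge[OF h D(1) C(1)] by simp
  ultimately show ?thesis using D(5) by linarith
qed

text \<open>One inclusion is immediate; \<open>dim_perp\<close>, applied to \<open>K\<close> and to
  its complement, makes the dimensions agree.\<close>

lemma perp_perp:
  assumes h: "herm h" and W: "fsub W" and K: "subspace K" "K \<subseteq> W"
  shows "perp h (perp h K W) W = span (K \<union> radical h W)"
proof -
  let ?R = "radical h W" and ?P = "perp h K W"
  have fK: "fsub K" "fsub ?P" "fsub ?R" "fsub (perp h ?P W)"
    using fsub_subset fsub_perp assms by blast+
  have sub: "span (K \<union> ?R) \<subseteq> perp h ?P W"
  proof (rule span_minimal)
    have "x \<in> perp h ?P W" if "x \<in> K" for x
      using that K herm_zero_sym[OF h] unfolding perp_def by blast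
    moreover have "x \<in> perp h ?P W" if "x \<in> ?R" for x
      using that unfolding perp_def by blast
    ultimately show "K \<union> ?R \<subseteq> perp h ?P W" by blast
  qed (use fK fsub_subspace in blast)
  have "?R \<subseteq> ?P" using K unfolding perp_def by blast
  then have "?P \<inter> ?R = ?R" by blast
  then have "dim (perp h ?P W) + dim ?P = dim W + dim ?R"
    using dim_perp[OF h W fsub_subspace[OF fK(2)] perp_subset] by simp
  then have "dim (perp h ?P W) = dim (span (K \<union> ?R))"
    using dim_perp[OF h W K] fsub_dim_sum[OF fK(1,3)] by simp
  then show ?thesis using fsub_eq_of_dim[OF fK(4) subspace_span sub] by simp
qed


lemma endo_linearI:
  assumes "\<And>x y. f (x + y) = f x + f y" "\<And>c x. f (c *s x) = c *s f x"
  shows "Vector_Spaces.linear scale scale f"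
  by unfold_locales (use assms in auto)

section \<open>Additivity of inertia over a subspace and its orthogonal complement\<close>

text \<open>Maximal nonpositive subspaces of \<open>K\<close> and of its complement are orthogonal
  to each other, so their sum is nonpositive; they overlap at most in the radical of
  \<open>K\<close>.\<close>

lemma posi_split_le:
  assumes h: "herm h" and W: "fsub W" and K: "subspace K" "K \<subseteq> W"
  shows "posi h W + dim (K \<inter> radical h W) \<le> posi h K + dim (radical h K) + posi h (perp h K W)"
proof -
  let ?Kp = "perp h K W"
  have fK: "fsub K" by (rule fsub_subset[OF W K])
  have fKp: "fsub ?Kp" by (rule fsub_perp[OF h W])
  have fR: "fsub (radical h K)" by (rule fsub_perp[OF h fK])
  obtain P1 where P1: "nonpos_on h (perp h P1 K)" "dim (perp h P1 K) + posi h K = dim K"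
    by (rule posi_decompose[OF h fK])
  obtain P2 where P2: "nonpos_on h (perp h P2 ?Kp)" "dim (perp h P2 ?Kp) + posi h ?Kp = dim ?Kp"
    by (rule posi_decompose[OF h fKp])
  define Q1 Q2 where "Q1 = perp h P1 K" and "Q2 = perp h P2 ?Kp"
  have Q: "fsub Q1" "fsub Q2" "Q1 \<subseteq> K" "Q2 \<subseteq> ?Kp"
    unfolding Q1_def Q2_def using fsub_perp[OF h] fK fKp perp_subset by auto
  have "nonpos_on h (span (Q1 \<union> Q2))" unfolding nonpos_on_def
  proof
    fix x assume "x \<in> span (Q1 \<union> Q2)"
    then obtain a b where ab: "x = a + b" "a \<in> Q1" "b \<in> Q2"
      by (rule span_Un_cases[OF _ fsub_subspace[OF Q(1)] fsub_subspace[OF Q(2)]])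
    have "h b a = 0" using ab Q unfolding perp_def by blast
    then have "h a b = 0" by (rule herm_zero_sym[OF h])
    then show "Re (h x x) \<le> 0"
      using ab P1(1) P2(1) unfolding nonpos_on_def Q1_def[symmetric] Q2_def[symmetric]
      by (auto simp: ab(1) herm_self_add[OF h] intro!: add_nonpos_nonpos)
  qed
  moreover have "span (Q1 \<union> Q2) \<subseteq> W"
    using Q(3,4) K(2) perp_subset[of h K W] fsub_subspace[OF W] by (intro span_minimal) auto
  ultimately have "dim (span (Q1 \<union> Q2)) + posi h W \<le> dim W"
    by (intro nonpos_dim[OF W subspace_span])
  moreover have "Q1 \<inter> Q2 \<subseteq> radical h K" using Q(3,4) unfolding perp_def by blast
  then have "dim (Q1 \<inter> Q2) \<le> dim (radical h K)" by (rule fsub_dim_mono[OF fR])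
  moreover have "dim (span (Q1 \<union> Q2)) + dim (Q1 \<inter> Q2) = dim Q1 + dim Q2"
    by (rule fsub_dim_sum[OF Q(1,2)])
  moreover have "dim ?Kp + dim K = dim W + dim (K \<inter> radical h W)" by (rule dim_perp[OF h W K])
  ultimately show ?thesis using P1(2) P2(2) unfolding Q1_def[symmetric] Q2_def[symmetric] by linarith
qed

text \<open>A maximal nonpositive subspace \<open>Q\<close> meets the nonnegative subspace \<open>M\<close> built below in a
  set \<open>R1\<close> of isotropic vectors; both \<open>Q\<close> and \<open>M\<close> lie in the orthogonal complement of \<open>R1\<close>,
  which gives the dimension bound.\<close>

lemma posi_split_ge:
  assumes h: "herm h" and W: "fsub W" and K: "subspace K" "K \<subseteq> W"
  shows "posi h K + dim (radical h K) + posi h (perp h K W) \<le> posi h W + dim (K \<inter> radical h W)"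
proof -
  let ?Kp = "perp h K W" and ?R = "radical h W" and ?RK = "radical h K"
  have fK: "fsub K" by (rule fsub_subset[OF W K])
  have fKp: "fsub ?Kp" by (rule fsub_perp[OF h W])
  have fR: "fsub ?R" by (rule fsub_perp[OF h W])
  have fRK: "fsub ?RK" by (rule fsub_perp[OF h fK])
  obtain P1 where P1: "fsub P1" "P1 \<subseteq> K" "pos_on h P1" "dim P1 = posi h K"
    by (rule posi_attained[OF fK])
  obtain P2 where P2: "fsub P2" "P2 \<subseteq> ?Kp" "pos_on h P2" "dim P2 = posi h ?Kp"
    by (rule posi_attained[OF fKp])
  have sI: "subspace (K \<inter> ?R)" using K fsub_subspace[OF fR] by (simp add: subspace_inter)
  have IRK: "K \<inter> ?R \<subseteq> ?RK" using K unfolding perp_def by blast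
  \<comment> \<open>\<open>R0\<close> is the part of the radical of \<open>K\<close> that the
    radical of \<open>W\<close> does not account for. It is isotropic, yet it adds to
    \<open>dim M\<close>, and this is the surplus to be gained.\<close>
  obtain R0 where R0: "fsub R0" "R0 \<subseteq> ?RK" "K \<inter> ?R \<inter> R0 = {0}" "dim ?RK = dim (K \<inter> ?R) + dim R0"
    using fsub_complement[OF fRK sI IRK] .
  have orth12: "h x y = 0" if "x \<in> P1" "y \<in> P2" for x y
  proof -
    have "h y x = 0" using that P1(2) P2(2) unfolding perp_def by blast
    then show ?thesis by (rule herm_zero_sym[OF h])
  qed
  have orthR: "h r x = 0" if "r \<in> R0" "x \<in> K \<union> ?Kp" for r x
  proof (cases "x \<in> K")
    case True then show ?thesis using that R0(2) unfolding perp_def by blast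
  next
    case False
    then have "h x r = 0" using that R0(2) unfolding perp_def by blast
    then show ?thesis by (rule herm_zero_sym[OF h])
  qed
  define M where "M = span (span (P1 \<union> P2) \<union> R0)"
  have f12: "fsub (span (P1 \<union> P2))" by (rule fsub_span_Un[OF P1(1) P2(1)])
  have fM: "fsub M" unfolding M_def by (rule fsub_span_Un[OF f12 R0(1)])
  have Mcases: "\<exists>a b r. x = (a + b) + r \<and> a \<in> P1 \<and> b \<in> P2 \<and> r \<in> R0
      \<and> Re (h x x) = Re (h a a) + Re (h b b)" if x: "x \<in> M" for x
  proof -
    obtain c r where c: "x = c + r" "c \<in> span (P1 \<union> P2)" "r \<in> R0"
      using x unfolding M_def by (rule span_Un_cases[OF _ fsub_subspace[OF f12] fsub_subspace[OF R0(1)]])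
    obtain a b where ab: "c = a + b" "a \<in> P1" "b \<in> P2"
      using c(2) by (rule span_Un_cases[OF _ fsub_subspace[OF P1(1)] fsub_subspace[OF P2(1)]])
    have ra: "h r a = 0" "h r b = 0" "h r r = 0"
      using orthR[OF c(3)] ab P1(2) P2(2) R0(2) c(3) perp_subset[of h K K] by blast+
    have ar: "h a r = 0" "h b r = 0" using ra herm_zero_sym[OF h] by blast+
    have "h a b = 0" by (rule orth12[OF ab(2,3)])
    moreover have "h b a = 0" by (rule herm_zero_sym[OF h \<open>h a b = 0\<close>])
    ultimately have "Re (h x x) = Re (h a a) + Re (h b b)"
      using ra ar by (simp add: c(1) ab(1) herm_simps[OF h])
    then show ?thesis using c ab by blast
  qed
  have "P1 \<inter> P2 \<subseteq> {0}"
  proof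
    fix x assume x: "x \<in> P1 \<inter> P2"
    then have "h x x = 0" using orth12 by blast
    then show "x \<in> {0}" using x P1(3) unfolding pos_on_def by force
  qed
  then have i12: "P1 \<inter> P2 = {0}"
    using subspace_0[OF fsub_subspace[OF P1(1)]] subspace_0[OF fsub_subspace[OF P2(1)]] by blast
  have "span (P1 \<union> P2) \<inter> R0 \<subseteq> {0}"
  proof
    fix x assume x: "x \<in> span (P1 \<union> P2) \<inter> R0"
    then obtain a b where ab: "x = a + b" "a \<in> P1" "b \<in> P2"
      using span_Un_cases[OF _ fsub_subspace[OF P1(1)] fsub_subspace[OF P2(1)]] by blast
    have "h x a = 0" "h x b = 0" using orthR[of x] x ab P1(2) P2(2) by blast+
    moreover have "h b a = 0" "h a b = 0" using orth12[OF ab(2,3)] herm_zero_sym[OF h] by blast+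
    ultimately have "h a a = 0" "h b b = 0" by (simp_all add: ab(1) herm_simps[OF h])
    then have "a = 0" "b = 0" using ab P1(3) P2(3) unfolding pos_on_def by force+
    then show "x \<in> {0}" using ab by simp
  qed
  then have i3: "span (P1 \<union> P2) \<inter> R0 = {0}"
    using subspace_0[OF subspace_span] subspace_0[OF fsub_subspace[OF R0(1)]] by blast
  have dM: "dim M = dim P1 + dim P2 + dim R0"
    unfolding M_def using fsub_dim_sum[OF f12 R0(1)] fsub_dim_sum[OF P1(1) P2(1)] i12 i3 by simp
  obtain P where P: "nonpos_on h (perp h P W)" "dim (perp h P W) + posi h W = dim W"
    by (rule posi_decompose[OF h W])
  define Q where "Q = perp h P W"
  have fQ: "fsub Q" "Q \<subseteq> W" unfolding Q_def using fsub_perp[OF h W] perp_subset by auto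
  define R1 where "R1 = Q \<inter> M"
  have fR1: "fsub R1" unfolding R1_def by (rule fsub_Int[OF fQ(1) fsub_subspace[OF fM]])
  \<comment> \<open>On \<open>M\<close> only the components in \<open>P1\<close> and
    \<open>P2\<close> contribute to \<open>h x x\<close>; nonpositivity on \<open>Q\<close> forces
    both to vanish.\<close>
  have R1R0: "x \<in> R0" if x: "x \<in> R1" for x
  proof -
    obtain a b r where abr: "x = (a + b) + r" "a \<in> P1" "b \<in> P2" "r \<in> R0"
        "Re (h x x) = Re (h a a) + Re (h b b)"
      using Mcases x unfolding R1_def by blast
    have "Re (h x x) \<le> 0" using x P(1) unfolding R1_def Q_def nonpos_on_def by blast
    moreover have "0 \<le> Re (h a a)" "0 \<le> Re (h b b)"
      using pos_on_nonneg[OF h P1(3) abr(2)] pos_on_nonneg[OF h P2(3) abr(3)] .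
    ultimately have "Re (h a a) = 0" "Re (h b b) = 0" using abr(5) by linarith+
    then have "a = 0" "b = 0" using abr P1(3) P2(3) unfolding pos_on_def by force+
    then show ?thesis using abr by simp
  qed
  have "h x r = 0" if r: "r \<in> R1" and x: "x \<in> Q \<union> M" for r x
  proof (cases "x \<in> Q")
    case True
    have "r \<in> R0" by (rule R1R0[OF r])
    then have "h r r = 0" using orthR[of r r] R0(2) perp_subset[of h K K] by blast
    then have "h r x = 0"
      using nonpos_isotropic[OF h fsub_subspace[OF fQ(1)], of r x] P(1) r True
      unfolding R1_def Q_def by blast
    then show ?thesis by (rule herm_zero_sym[OF h])
  next
    case False
    then obtain a b s where abr: "x = (a + b) + s" "a \<in> P1" "b \<in> P2" "s \<in> R0"
      using Mcases x by blast
    have "h r a = 0" "h r b = 0" "h r s = 0"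
      using orthR[OF R1R0[OF r]] abr P1(2) P2(2) R0(2) perp_subset[of h K K] by blast+
    then have "h r x = 0" by (simp add: abr(1) herm_simps[OF h])
    then show ?thesis by (rule herm_zero_sym[OF h])
  qed
  moreover have MW: "M \<subseteq> W" unfolding M_def
    using P1(2) P2(2) R0(2) K(2) perp_subset[of h K W] perp_subset[of h K K] fsub_subspace[OF W]
    by (intro span_minimal Un_least) auto
  ultimately have "Q \<union> M \<subseteq> perp h R1 W" using fQ(2) unfolding perp_def by blast
  then have "span (Q \<union> M) \<subseteq> perp h R1 W"
    using fsub_subspace[OF fsub_perp[OF h W]] by (intro span_minimal)
  then have "dim (span (Q \<union> M)) \<le> dim (perp h R1 W)" by (rule fsub_dim_mono[OF fsub_perp[OF h W]])
  moreover have R1W: "R1 \<subseteq> W" unfolding R1_def using fQ(2) by blast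
  have "dim (perp h R1 W) + dim R1 = dim W + dim (R1 \<inter> ?R)"
    by (rule dim_perp[OF h W fsub_subspace[OF fR1] R1W])
  \<comment> \<open>As \<open>R1\<close> meets the radical of \<open>W\<close> trivially, its
    complement has codimension exactly \<open>dim R1\<close>, which cancels the overlap of
    \<open>Q\<close> and \<open>M\<close>.\<close>
  moreover have "R1 \<inter> ?R \<subseteq> {0}"
  proof
    fix x assume x: "x \<in> R1 \<inter> ?R"
    then have "x \<in> R0" "x \<in> K" using R1R0 R0(2) perp_subset[of h K K] by blast+
    then show "x \<in> {0}" using x R0(3) by blast
  qed
  then have "dim (R1 \<inter> ?R) = 0" using fsub_dim_mono[OF fsub_zero] by fastforce
  moreover have "dim (span (Q \<union> M)) + dim R1 = dim Q + dim M"
    unfolding R1_def by (rule fsub_dim_sum[OF fQ(1) fM])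
  ultimately have "dim Q + dim M \<le> dim W" by linarith
  then show ?thesis using dM P1(4) P2(4) R0(4) P(2) unfolding Q_def[symmetric] by linarith
qed

text \<open>Additivity for a possibly degenerate \<open>K\<close>. A vector of the radical of
  \<open>K\<close> outside the radical of \<open>W\<close> spans a hyperbolic plane with a vector
  outside the sum of \<open>K\<close> and its complement; such directions therefore count once in
  each index.\<close>

lemma posi_split:
  assumes "herm h" "fsub W" "subspace K" "K \<subseteq> W"
  shows "posi h W + dim (K \<inter> radical h W) = posi h K + dim (radical h K) + posi h (perp h K W)"
  using posi_split_le[OF assms] posi_split_ge[OF assms] by (rule antisym)

lemma negi_split:
  assumes "herm h" "fsub W" "subspace K" "K \<subseteq> W"
  shows "negi h W + dim (K \<inter> radical h W) = negi h K + dim (radical h K) + negi h (perp h K W)"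
  using posi_split[OF herm_uminus[OF assms(1)] assms(2-4)] by (simp add: negi_def)

text \<open>If \<open>P\<close> were maximal, the isotropic vector \<open>r\<close> would lie in its
  nonpositive complement and, by \<open>nonpos_isotropic\<close>, be orthogonal to all of
  \<open>W\<close>, including \<open>w\<close>.\<close>

lemma posi_extend:
  assumes h: "herm h" and W: "fsub W" and P: "subspace P" "P \<subseteq> W" "pos_on h P"
    and r: "r \<in> W" "\<And>x. x \<in> P \<Longrightarrow> h r x = 0" "h r r = 0" "w \<in> W" "h r w \<noteq> 0"
  shows "Suc (dim P) \<le> posi h W"
proof (rule ccontr)
  assume "\<not> Suc (dim P) \<le> posi h W"
  then have dP: "posi h W \<le> dim P" by simp
  note md = maximal_positive_decompose[OF h W fsub_subset[OF W P(1,2)] P(2,3) dP]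
  let ?Q = "perp h P W"
  have sQ: "subspace ?Q" by (rule subspace_perp[OF h fsub_subspace[OF W]])
  have rQ: "r \<in> ?Q" using r(1,2) unfolding perp_def by blast
  have "w \<in> span (P \<union> ?Q)" using r(4) md(2) by simp
  then obtain a b where ab: "w = a + b" "a \<in> P" "b \<in> ?Q" by (rule span_Un_cases[OF _ P(1) sQ])
  have "h r b = 0" by (rule nonpos_isotropic[OF h sQ md(3) rQ ab(3) r(3)])
  then show False using r(2)[OF ab(2)] r(5) by (simp add: ab(1) herm_simps[OF h])
qed

text \<open>The kernel of \<open>f\<close> on \<open>S\<close> is isotropic for \<open>h'\<close>,
  so positive subspaces of \<open>S\<close> are mapped injectively; those of \<open>T\<close> lift
  through a section. This transfers inertia between spaces of different dimension.\<close>

lemma posi_pullback: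
  assumes f: "Vector_Spaces.linear scale scale f" and S: "fsub S" and T: "f ` S = T"
    and h: "herm h" and eq: "\<And>x. x \<in> S \<Longrightarrow> h' x x = h (f x) (f x)"
  shows "posi h' S = posi h T"
proof -
  interpret f: Vector_Spaces.linear scale scale f by fact
  have fT: "fsub T"
    using f.subspace_image[OF fsub_subspace[OF S]] fin_dim_image[OF f fsub_fin_dim[OF S]] T
    by (simp add: fsub_def)
  show ?thesis
  proof (rule antisym)
    obtain P where P: "fsub P" "P \<subseteq> S" "pos_on h' P" "dim P = posi h' S"
      by (rule posi_attained[OF S])
    obtain C where C: "subspace C" "C \<subseteq> P" "f ` C = f ` P" "dim C = dim (f ` P)"
        "dim P = dim C + dim {x \<in> P. f x = 0}"
      by (rule linear_section[OF f fsub_subspace[OF P(1)] fsub_fin_dim[OF P(1)]])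
    have nz: "f x \<noteq> 0" if "x \<in> P" "x \<noteq> 0" for x
    proof
      assume "f x = 0"
      then have "h' x x = 0" using eq[of x] that P(2) herm_zero_left[OF h] by auto
      then show False using that P(3) unfolding pos_on_def by force
    qed
    have "{x \<in> P. f x = 0} \<subseteq> {0}" using nz by blast
    then have "dim {x \<in> P. f x = 0} = 0" using fsub_dim_mono[OF fsub_zero] by fastforce
    then have "dim (f ` P) = dim P" using C by simp
    moreover have "pos_on h (f ` P)" unfolding pos_on_def
    proof (intro ballI impI)
      fix y assume y: "y \<in> f ` P" "y \<noteq> 0"
      then obtain x where x: "x \<in> P" "y = f x" by blast
      then have "x \<noteq> 0" using y f.zero by auto
      then have "0 < Re (h' x x)" using x P(3) unfolding pos_on_def by blast
      moreover have "h' x x = h (f x) (f x)" using eq x(1) P(2) by blast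
      ultimately show "0 < Re (h y y)" using x by simp
    qed
    moreover have "f ` P \<subseteq> T" using P(2) T by blast
    ultimately show "posi h' S \<le> posi h T"
      using posi_ge[OF fT f.subspace_image[OF fsub_subspace[OF P(1)]], of h] P(4) by simp
  next
    obtain P where P: "fsub P" "P \<subseteq> T" "pos_on h P" "dim P = posi h T"
      by (rule posi_attained[OF fT])
    define S' where "S' = {x \<in> S. f x \<in> P}"
    have sS': "subspace S'" unfolding S'_def
      using fsub_subspace[OF S] fsub_subspace[OF P(1)]
      by (simp add: subspace_def f.add f.scale f.zero)
    have S'S: "S' \<subseteq> S" unfolding S'_def by blast
    have fS': "fsub S'" by (rule fsub_subset[OF S sS' S'S])
    have im: "f ` S' = P" unfolding S'_def using P(2) T by blast
    obtain C where C: "subspace C" "C \<subseteq> S'" "inj_on f C" "f ` C = f ` S'" "dim C = dim (f ` S')"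
      by (rule linear_section[OF f fsub_subspace[OF fS'] fsub_fin_dim[OF fS']])
    have "pos_on h' C" unfolding pos_on_def
    proof (intro ballI impI)
      fix x assume x: "x \<in> C" "x \<noteq> 0"
      then have "f x \<noteq> 0"
        using inj_onD[OF C(3), of x 0] subspace_0[OF C(1)] f.zero by auto
      moreover have "f x \<in> P" "x \<in> S" using x C(2) unfolding S'_def by blast+
      ultimately show "0 < Re (h' x x)" using P(3) eq[of x] unfolding pos_on_def by auto
    qed
    moreover have "C \<subseteq> S" using C(2) S'S by blast
    ultimately show "posi h T \<le> posi h' S"
      using posi_ge[OF S C(1), of h'] C(5) im P(4) by simp
  qed
qed

lemma negi_pullback:
  assumes f: "Vector_Spaces.linear scale scale f" and S: "fsub S" and T: "f ` S = T"
    and h: "herm h" and eq: "\<And>x. x \<in> S \<Longrightarrow> h' x x = h (f x) (f x)"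
  shows "negi h' S = negi h T"
  unfolding negi_def using eq by (intro posi_pullback[OF f S T herm_uminus[OF h]]) simp

text \<open>The ratio of \<open>h x x\<close> to \<open>|f x|^2\<close> is smallest at a vector
  \<open>u\<close> of \<open>P\<close> orthogonal to the kernel of \<open>f\<close>. Half of that
  minimum serves as \<open>e\<close>, which makes the inequality strict.\<close>

lemma pos_on_dominates_functional:
  assumes h: "herm h" and P: "fsub P" "pos_on h P" and f: "functional f"
  obtains e where "e > 0" "\<And>x. x \<in> P \<Longrightarrow> x \<noteq> 0 \<Longrightarrow> e * (cmod (f x))\<^sup>2 < Re (h x x)"
proof (cases "\<exists>x\<in>P. f x \<noteq> 0")
  case False
  then have "1 * (cmod (f x))\<^sup>2 < Re (h x x)" if "x \<in> P" "x \<noteq> 0" for x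
    using that P(2) unfolding pos_on_def by simp
  then show ?thesis using that[of 1] by simp
next
  case True
  let ?K = "{x \<in> P. f x = 0}"
  have sK: "subspace ?K" by (rule subspace_kernel[OF f fsub_subspace[OF P(1)]])
  have fK: "fsub ?K" by (rule fsub_subset[OF P(1) sK]) blast
  have fp: "fsub (perp h ?K P)" by (rule fsub_perp[OF h P(1)])
  have "dim P \<le> dim (perp h ?K P) + dim ?K" by (rule dim_perp_ge[OF h P(1) fK])
  moreover have "dim ?K < dim P"
  proof (rule ccontr)
    assume "\<not> dim ?K < dim P"
    then have "?K = P" by (intro fsub_eq_of_dim[OF P(1) sK]) auto
    then show False using True by blast
  qed
  ultimately have "dim (perp h ?K P) \<noteq> 0" by simp
  then have "perp h ?K P \<noteq> {0}" by auto
  then obtain u where u: "u \<in> perp h ?K P" "u \<noteq> 0"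
    using subspace_0[OF fsub_subspace[OF fp]] by blast
  have uP: "u \<in> P" "\<And>y. y \<in> ?K \<Longrightarrow> h u y = 0" using u(1) unfolding perp_def by blast+
  have pu: "0 < Re (h u u)" using uP(1) u(2) P(2) unfolding pos_on_def by blast
  have fu: "f u \<noteq> 0"
  proof
    assume "f u = 0"
    then have "h u u = 0" using uP by blast
    then show False using pu by simp
  qed
  define e where "e = Re (h u u) / (2 * (cmod (f u))\<^sup>2)"
  have e0: "e > 0" unfolding e_def using pu fu by simp
  have "e * (cmod (f x))\<^sup>2 < Re (h x x)" if x: "x \<in> P" "x \<noteq> 0" for x
  proof (cases "f x = 0")
    case True
    then show ?thesis using x P(2) unfolding pos_on_def by simp
  next
    case False
    define c where "c = f x / f u"
    define k where "k = x - c *s u"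
    have kK: "k \<in> ?K" unfolding k_def c_def
      using x uP(1) fu fsub_subspace[OF P(1)]
      by (simp add: functional_diff[OF f] functional_scale[OF f] subspace_diff subspace_scale)
    have "h u k = 0" by (rule uP(2)[OF kK])
    then have "h (c *s u) k = 0" by (simp add: herm_simps[OF h])
    moreover have "x = c *s u + k" unfolding k_def by simp
    ultimately have "Re (h x x) = (cmod c)\<^sup>2 * Re (h u u) + Re (h k k)"
      by (simp add: herm_self_add[OF h] herm_self_scale[OF h])
    moreover have "0 \<le> Re (h k k)" using kK by (intro pos_on_nonneg[OF h P(2)]) blast
    ultimately have "(cmod c)\<^sup>2 * Re (h u u) \<le> Re (h x x)" by simp
    moreover have "(cmod c)\<^sup>2 * Re (h u u) = 2 * (e * (cmod (f x))\<^sup>2)"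
      unfolding c_def e_def using fu by (simp add: norm_divide power_divide)
    moreover have "0 < e * (cmod (f x))\<^sup>2" using e0 False by simp
    ultimately show ?thesis by linarith
  qed
  then show ?thesis using that e0 by blast
qed

end

section \<open>Families of forms with a free off-diagonal block\<close>

context complex_vector_space
begin

text \<open>Adding a matrix of rank one to \<open>X\<close> changes the block form in this way, with
  \<open>f\<close> factoring through \<open>A\<^sup>*\<close> and \<open>g\<close> through
  \<open>B\<close>.\<close>

definition rank_two_update :: "('b \<Rightarrow> 'b \<Rightarrow> complex) \<Rightarrow> ('b \<Rightarrow> complex) \<Rightarrow> ('b \<Rightarrow> complex) \<Rightarrow> 'b \<Rightarrow> 'b \<Rightarrow> complex" where
  "rank_two_update h f g x y = h x y + f x * cnj (g y) + g x * cnj (f y)"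

lemma herm_rank_two_update:
  assumes "herm h" "functional f" "functional g" shows "herm (rank_two_update h f g)"
proof (rule hermI)
  show "rank_two_update h f g y x = cnj (rank_two_update h f g x y)" for x y
    using herm_sym[OF assms(1), of y x] by (simp add: rank_two_update_def)
qed (simp_all add: rank_two_update_def herm_simps[OF assms(1)] functional_add[OF assms(2)] functional_add[OF assms(3)]
    functional_scale[OF assms(2)] functional_scale[OF assms(3)] algebra_simps)

lemma rank_two_update_self: "Re (rank_two_update h f g x x) = Re (h x x) + 2 * Re (f x * cnj (g x))"
  by (simp add: rank_two_update_def)

lemma perp_cong:
  assumes "\<And>x y. x \<in> W \<Longrightarrow> y \<in> W \<Longrightarrow> h x y = h' x y" "K \<subseteq> W"
  shows "perp h K W = perp h' K W"
proof -
  have "h x y = h' x y" if "x \<in> W" "y \<in> K" for x y using assms that by blast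
  then show ?thesis unfolding perp_def by auto
qed

lemma posi_nonpos_on: "fsub W \<Longrightarrow> nonpos_on h W \<Longrightarrow> posi h W = 0"
  using nonpos_dim[of W W h] by (simp add: fsub_subspace)

text \<open>A positive subspace loses at most the codimension of \<open>K\<close> when it is
  intersected with \<open>K\<close>. This is the upper bound behind \<open>N1\<close> and
  \<open>N3\<close>.\<close>

lemma posi_le_codim:
  assumes W: "fsub W" and K: "subspace K" "K \<subseteq> W"
  shows "posi h W + dim K \<le> posi h K + dim W"
proof -
  obtain P where P: "fsub P" "P \<subseteq> W" "pos_on h P" "dim P = posi h W"
    by (rule posi_attained[OF W])
  have fK: "fsub K" by (rule fsub_subset[OF W K])
  have "dim (P \<inter> K) \<le> posi h K"
    using P(3) K(1) fsub_subspace[OF P(1)]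
    by (intro posi_ge[OF fK]) (auto simp: pos_on_def subspace_inter)
  moreover have "span (P \<union> K) \<subseteq> W"
    using P(2) K(2) fsub_subspace[OF W] by (intro span_minimal) auto
  then have "dim (span (P \<union> K)) \<le> dim W" by (rule fsub_dim_mono[OF W])
  moreover have "dim (span (P \<union> K)) + dim (P \<inter> K) = dim P + dim K"
    by (rule fsub_dim_sum[OF P(1) fK])
  ultimately show ?thesis using P(4) by linarith
qed

text \<open>In \<open>posi_split\<close> the surplus over \<open>posi h K\<close> is at least the
  dimension of the radical of \<open>K\<close> minus that of \<open>K \<inter> radical h W\<close>.
  Inside the radical of \<open>K\<close> the latter space meets
  \<open>L \<inter> radical h K\<close> in the triple intersection, which bounds this difference by
  quantities that all members of a family share.\<close>

lemma posi_lower_bound: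
  assumes h: "herm h" and W: "fsub W" and K: "subspace K" "K \<subseteq> W" and L: "subspace L"
  shows "posi h K + dim (L \<inter> radical h K) \<le> posi h W + dim (K \<inter> L \<inter> radical h W)"
proof -
  have fK: "fsub K" by (rule fsub_subset[OF W K])
  have fRK: "fsub (radical h K)" by (rule fsub_perp[OF h fK])
  have fR: "fsub (radical h W)" by (rule fsub_perp[OF h W])
  have f1: "fsub (L \<inter> radical h K)" using fsub_Int[OF fRK L] by (simp add: Int_commute)
  have f2: "fsub (K \<inter> radical h W)" by (rule fsub_Int[OF fK fsub_subspace[OF fR]])
  have sub: "K \<inter> radical h W \<subseteq> radical h K" using K(2) unfolding perp_def by blast
  have eq: "(L \<inter> radical h K) \<inter> (K \<inter> radical h W) = K \<inter> L \<inter> radical h W"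
    using sub by blast
  have "span ((L \<inter> radical h K) \<union> (K \<inter> radical h W)) \<subseteq> radical h K"
    using sub by (intro span_minimal fsub_subspace[OF fRK]) auto
  then have "dim (span ((L \<inter> radical h K) \<union> (K \<inter> radical h W))) \<le> dim (radical h K)"
    by (rule fsub_dim_mono[OF fRK])
  then have "dim (L \<inter> radical h K) + dim (K \<inter> radical h W)
      \<le> dim (radical h K) + dim (K \<inter> L \<inter> radical h W)"
    using fsub_dim_sum[OF f1 f2] unfolding eq by linarith
  then show ?thesis using posi_split[OF h W K] by linarith
qed

text \<open>The assumptions make \<open>negi_split\<close> collapse; \<open>inertia_sum\<close> on
  \<open>W\<close> and on \<open>K\<close> then turns the result into equality in
  \<open>posi_le_codim\<close>.\<close>

lemma posi_eq_codim:
  assumes h: "herm h" and W: "fsub W" and K: "subspace K" "K \<subseteq> W"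
    and nn: "nonpos_on (\<lambda>x y. - h x y) (perp h K W)" and R: "radical h W \<subseteq> K"
  shows "posi h W + dim K = posi h K + dim W"
proof -
  have fK: "fsub K" by (rule fsub_subset[OF W K])
  have "negi h (perp h K W) = 0"
    unfolding negi_def by (rule posi_nonpos_on[OF fsub_perp[OF h W] nn])
  moreover have "K \<inter> radical h W = radical h W" using R by blast
  ultimately have "negi h W + dim (radical h W) = negi h K + dim (radical h K)"
    using negi_split[OF h W K] by simp
  then show ?thesis using inertia_sum[OF h W] inertia_sum[OF h fK] by linarith
qed

lemma inertia_split_vector:
  assumes h: "herm h" and W: "fsub W" and w: "w \<in> W" "h w w \<noteq> 0"
  shows "posi h W = posi h (perp h {w} W) + (if 0 < Re (h w w) then 1 else 0)"
    and "negi h W = negi h (perp h {w} W) + (if Re (h w w) < 0 then 1 else 0)"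
proof -
  let ?S = "span {w}"
  have S: "fsub ?S" "subspace ?S" unfolding fsub_def by (simp_all add: fin_dim_span fin_dim_finite)
  have SW: "?S \<subseteq> W" using w(1) fsub_subspace[OF W] by (intro span_minimal) auto
  have el: "\<exists>c. x = c *s w" if "x \<in> ?S" for x using that by (auto simp: span_singleton)
  have nz: "x = 0" if "x \<in> ?S" "h x w = 0" for x
    using el[OF that(1)] that(2) w(2) by (auto simp: herm_simps[OF h])
  have wS: "w \<in> ?S" by (rule span_base) simp
  have "radical h ?S = {0}"
    using nz wS subspace_0[OF S(2)] herm_zero_left[OF h] unfolding perp_def by blast
  then have 1: "dim (radical h ?S) = 0" by simp
  have "?S \<inter> radical h W \<subseteq> {0}" using nz w(1) unfolding perp_def by blast
  then have 2: "dim (?S \<inter> radical h W) = 0" using fsub_dim_mono[OF fsub_zero] by fastforce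
  have p: "perp h ?S W = perp h {w} W" by (rule perp_span[OF h])
  have w0: "w \<noteq> 0" using w(2) herm_zero_left[OF h] by auto
  have "dim ?S = 1"
    using dim_span_eq_card_independent[of "{w}"] w0 by simp
  then have s: "posi h ?S + negi h ?S = 1" using inertia_sum[OF h S(1)] 1 by simp
  have re: "Re (h w w) \<noteq> 0" using w(2) herm_self_eq_0[OF h] by blast
  have sc: "\<exists>c. Re (h x x) = (cmod c)\<^sup>2 * Re (h w w)" if "x \<in> ?S" for x
    using el[OF that] herm_self_scale[OF h] by blast
  have a: "posi h ?S = (if 0 < Re (h w w) then 1 else 0)"
  proof (cases "0 < Re (h w w)")
    case True
    have "Re (- h x x) \<le> 0" if "x \<in> ?S" for x using sc[OF that] True by auto
    then have "negi h ?S = 0"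
      unfolding negi_def by (intro posi_nonpos_on[OF S(1)]) (simp add: nonpos_on_def)
    then show ?thesis using s True by simp
  next
    case False
    have "Re (h x x) \<le> 0" if "x \<in> ?S" for x
      using sc[OF that] False by (auto simp: mult_nonneg_nonpos)
    then have "posi h ?S = 0" by (intro posi_nonpos_on[OF S(1)]) (simp add: nonpos_on_def)
    then show ?thesis using False by simp
  qed
  show "posi h W = posi h (perp h {w} W) + (if 0 < Re (h w w) then 1 else 0)"
    using posi_split[OF h W S(2) SW] 1 2 p a by simp
  have "negi h ?S = (if Re (h w w) < 0 then 1 else 0)" using s a re by auto
  then show "negi h W = negi h (perp h {w} W) + (if Re (h w w) < 0 then 1 else 0)"
    using negi_split[OF h W S(2) SW] 1 2 p by simp
qed

end

text \<open>An abstract version of the set of all forms \<open>H + UXV + (UXV)\<^sup>*\<close>, where \<open>K\<close> and \<open>L\<close> play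
  the roles of the kernels of \<open>U\<^sup>*\<close> and \<open>V\<close>.\<close>

locale form_family = complex_vector_space scale
  for scale :: "complex \<Rightarrow> 'b::ab_group_add \<Rightarrow> 'b" (infixr "*s" 75) +
  fixes F :: "('b \<Rightarrow> 'b \<Rightarrow> complex) set" and K L W :: "'b set"
  assumes W: "fsub W" and K: "subspace K" "K \<subseteq> W" and L: "subspace L" "L \<subseteq> W"
    and nonempty: "F \<noteq> {}" and herm: "h \<in> F \<Longrightarrow> herm h"
    and closed: "h \<in> F \<Longrightarrow> functional f \<Longrightarrow> functional g \<Longrightarrow> (\<And>x. x \<in> K \<Longrightarrow> f x = 0)
      \<Longrightarrow> (\<And>x. x \<in> L \<Longrightarrow> g x = 0) \<Longrightarrow> \<exists>h'\<in>F. \<forall>x\<in>W. \<forall>y\<in>W. h' x y = rank_two_update h f g x y"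
    and agree_K: "h \<in> F \<Longrightarrow> h' \<in> F \<Longrightarrow> x \<in> K \<Longrightarrow> y \<in> K \<Longrightarrow> h x y = h' x y"
    and agree_L: "h \<in> F \<Longrightarrow> h' \<in> F \<Longrightarrow> x \<in> L \<Longrightarrow> y \<in> L \<Longrightarrow> h x y = h' x y"
    and agree_KL: "h \<in> F \<Longrightarrow> h' \<in> F \<Longrightarrow> x \<in> K \<Longrightarrow> x \<in> L \<Longrightarrow> y \<in> W \<Longrightarrow> h x y = h' x y"
begin

text \<open>The roles of \<open>K\<close> and \<open>L\<close> are symmetric, and by
  \<open>negate\<close> so are the two indices; an extremal argument is therefore carried out in one
  case and transferred to the others.\<close>

lemma swap: "form_family scale F L K W"
proof unfold_locales
  show "\<exists>h'\<in>F. \<forall>x\<in>W. \<forall>y\<in>W. h' x y = rank_two_update h f g x y"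
    if "h \<in> F" "functional f" "functional g" "\<And>x. x \<in> L \<Longrightarrow> f x = 0" "\<And>x. x \<in> K \<Longrightarrow> g x = 0" for h f g
    using closed[of h g f] that by (simp add: rank_two_update_def algebra_simps)
qed (use W K L nonempty herm agree_K agree_L agree_KL in auto)

lemma negate: "form_family scale ((\<lambda>h x y. - h x y) ` F) K L W"
proof unfold_locales
  show "\<exists>h'\<in>(\<lambda>h x y. - h x y) ` F. \<forall>x\<in>W. \<forall>y\<in>W. h' x y = rank_two_update h f g x y"
    if a: "h \<in> (\<lambda>h x y. - h x y) ` F" "functional f" "functional g"
      "\<And>x. x \<in> K \<Longrightarrow> f x = 0" "\<And>x. x \<in> L \<Longrightarrow> g x = 0" for h f g
  proof -
    obtain h0 where h0: "h0 \<in> F" "h = (\<lambda>x y. - h0 x y)" using a(1) by blast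
    \<comment> \<open>The sign is absorbed by \<open>f\<close>: negating the update of
      \<open>h0\<close> by \<open>- f\<close> and \<open>g\<close> gives the update of
      \<open>h\<close> by \<open>f\<close> and \<open>g\<close>.\<close>
    have "functional (\<lambda>x. - f x)" using a(2) unfolding functional_def by simp
    then obtain h' where h': "h' \<in> F" "\<forall>x\<in>W. \<forall>y\<in>W. h' x y = rank_two_update h0 (\<lambda>x. - f x) g x y"
      using closed[OF h0(1) _ a(3), of "\<lambda>x. - f x"] a(4,5) by auto
    then have "\<forall>x\<in>W. \<forall>y\<in>W. - h' x y = rank_two_update h f g x y" by (simp add: rank_two_update_def h0(2))
    then show ?thesis using h'(1) by (intro bexI[of _ "\<lambda>x y. - h' x y"]) auto
  qed
  show "herm h" if "h \<in> (\<lambda>h x y. - h x y) ` F" for h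
    using that herm_uminus herm by auto
  show "h x y = h' x y" if "h \<in> (\<lambda>h x y. - h x y) ` F" "h' \<in> (\<lambda>h x y. - h x y) ` F" "x \<in> K" "y \<in> K" for h h' x y
    using that agree_K by auto
  show "h x y = h' x y" if "h \<in> (\<lambda>h x y. - h x y) ` F" "h' \<in> (\<lambda>h x y. - h x y) ` F" "x \<in> L" "y \<in> L" for h h' x y
    using that agree_L by auto
  show "h x y = h' x y" if "h \<in> (\<lambda>h x y. - h x y) ` F" "h' \<in> (\<lambda>h x y. - h x y) ` F" "x \<in> K" "x \<in> L" "y \<in> W" for h h' x y
    using that agree_KL by auto
qed (use W K L nonempty in auto)

lemma update:
  assumes "h \<in> F" "functional f" "functional g" "\<And>x. x \<in> K \<Longrightarrow> f x = 0" "\<And>x. x \<in> L \<Longrightarrow> g x = 0"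
  obtains h' where "h' \<in> F" "posi h' W = posi (rank_two_update h f g) W" "negi h' W = negi (rank_two_update h f g) W"
    "radical h' W = radical (rank_two_update h f g) W"
proof -
  obtain h' where h': "h' \<in> F" "\<And>x y. x \<in> W \<Longrightarrow> y \<in> W \<Longrightarrow> h' x y = rank_two_update h f g x y"
    using closed[OF assms] by blast
  have "posi h' W = posi (rank_two_update h f g) W" "negi h' W = negi (rank_two_update h f g) W"
    using h'(2) by (auto intro: posi_cong negi_cong)
  moreover have "radical h' W = radical (rank_two_update h f g) W" using h'(2) by (intro perp_cong) auto
  ultimately show ?thesis using that h'(1) by blast
qed

lemma fsub_KL: "fsub K" "fsub L"
  by (rule fsub_subset[OF W K], rule fsub_subset[OF W L])

lemma invariants:
  assumes "h \<in> F" "h' \<in> F"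
  shows "posi h K = posi h' K" "negi h K = negi h' K" "posi h L = posi h' L" "negi h L = negi h' L"
    "radical h K = radical h' K" "radical h L = radical h' L"
    "K \<inter> L \<inter> radical h W = K \<inter> L \<inter> radical h' W"
proof -
  show "posi h K = posi h' K" "negi h K = negi h' K"
    using agree_K[OF assms] by (auto intro: posi_cong negi_cong)
  show "posi h L = posi h' L" "negi h L = negi h' L"
    using agree_L[OF assms] by (auto intro: posi_cong negi_cong)
  show "radical h K = radical h' K" using agree_K[OF assms] by (intro perp_cong) auto
  show "radical h L = radical h' L" using agree_L[OF assms] by (intro perp_cong) auto
  show "K \<inter> L \<inter> radical h W = K \<inter> L \<inter> radical h' W"
    using agree_KL[OF assms] unfolding perp_def by auto
qed

section \<open>Enlarging the radical, and forms with minimal indices\<close>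

text \<open>With \<open>V\<close> one of \<open>K\<close> and \<open>L\<close>, the form itself thus
  produces admissible functionals from vectors orthogonal to \<open>V\<close>.\<close>

lemma perp_functional:
  assumes "h \<in> F" "w \<in> perp h V W"
  shows "functional (\<lambda>x. h x w)" "\<And>x. x \<in> V \<Longrightarrow> h x w = 0"
proof -
  show "functional (\<lambda>x. h x w)" by (rule functional_herm[OF herm[OF assms(1)]])
  show "h x w = 0" if "x \<in> V" for x
    using that assms(2) herm_zero_sym[OF herm[OF assms(1)], of w x] unfolding perp_def by blast
qed

text \<open>The vector \<open>x1 w + x2 w'\<close> enters the radical.\<close>

lemma enlarge_radical:
  assumes hF: "h \<in> F" and w: "w \<in> perp h K W" "w' \<in> perp h L W"
    and eq: "\<sigma> * x1 = Re (h w' w') * x2" "\<sigma> * x2 = Re (h w w) * x1"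
    and nz: "x1 \<noteq> 0 \<or> x2 \<noteq> 0" "of_real \<sigma> + h w' w \<noteq> 0"
  shows "\<exists>h'\<in>F. dim (radical h W) < dim (radical h' W)"
proof -
  have h: "herm h" by (rule herm[OF hF])
  define s where "s = of_real \<sigma> + h w' w"
  have s0: "s \<noteq> 0" using nz unfolding s_def by simp
  \<comment> \<open>With this factor the update subtracts exactly
    \<open>x2 * h w' y + x1 * h w y\<close> from \<open>h u y\<close>, which leaves 0.\<close>
  define \<kappa> where "\<kappa> = - (1 / s)"
  define f where "f x = \<kappa> * h x w" for x
  define g where "g x = h x w'" for x
  have ff: "functional f"
    unfolding f_def functional_def by (simp add: herm_simps[OF h] distrib_left mult.left_commute)
  have gf: "functional g" unfolding g_def by (rule functional_herm[OF h])
  have fK: "f x = 0" if "x \<in> K" for x using perp_functional(2)[OF hF w(1) that] by (simp add: f_def)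
  have gL: "g x = 0" if "x \<in> L" for x using perp_functional(2)[OF hF w(2) that] by (simp add: g_def)
  obtain h' where h': "h' \<in> F" "radical h' W = radical (rank_two_update h f g) W"
    using update[OF hF ff gf fK gL] .
  define u where "u = of_real x1 *s w + of_real x2 *s w'"
  have wW: "w \<in> W" "w' \<in> W" using w unfolding perp_def by blast+
  have uW: "u \<in> W" unfolding u_def using wW fsub_subspace[OF W]
    by (simp add: subspace_add subspace_scale)
  have ww: "h w w = of_real (Re (h w w))" "h w' w' = of_real (Re (h w' w'))"
    using herm_self[OF h] by blast+
  have sym: "h w w' = cnj (h w' w)" by (rule herm_sym[OF h])
  have e: "of_real \<sigma> * of_real x1 = h w' w' * of_real x2" "of_real \<sigma> * of_real x2 = h w w * of_real x1"
    using eq ww by (metis of_real_mult)+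
  \<comment> \<open>The equations on \<open>x1\<close> and \<open>x2\<close> trade the diagonal
    terms \<open>h w w * x1\<close> and \<open>h w' w' * x2\<close> for multiples of the other
    coordinate, so that \<open>s\<close> or its conjugate factors out of both products.\<close>
  have uw: "h u w = s * of_real x2"
    using e(2) by (simp add: u_def s_def herm_simps[OF h] algebra_simps)
  have uw': "h u w' = cnj s * of_real x1"
    using e(1) by (simp add: u_def s_def herm_simps[OF h] sym algebra_simps)
  have "rank_two_update h f g u y = 0" for y
  proof -
    have y: "cnj (h y w) = h w y" "cnj (h y w') = h w' y" using herm_sym[OF h] by metis+
    have "rank_two_update h f g u y = h u y - of_real x2 * h w' y - of_real x1 * h w y"
      using s0 by (simp add: rank_two_update_def f_def g_def \<kappa>_def uw uw' y)
    then show ?thesis by (simp add: u_def herm_simps[OF h])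
  qed
  then have uR: "u \<in> radical (rank_two_update h f g) W" using uW unfolding perp_def by blast
  have unR: "u \<notin> radical h W"
  proof
    assume "u \<in> radical h W"
    then have "h u w = 0" "h u w' = 0" using wW unfolding perp_def by blast+
    then show False using uw uw' s0 nz(1) by simp
  qed
  \<comment> \<open>\<open>f\<close> and \<open>g\<close> come from vectors of \<open>W\<close> and
    so vanish on the old radical.\<close>
  have "radical h W \<subseteq> radical (rank_two_update h f g) W"
    using wW unfolding perp_def by (auto simp: rank_two_update_def f_def g_def)
  then have "radical h W \<subset> radical h' W" using uR unR h'(2) by blast
  moreover have "fsub (radical h' W)" "subspace (radical h W)"
    using fsub_perp[OF herm[OF h'(1)] W] fsub_subspace[OF fsub_perp[OF h W]] by blast+
  ultimately have "dim (radical h W) < dim (radical h' W)"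
    using fsub_eq_of_dim by (metis linorder_not_le psubset_eq)
  then show ?thesis using h'(1) by blast
qed

text \<open>The update with \<open>g x = h x e\<close> and \<open>f e = - 1\<close> cancels
  \<open>h e y\<close>, so \<open>e\<close> enters the radical. The old radical loses at most the
  one dimension on which \<open>f\<close> is nonzero, and \<open>e\<close> replaces it; the parts in
  \<open>K\<close> and in \<open>L\<close> survive because \<open>f\<close> vanishes there.\<close>

lemma enlarge_radical_L:
  assumes hF: "h \<in> F" and e: "e \<in> radical h L" "e = k + r" "k \<in> K" "r \<in> radical h W"
    and ne: "e \<notin> span (K \<union> (L \<inter> radical h W))"
  shows "\<exists>h'\<in>F. dim (radical h W) \<le> dim (radical h' W)
    \<and> dim (L \<inter> radical h W) < dim (L \<inter> radical h' W)
    \<and> dim (K \<inter> radical h W) \<le> dim (K \<inter> radical h' W)"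
proof -
  have h: "herm h" by (rule herm[OF hF])
  let ?R = "radical h W"
  have fR: "fsub ?R" by (rule fsub_perp[OF h W])
  obtain a where a: "functional a" "\<And>x. x \<in> span (K \<union> (L \<inter> ?R)) \<Longrightarrow> a x = 0" "a e = 1"
    by (rule functional_separating[OF subspace_span ne]) (use that in blast)
  define f where "f x = - a x" for x
  define g where "g x = h x e" for x
  have ff: "functional f" using a(1) unfolding f_def functional_def by simp
  have gf: "functional g" unfolding g_def by (rule functional_herm[OF h])
  have f0: "f x = 0" if "x \<in> K \<union> (L \<inter> ?R)" for x
    using a(2) span_base[OF that] by (simp add: f_def)
  have eL: "e \<in> L" "e \<in> W" using e(1) L(2) unfolding perp_def by blast+
  have gL: "g x = 0" if "x \<in> L" for x
  proof -
    have "h e x = 0" using e(1) that unfolding perp_def by blast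
    then show ?thesis unfolding g_def by (rule herm_zero_sym[OF h])
  qed
  have gR: "g x = 0" if "x \<in> ?R" for x using that eL unfolding g_def perp_def by blast
  obtain h' where h': "h' \<in> F" "radical h' W = radical (rank_two_update h f g) W"
    using update[OF hF ff gf _ gL] f0 by blast
  have fR': "fsub (radical h' W)" by (rule fsub_perp[OF herm[OF h'(1)] W])
  have RR: "x \<in> radical h' W" if x: "x \<in> ?R" "f x = 0" for x
    using x gR[OF x(1)] unfolding h'(2) by (simp add: perp_def rank_two_update_def)
  have "rank_two_update h f g e y = 0" for y
  proof -
    have "rank_two_update h f g e y = h e y - cnj (h y e)"
      using gL[OF eL(1)] a(3) by (simp add: rank_two_update_def f_def g_def)
    then show ?thesis using herm_sym[OF h, of e y] by simp
  qed
  then have eR: "e \<in> radical h' W" using eL unfolding h'(2) by (simp add: perp_def)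
  have enR: "e \<notin> ?R" using ne eL span_base[of e "K \<union> (L \<inter> ?R)"] by auto
  let ?N = "{x \<in> ?R. f x = 0}"
  have sN: "subspace ?N" by (rule subspace_kernel[OF ff fsub_subspace[OF fR]])
  have fN: "fsub ?N" by (rule fsub_subset[OF fR sN]) blast
  have "e \<notin> ?N" using enR by simp
  then have "dim (span (insert e ?N)) = Suc (dim ?N)"
    by (rule dim_span_insert[OF sN fsub_fin_dim[OF fN]])
  moreover have "span (insert e ?N) \<subseteq> radical h' W"
    using eR RR by (intro span_minimal fsub_subspace[OF fR']) auto
  then have "dim (span (insert e ?N)) \<le> dim (radical h' W)" by (rule fsub_dim_mono[OF fR'])
  moreover have "dim ?R \<le> Suc (dim ?N)"
    by (rule dim_kernel_functional[OF ff fsub_subspace[OF fR] fsub_fin_dim[OF fR]])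
  ultimately have 1: "dim ?R \<le> dim (radical h' W)" by linarith
  have fLR: "fsub (L \<inter> radical h' W)" by (rule fsub_Int[OF fsub_KL(2) fsub_subspace[OF fR']])
  have sLR: "subspace (L \<inter> ?R)" using L(1) fsub_subspace[OF fR] by (simp add: subspace_inter)
  have sub: "L \<inter> ?R \<subseteq> L \<inter> radical h' W" using RR f0 by blast
  moreover have "L \<inter> ?R \<noteq> L \<inter> radical h' W" using eR enR eL(1) by blast
  ultimately have 2: "dim (L \<inter> ?R) < dim (L \<inter> radical h' W)"
    using fsub_eq_of_dim[OF fLR sLR sub] by (meson linorder_not_le)
  have "K \<inter> ?R \<subseteq> K \<inter> radical h' W" using RR f0 by blast
  then have "dim (K \<inter> ?R) \<le> dim (K \<inter> radical h' W)"
    by (rule fsub_dim_mono[OF fsub_Int[OF fsub_KL(1) fsub_subspace[OF fR']]])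
  then show ?thesis using 1 2 h'(1) by blast
qed

text \<open>Lexicographic maximality: first the dimension of the radical, then the sum of the
  dimensions of its parts in \<open>K\<close> and in \<open>L\<close>. The second criterion is the
  one that \<open>enlarge_radical_L\<close> improves.\<close>

definition optimal :: "('b \<Rightarrow> 'b \<Rightarrow> complex) \<Rightarrow> bool" where
  "optimal h \<longleftrightarrow> h \<in> F \<and> (\<forall>h'\<in>F. dim (radical h W) \<le> dim (radical h' W) \<longrightarrow>
     dim (radical h' W) = dim (radical h W) \<and>
     dim (K \<inter> radical h' W) + dim (L \<inter> radical h' W) \<le> dim (K \<inter> radical h W) + dim (L \<inter> radical h W))"

lemma optimal_exists: "\<exists>h. optimal h"
proof -
  \<comment> \<open>\<open>N\<close> exceeds every value of the second criterion, so that
    \<open>\<mu>\<close> compares lexicographically.\<close>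
  define N where "N = 2 * dim W + 1"
  define d where "d h = dim (K \<inter> radical h W) + dim (L \<inter> radical h W)" for h
  define \<mu> where "\<mu> h = dim (radical h W) * N + d h" for h
  have dW: "d h < N" for h
  proof -
    have "dim (K \<inter> radical h W) \<le> dim W" "dim (L \<inter> radical h W) \<le> dim W"
      by (rule fsub_dim_mono[OF W le_infI1[OF K(2)]], rule fsub_dim_mono[OF W le_infI1[OF L(2)]])
    then show ?thesis unfolding d_def N_def by linarith
  qed
  have rW: "dim (radical h W) \<le> dim W" for h by (rule fsub_dim_mono[OF W perp_subset])
  have "\<mu> h \<le> dim W * N + N" for h
    unfolding \<mu>_def using dW[of h] mult_le_mono1[OF rW[of h], of N] by linarith
  then obtain h where h: "h \<in> F" "\<And>h'. h' \<in> F \<Longrightarrow> \<mu> h' \<le> \<mu> h"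
  proof -
    obtain h0 where "h0 \<in> F" using nonempty by blast
    then have "\<exists>h. h \<in> F \<and> (\<forall>h'. h' \<in> F \<longrightarrow> \<mu> h' \<le> \<mu> h)"
      using \<open>\<And>h. \<mu> h \<le> dim W * N + N\<close> by (intro ex_has_greatest_nat) (auto intro: le_imp_less_Suc)
    then show ?thesis using that by blast
  qed
  have "dim (radical h' W) = dim (radical h W) \<and> d h' \<le> d h"
    if h': "h' \<in> F" "dim (radical h W) \<le> dim (radical h' W)" for h'
  proof -
    have le: "dim (radical h' W) * N + d h' \<le> dim (radical h W) * N + d h"
      using h(2)[OF h'(1)] unfolding \<mu>_def .
    have "dim (radical h' W) \<le> dim (radical h W)"
    proof (rule ccontr)
      assume "\<not> ?thesis"
      then have "Suc (dim (radical h W)) * N \<le> dim (radical h' W) * N" by (intro mult_le_mono1) simp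
      then show False using le dW[of h] by simp
    qed
    then show ?thesis using h'(2) le by simp
  qed
  then show ?thesis unfolding optimal_def d_def using h(1) by blast
qed

lemma optimal_swap: "optimal h \<Longrightarrow> form_family.optimal scale F L K W h"
  unfolding optimal_def form_family.optimal_def[OF swap] by (simp add: add.commute)

text \<open>For equal signs a real \<open>\<sigma>\<close> with
  \<open>\<sigma>^2 = h w w * h w' w'\<close> exists, and \<open>x1 = h w' w'\<close>,
  \<open>x2 = \<sigma>\<close> solve the equations of \<open>enlarge_radical\<close>, so the radical
  could still grow.\<close>

lemma optimal_no_same_sign:
  assumes "optimal h" "w \<in> perp h K W" "w' \<in> perp h L W"
  shows "\<not> 0 < Re (h w w) * Re (h w' w')"
proof
  assume pq: "0 < Re (h w w) * Re (h w' w')"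
  define t where "t = sqrt (Re (h w w) * Re (h w' w'))"
  have t: "t \<noteq> 0" "t * t = Re (h w w) * Re (h w' w')"
    unfolding t_def using pq by auto
  \<comment> \<open>Both square roots solve the equations. As \<open>t\<close> is nonzero, at most
    one of them makes the denominator \<open>\<sigma> + h w' w\<close> vanish.\<close>
  define \<sigma> where "\<sigma> = (if of_real t + h w' w = 0 then - t else t)"
  have s2: "\<sigma> * \<sigma> = Re (h w w) * Re (h w' w')" unfolding \<sigma>_def using t by simp
  have "of_real \<sigma> + h w' w \<noteq> 0"
  proof (cases "of_real t + h w' w = 0")
    case True
    then have "h w' w = - of_real t" by (simp add: add_eq_0_iff)
    then have "of_real \<sigma> + h w' w = - (2 * of_real t)" unfolding \<sigma>_def by simp
    then show ?thesis using t by simp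
  qed (simp add: \<sigma>_def)
  moreover have "Re (h w' w') \<noteq> 0" using pq by auto
  ultimately have "\<exists>h'\<in>F. dim (radical h W) < dim (radical h' W)"
    using s2 assms
    by (intro enlarge_radical[of h w w' \<sigma> "Re (h w' w')" \<sigma>]) (auto simp: optimal_def mult.commute)
  then show False using assms(1) unfolding optimal_def by (metis less_irrefl less_imp_le)
qed

text \<open>This reverses the estimate behind \<open>posi_lower_bound\<close>: the radical of
  \<open>L\<close> is spanned by its part in \<open>K\<close> and the part of
  \<open>radical h W\<close> in \<open>L\<close>. A vector \<open>e\<close> outside that span could
  be brought into the radical of \<open>W\<close>, against optimality.\<close>

lemma optimal_radical_L:
  assumes opt: "optimal h"
  shows "dim (radical h L) + dim (K \<inter> L \<inter> radical h W) \<le> dim (K \<inter> radical h L) + dim (L \<inter> radical h W)"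
proof -
  have hF: "h \<in> F" using opt unfolding optimal_def by blast
  have h: "herm h" by (rule herm[OF hF])
  let ?R = "radical h W" and ?RL = "radical h L"
  have fR: "fsub ?R" "fsub ?RL" using fsub_perp[OF h] W fsub_KL by blast+
  have f1: "fsub (K \<inter> ?RL)" by (rule fsub_Int[OF fsub_KL(1) fsub_subspace[OF fR(2)]])
  have f2: "fsub (L \<inter> ?R)" by (rule fsub_Int[OF fsub_KL(2) fsub_subspace[OF fR(1)]])
  have "?RL \<subseteq> span ((K \<inter> ?RL) \<union> (L \<inter> ?R))"
  proof (rule ccontr)
    assume "\<not> ?thesis"
    then obtain e where e: "e \<in> ?RL" "e \<notin> span ((K \<inter> ?RL) \<union> (L \<inter> ?R))" by blast
    have eL: "e \<in> L" "e \<in> W" using e(1) L(2) unfolding perp_def by blast+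
    have ne: "e \<notin> span (K \<union> (L \<inter> ?R))"
    proof
      assume "e \<in> span (K \<union> (L \<inter> ?R))"
      then obtain k u where ku: "e = k + u" "k \<in> K" "u \<in> L \<inter> ?R"
        by (rule span_Un_cases[OF _ K(1) fsub_subspace[OF f2]])
      have "u \<in> ?RL" using ku(3) L(2) unfolding perp_def by blast
      then have "k \<in> ?RL" using ku(1) e(1) subspace_diff[OF fsub_subspace[OF fR(2)], of e u] by simp
      then have "e \<in> span ((K \<inter> ?RL) \<union> (L \<inter> ?R))"
        unfolding ku(1) using ku(2,3) by (intro span_add span_base) auto
      then show False using e(2) by blast
    qed
    show False
    \<comment> \<open>Orthogonality to the complement of \<open>K\<close> means that
      \<open>e\<close> lies in \<open>K\<close> plus the radical, where the exchange of
      \<open>enlarge_radical_L\<close> applies. Otherwise some \<open>w\<close> in that complement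
      pairs with \<open>e\<close>.\<close>
    proof (cases "e \<in> perp h (perp h K W) W")
      case True
      then have "e \<in> span (K \<union> ?R)" unfolding perp_perp[OF h W K] .
      then obtain k r where kr: "e = k + r" "k \<in> K" "r \<in> ?R"
        by (rule span_Un_cases[OF _ K(1) fsub_subspace[OF fR(1)]])
      from enlarge_radical_L[OF hF e(1) kr ne]
      obtain h' where "h' \<in> F" "dim ?R \<le> dim (radical h' W)"
        "dim (L \<inter> ?R) < dim (L \<inter> radical h' W)" "dim (K \<inter> ?R) \<le> dim (K \<inter> radical h' W)" by blast
      then show False using opt unfolding optimal_def by fastforce
    next
      case False
      then obtain w where w: "w \<in> perp h K W" "h e w \<noteq> 0" using eL unfolding perp_def by blast
      have "h e e = 0" using e(1) eL unfolding perp_def by blast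
      moreover have "e \<in> perp h L W" using e(1) eL unfolding perp_def by blast
      \<comment> \<open>\<open>e\<close> is isotropic and orthogonal to \<open>L\<close>, so
        \<open>\<sigma> = 0\<close>, \<open>x1 = 0\<close>, \<open>x2 = 1\<close> are admissible:
        \<open>e\<close> itself enters the radical.\<close>
      ultimately have "\<exists>h'\<in>F. dim ?R < dim (radical h' W)"
        using w by (intro enlarge_radical[OF hF, of w e 0 0 1]) auto
      then show False using opt unfolding optimal_def by (metis less_irrefl less_imp_le)
    qed
  qed
  then have "dim ?RL \<le> dim (span ((K \<inter> ?RL) \<union> (L \<inter> ?R)))"
    by (rule fsub_dim_mono[OF fsub_span_Un[OF f1 f2]])
  moreover have "?R \<inter> L \<subseteq> ?RL" using L(2) unfolding perp_def by blast
  then have "(K \<inter> ?RL) \<inter> (L \<inter> ?R) = K \<inter> L \<inter> ?R" by blast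
  ultimately show ?thesis using fsub_dim_sum[OF f1 f2] by simp
qed

lemma optimal_radical_K:
  assumes "optimal h"
  shows "dim (radical h K) + dim (K \<inter> L \<inter> radical h W) \<le> dim (L \<inter> radical h K) + dim (K \<inter> radical h W)"
  using form_family.optimal_radical_L[OF swap optimal_swap[OF assms]] by (simp add: Int_commute)

text \<open>By \<open>optimal_no_same_sign\<close> one of the complements of \<open>K\<close> and
  \<open>L\<close> contains no positive vector. It drops out of the corresponding
  \<open>posi_split\<close>, and \<open>optimal_radical_K\<close> or
  \<open>optimal_radical_L\<close> controls the radicals that remain.\<close>

lemma optimal_posi:
  assumes opt: "optimal h"
  shows "posi h W + dim (K \<inter> L \<inter> radical h W)
    = max (posi h K + dim (L \<inter> radical h K)) (posi h L + dim (K \<inter> radical h L))"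
proof -
  have h: "herm h" using opt herm unfolding optimal_def by blast
  have ge: "posi h K + dim (L \<inter> radical h K) \<le> posi h W + dim (K \<inter> L \<inter> radical h W)"
      "posi h L + dim (K \<inter> radical h L) \<le> posi h W + dim (K \<inter> L \<inter> radical h W)"
    using posi_lower_bound[OF h W K L(1)] posi_lower_bound[OF h W L K(1)] by (simp_all add: Int_commute)
  have "nonpos_on h (perp h K W) \<or> nonpos_on h (perp h L W)"
    using optimal_no_same_sign[OF opt] unfolding nonpos_on_def by (meson linorder_not_le mult_pos_pos)
  then show ?thesis
  proof
    assume "nonpos_on h (perp h K W)"
    then have "posi h (perp h K W) = 0" by (rule posi_nonpos_on[OF fsub_perp[OF h W]])
    then show ?thesis using posi_split[OF h W K] optimal_radical_K[OF opt] ge by linarith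
  next
    assume "nonpos_on h (perp h L W)"
    then have "posi h (perp h L W) = 0" by (rule posi_nonpos_on[OF fsub_perp[OF h W]])
    then show ?thesis using posi_split[OF h W L] optimal_radical_L[OF opt] ge by linarith
  qed
qed

text \<open>Optimality refers only to radicals, which negation preserves. Hence one and the same
  form minimizes both indices, and with them the rank.\<close>

lemma optimal_negate:
  assumes "optimal h"
  shows "form_family.optimal scale ((\<lambda>h x y. - h x y) ` F) K L W (\<lambda>x y. - h x y)"
  using assms unfolding optimal_def form_family.optimal_def[OF negate] by auto

lemma optimal_negi:
  assumes opt: "optimal h"
  shows "negi h W + dim (K \<inter> L \<inter> radical h W)
    = max (negi h K + dim (L \<inter> radical h K)) (negi h L + dim (K \<inter> radical h L))"
  using form_family.optimal_posi[OF negate optimal_negate[OF opt]] by (simp add: negi_def)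


section \<open>Forms with maximal indices and with maximal rank\<close>

text \<open>At \<open>v + c r\<close> the update adds a multiple of
  \<open>Re ((a v + c) * cnj (b v + c))\<close> to the value of \<open>h\<close> at
  \<open>v\<close>. By polarization this costs at most a multiple of \<open>|a v - b v|^2\<close>,
  which \<open>h\<close> dominates on \<open>P\<close> if the update is small; so \<open>r\<close>
  can join \<open>P\<close>. A negative space survives once its vectors are shifted along
  \<open>r\<close> into the kernel of \<open>a\<close>.\<close>

lemma add_radical_vector:
  assumes hF: "h \<in> F" and r: "r \<in> radical h W" "r \<notin> K" "r \<notin> L"
  shows "\<exists>h'\<in>F. posi h W < posi h' W \<and> negi h W \<le> negi h' W"
proof -
  have h: "herm h" by (rule herm[OF hF])
  have rW: "r \<in> W" "\<And>x. x \<in> W \<Longrightarrow> h r x = 0" using r(1) unfolding perp_def by blast+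
  have rW': "h x r = 0" if "x \<in> W" for x by (rule herm_zero_sym[OF h rW(2)[OF that]])
  obtain a where a: "functional a" "\<And>x. x \<in> K \<Longrightarrow> a x = 0" "a r = 1"
    by (rule functional_separating[OF K(1) r(2)]) (use that in blast)
  obtain b where b: "functional b" "\<And>x. x \<in> L \<Longrightarrow> b x = 0" "b r = 1"
    by (rule functional_separating[OF L(1) r(3)]) (use that in blast)
  obtain P where P: "fsub P" "P \<subseteq> W" "pos_on h P" "dim P = posi h W"
    by (rule posi_attained[OF W])
  have fab: "functional (\<lambda>x. a x - b x)" unfolding functional_def
    by (simp add: functional_add[OF a(1)] functional_add[OF b(1)]
        functional_scale[OF a(1)] functional_scale[OF b(1)] right_diff_distrib)
  obtain e where e: "e > 0" "\<And>x. x \<in> P \<Longrightarrow> x \<noteq> 0 \<Longrightarrow> e * (cmod (a x - b x))\<^sup>2 < Re (h x x)"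
    by (rule pos_on_dominates_functional[OF h P(1,3) fab]) (use that in blast)
  define f where "f x = of_real (2 * e) * a x" for x
  have ff: "functional f" unfolding f_def functional_def
    by (simp add: functional_add[OF a(1)] functional_scale[OF a(1)] distrib_left mult.left_commute)
  have fK: "f x = 0" if "x \<in> K" for x by (simp add: f_def a(2)[OF that])
  obtain h' where h': "h' \<in> F" "posi h' W = posi (rank_two_update h f b) W" "negi h' W = negi (rank_two_update h f b) W"
    by (rule update[OF hF ff b(1) fK b(2)]) (use that in blast)+
  let ?u = "rank_two_update h f b"
  have self: "Re (?u x x) = Re (h v v) + 4 * e * Re ((a v + c) * cnj (b v + c))"
    if "v \<in> W" "x = v + c *s r" for x v c
  proof -
    have "h x x = h v v"
      using rW(2)[OF that(1)] rW(2)[OF rW(1)] rW'[OF that(1)] by (simp add: that(2) herm_simps[OF h])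
    moreover have "a x = a v + c" "b x = b v + c"
      by (simp_all add: that(2) functional_add[OF a(1)] functional_scale[OF a(1)]
          functional_add[OF b(1)] functional_scale[OF b(1)] a(3) b(3))
    ultimately show ?thesis by (simp add: rank_two_update_self f_def algebra_simps)
  qed
  have ge: "4 * Re ((s + c) * cnj (t + c)) \<ge> - (cmod (s - t))\<^sup>2" for s t c :: complex
  proof -
    have "4 * Re ((s + c) * cnj (t + c)) = (cmod ((s + c) + (t + c)))\<^sup>2 - (cmod ((s + c) - (t + c)))\<^sup>2"
      unfolding cmod_power2 by (simp add: power2_eq_square algebra_simps)
    then show ?thesis by simp
  qed
  have rP: "r \<notin> P"
  proof
    assume "r \<in> P"
    moreover have "r \<noteq> 0" using r(2) subspace_0[OF K(1)] by blast
    ultimately have "0 < Re (h r r)" using P(3) unfolding pos_on_def by blast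
    then show False using rW by simp
  qed
  have "pos_on ?u (span (insert r P))" unfolding pos_on_def
  proof (intro ballI impI)
    fix x assume x: "x \<in> span (insert r P)" "x \<noteq> 0"
    obtain v c where vc: "x = v + c *s r" "v \<in> P"
      by (rule span_insert_cases[OF x(1) fsub_subspace[OF P(1)]])
    have vW: "v \<in> W" using vc P(2) by blast
    show "0 < Re (?u x x)"
    proof (cases "v = 0")
      case True
      then have "c \<noteq> 0" using x(2) vc by auto
      moreover have "Re (c * cnj c) = (cmod c)\<^sup>2" unfolding cmod_power2 by (simp add: power2_eq_square)
      ultimately have "0 < Re (c * cnj c)" by simp
      moreover have "Re (?u x x) = 4 * e * Re (c * cnj c)"
        using self[OF vW vc(1)] unfolding True
        by (simp only: herm_zero_left[OF h] functional_zero[OF a(1)] functional_zero[OF b(1)] add_0 zero_complex.simps)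
      ultimately show ?thesis using e(1) by simp
    next
      case False
      have "e * (4 * Re ((a v + c) * cnj (b v + c))) \<ge> e * (- (cmod (a v - b v))\<^sup>2)"
        by (rule mult_left_mono[OF ge]) (use e(1) in simp)
      then show ?thesis using self[OF vW vc(1)] e(2)[OF vc(2) False] by linarith
    qed
  qed
  moreover have "span (insert r P) \<subseteq> W"
    using rW(1) P(2) by (intro span_minimal fsub_subspace[OF W]) auto
  ultimately have "dim (span (insert r P)) \<le> posi ?u W" by (intro posi_ge[OF W subspace_span])
  then have 1: "posi h W < posi h' W"
    using dim_span_insert[OF fsub_subspace[OF P(1)] fsub_fin_dim[OF P(1)] rP] P(4) h'(2) by simp
  obtain N where N: "fsub N" "N \<subseteq> W" "pos_on (\<lambda>x y. - h x y) N" "dim N = posi (\<lambda>x y. - h x y) W"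
    by (rule posi_attained[OF W])
  have rN: "r \<notin> N"
  proof
    assume "r \<in> N"
    moreover have "r \<noteq> 0" using r(2) subspace_0[OF K(1)] by blast
    ultimately have "0 < Re (- h r r)" using N(3) unfolding pos_on_def by blast
    then show False using rW by simp
  qed
  \<comment> \<open>On the kernel of \<open>a\<close> the update adds nothing to the diagonal. No
    dimension is lost: adjoining \<open>r\<close> adds one, and the condition \<open>a x = 0\<close>
    removes at most one.\<close>
  define N' where "N' = {x \<in> span (insert r N). a x = 0}"
  have fs: "fsub (span (insert r N))" by (rule fsub_span_insert[OF N(1)])
  have sN': "subspace N'" unfolding N'_def by (rule subspace_kernel[OF a(1) subspace_span])
  have "dim (span (insert r N)) \<le> Suc (dim N')"
    unfolding N'_def by (rule dim_kernel_functional[OF a(1) fsub_subspace[OF fs] fsub_fin_dim[OF fs]])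
  then have "dim N \<le> dim N'"
    using dim_span_insert[OF fsub_subspace[OF N(1)] fsub_fin_dim[OF N(1)] rN] by simp
  moreover have "span (insert r N) \<subseteq> W"
    using rW(1) N(2) by (intro span_minimal fsub_subspace[OF W]) auto
  then have "N' \<subseteq> W" unfolding N'_def by blast
  moreover have "pos_on (\<lambda>x y. - ?u x y) N'" unfolding pos_on_def
  proof (intro ballI impI)
    fix x assume x: "x \<in> N'" "x \<noteq> 0"
    have xs: "x \<in> span (insert r N)" "a x = 0" using x(1) unfolding N'_def by blast+
    obtain v c where vc: "x = v + c *s r" "v \<in> N"
      by (rule span_insert_cases[OF xs(1) fsub_subspace[OF N(1)]])
    have vW: "v \<in> W" using vc N(2) by blast
    have ac: "a v + c = 0"
      using xs(2) by (simp add: vc(1) functional_add[OF a(1)] functional_scale[OF a(1)] a(3))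
    have "v \<noteq> 0"
    proof
      assume "v = 0"
      then have "c = 0" using ac functional_zero[OF a(1)] by simp
      then show False using x(2) vc(1) \<open>v = 0\<close> by simp
    qed
    then have "0 < Re (- h v v)" using N(3) vc(2) unfolding pos_on_def by blast
    then show "0 < Re (- ?u x x)" using self[OF vW vc(1)] ac by simp
  qed
  ultimately have "negi h W \<le> negi ?u W"
    unfolding negi_def using posi_ge[OF W sN'] N(4) by fastforce
  then show ?thesis using 1 h'(1,3) by auto
qed

text \<open>With \<open>f x = h x w\<close> and \<open>b r = 1\<close> the update leaves the form on
  the complement \<open>?V\<close> of \<open>w\<close> unchanged but pairs \<open>r\<close> with
  \<open>w\<close>. A hyperbolic plane replaces the definite line of \<open>w\<close>: both indices
  of \<open>?V\<close> grow, whereas in \<open>h\<close> the vector \<open>w\<close> contributed to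
  one index only.\<close>

lemma pair_radical_vector:
  assumes hF: "h \<in> F" and w: "w \<in> perp h K W" "h w w \<noteq> 0" and r: "r \<in> radical h W" "r \<notin> L"
  shows "\<exists>h'\<in>F. posi h W + negi h W < posi h' W + negi h' W
    \<and> (Re (h w w) < 0 \<longrightarrow> posi h W < posi h' W)"
proof -
  have h: "herm h" by (rule herm[OF hF])
  have rW: "r \<in> W" "\<And>x. x \<in> W \<Longrightarrow> h r x = 0" using r(1) unfolding perp_def by blast+
  have wW: "w \<in> W" using w(1) unfolding perp_def by blast
  obtain b where b: "functional b" "\<And>x. x \<in> L \<Longrightarrow> b x = 0" "b r = 1"
    by (rule functional_separating[OF L(1) r(2)]) (use that in blast)
  define f where "f x = h x w" for x
  have ff: "functional f" unfolding f_def by (rule functional_herm[OF h])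
  have fK: "f x = 0" if "x \<in> K" for x unfolding f_def by (rule perp_functional(2)[OF hF w(1) that])
  obtain h' where h': "h' \<in> F" "posi h' W = posi (rank_two_update h f b) W" "negi h' W = negi (rank_two_update h f b) W"
    by (rule update[OF hF ff b(1) fK b(2)]) (use that in blast)+
  let ?u = "rank_two_update h f b" and ?V = "perp h {w} W"
  have u: "herm ?u" by (rule herm_rank_two_update[OF h ff b(1)])
  have fV: "fsub ?V" by (rule fsub_perp[OF h W])
  have f0: "f x = 0" if "x \<in> ?V" for x using that unfolding f_def perp_def by blast
  have rV: "r \<in> ?V" using rW wW unfolding perp_def by blast
  have same: "?u x y = h x y" if "x \<in> ?V" "y \<in> ?V" for x y by (simp add: rank_two_update_def f0 that)
  have ru: "?u r x = 0" if "x \<in> ?V" for x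
    using same[OF rV that] rW(2) that perp_subset[of h "{w}" W] by auto
  have urw: "?u r w \<noteq> 0"
  proof -
    have "?u r w = cnj (h w w)" using rW(2)[OF wW] f0[OF rV] by (simp add: rank_two_update_def b(3) f_def)
    then show ?thesis using w(2) by simp
  qed
  have "Suc (posi h ?V) \<le> posi ?u W"
  proof -
    obtain P where P: "fsub P" "P \<subseteq> ?V" "pos_on h P" "dim P = posi h ?V"
      by (rule posi_attained[OF fV])
    have "pos_on ?u P" using P(2,3) same unfolding pos_on_def by (simp add: subset_iff)
    then have "Suc (dim P) \<le> posi ?u W"
      using P(2) perp_subset[of h "{w}" W] ru ru[OF rV] rW(1) wW urw
      by (intro posi_extend[OF u W fsub_subspace[OF P(1)]]) auto
    then show ?thesis using P(4) by simp
  qed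
  moreover have "Suc (negi h ?V) \<le> negi ?u W"
  proof -
    obtain P where P: "fsub P" "P \<subseteq> ?V" "pos_on (\<lambda>x y. - h x y) P" "dim P = posi (\<lambda>x y. - h x y) ?V"
      by (rule posi_attained[OF fV])
    have "pos_on (\<lambda>x y. - ?u x y) P" using P(2,3) same unfolding pos_on_def by (simp add: subset_iff)
    then have "Suc (dim P) \<le> posi (\<lambda>x y. - ?u x y) W"
      using P(2) perp_subset[of h "{w}" W] ru ru[OF rV] rW(1) wW urw
      by (intro posi_extend[OF herm_uminus[OF u] W fsub_subspace[OF P(1)]]) auto
    then show ?thesis using P(4) unfolding negi_def by simp
  qed
  ultimately show ?thesis
    using inertia_split_vector[OF h W wW w(2)] h' herm_self_eq_0[OF h, of w] w(2)
    by (intro bexI[of _ h']) (auto split: if_splits)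
qed

text \<open>With \<open>t1\<close>, \<open>t2\<close> and \<open>T\<close> as in the proof, the new form at \<open>v\<close> exceeds the old form at \<open>T v\<close>
  by a positive definite quadratic form in \<open>(t1 v, t2 v)\<close>. Hence \<open>T\<close> embeds a nonpositive space of
  the new form into one of the old form, and there is still room for \<open>w\<close>.\<close>

lemma combine_negative_vectors:
  assumes hF: "h \<in> F" and w: "w \<in> perp h K W" "w' \<in> perp h L W"
    and neg: "Re (h w w) < 0" "Re (h w' w') < 0"
  shows "\<exists>h'\<in>F. posi h W < posi h' W"
proof -
  have h: "herm h" by (rule herm[OF hF])
  define p q \<rho> where "p = Re (h w w)" and "q = Re (h w' w')" and "\<rho> = h w' w"
  have pq: "p < 0" "q < 0" using neg unfolding p_def q_def by blast+
  \<comment> \<open>As in \<open>enlarge_radical\<close>, but with \<open>\<sigma>^2\<close>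
    strictly below \<open>p * q\<close>, which makes \<open>G\<close> definite. The value 0 serves
    unless \<open>\<rho> = 0\<close>, when \<open>s\<close> would vanish.\<close>
  define \<sigma> where "\<sigma> = (if \<rho> = 0 then sqrt (p * q) / 2 else 0)"
  have pq0: "0 < p * q" using pq by (simp add: mult_neg_neg)
  have \<sigma>: "\<sigma> * \<sigma> < p * q" unfolding \<sigma>_def using pq0 by auto
  define s where "s = of_real \<sigma> + \<rho>"
  have s0: "s \<noteq> 0" unfolding s_def \<sigma>_def using pq0 pq by auto
  have wW: "w \<in> W" "w' \<in> W" using w unfolding perp_def by blast+
  define \<kappa> where "\<kappa> = - (1 / s)"
  define f where "f x = \<kappa> * h x w" for x
  define g where "g x = h x w'" for x
  have ff: "functional f"
    unfolding f_def functional_def by (simp add: herm_simps[OF h] distrib_left mult.left_commute)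
  have gf: "functional g" unfolding g_def by (rule functional_herm[OF h])
  have fK: "f x = 0" if "x \<in> K" for x using perp_functional(2)[OF hF w(1) that] by (simp add: f_def)
  have gL: "g x = 0" if "x \<in> L" for x using perp_functional(2)[OF hF w(2) that] by (simp add: g_def)
  obtain h' where h': "h' \<in> F" "posi h' W = posi (rank_two_update h f g) W"
    by (rule update[OF hF ff gf fK gL]) (use that in blast)+
  let ?u = "rank_two_update h f g"
  have u: "herm ?u" by (rule herm_rank_two_update[OF h ff gf])
  define t1 t2 where "t1 v = h v w' / cnj s" and "t2 v = h v w / s" for v
  define T where "T v = v - t1 v *s w - t2 v *s w'" for v
  define G where "G y z = p * (cmod y)\<^sup>2 + q * (cmod z)\<^sup>2 + 2 * \<sigma> * Re (z * cnj y)" for y z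
  \<comment> \<open>Completing the square; since \<open>p < 0\<close> and
    \<open>\<sigma>^2 < p * q\<close>, this makes \<open>G\<close> negative definite.\<close>
  have pG: "p * G y z = (cmod (of_real p * y + of_real \<sigma> * z))\<^sup>2 + (p * q - \<sigma> * \<sigma>) * (cmod z)\<^sup>2" for y z
    unfolding G_def cmod_power2 by (simp add: power2_eq_square algebra_simps)
  have G_le: "G y z \<le> 0" for y z
  proof -
    have "0 \<le> p * G y z" unfolding pG using \<sigma> by (intro add_nonneg_nonneg mult_nonneg_nonneg) auto
    then show ?thesis using pq by (simp add: zero_le_mult_iff)
  qed
  have G_0: "y = 0 \<and> z = 0" if "0 \<le> G y z" for y z
  proof -
    have "G y z = 0" using that G_le[of y z] by simp
    then have "(cmod (of_real p * y + of_real \<sigma> * z))\<^sup>2 + (p * q - \<sigma> * \<sigma>) * (cmod z)\<^sup>2 = 0"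
      using pG[of y z] by simp
    moreover have "0 \<le> (p * q - \<sigma> * \<sigma>) * (cmod z)\<^sup>2" using \<sigma> by simp
    ultimately have "(cmod (of_real p * y + of_real \<sigma> * z))\<^sup>2 = 0" "(p * q - \<sigma> * \<sigma>) * (cmod z)\<^sup>2 = 0"
      by (simp_all add: add_nonneg_eq_0_iff)
    then have "z = 0" "of_real p * y = 0" using \<sigma> by auto
    then show ?thesis using pq by simp
  qed
  \<comment> \<open>The free multiple \<open>x\<close> of \<open>w\<close> lets one identity serve
    three times: for the injectivity of \<open>T\<close> on \<open>Q\<close>, for \<open>w\<close>
    outside the image, and for nonpositivity on the enlarged space.\<close>
  have key: "Re (h (T v + x *s w) (T v + x *s w)) = Re (?u v v) + G (x - t1 v) (t2 v)" for v x
  proof -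
    define y z where "y = x - t1 v" and "z = t2 v"
    have a: "h v w = s * z" and b: "h v w' = cnj s * t1 v"
      unfolding z_def t1_def t2_def using s0 by simp_all
    have e: "T v + x *s w = v + (y *s w + (- z) *s w')"
      unfolding T_def y_def z_def by (simp add: scale_left_diff_distrib)
    have ww': "h w w' = cnj \<rho>" unfolding \<rho>_def by (rule herm_sym[OF h])
    have "Re (h (T v + x *s w) (T v + x *s w)) = Re (h v v) + (cmod y)\<^sup>2 * p + (cmod z)\<^sup>2 * q
        - 2 * Re (y * cnj z * cnj \<rho>) + 2 * Re (cnj y * (s * z) - cnj z * (cnj s * t1 v))"
      unfolding e herm_self_add[OF h] herm_self_scale[OF h]
      by (simp add: herm_simps[OF h] a b ww' p_def q_def algebra_simps)
    moreover have "Re (?u v v) = Re (h v v) - 2 * Re (z * (s * cnj (t1 v)))"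
      using s0 by (simp add: rank_two_update_self f_def g_def \<kappa>_def a b)
    moreover have "- Re (y * cnj z * cnj \<rho>) + Re (cnj y * (s * z)) = \<sigma> * Re (z * cnj y)"
      unfolding s_def by (simp add: algebra_simps)
    moreover have "Re (cnj z * (cnj s * t1 v)) = Re (z * (s * cnj (t1 v)))"
      by (simp add: algebra_simps)
    ultimately show ?thesis unfolding G_def y_def[symmetric] z_def[symmetric]
      by (simp add: algebra_simps)
  qed
  have lT: "Vector_Spaces.linear scale scale T"
    by (rule endo_linearI) (simp_all add: T_def t1_def t2_def herm_simps[OF h] add_divide_distrib
        scale_left_distrib scale_right_diff_distrib algebra_simps)
  interpret T: Vector_Spaces.linear scale scale T by (rule lT)
  obtain P where P: "nonpos_on ?u (perp ?u P W)" "dim (perp ?u P W) + posi ?u W = dim W"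
    by (rule posi_decompose[OF u W])
  define Q where "Q = perp ?u P W"
  have Q: "fsub Q" "Q \<subseteq> W" "nonpos_on ?u Q"
    unfolding Q_def using fsub_perp[OF u W] perp_subset P(1) by auto
  have le: "Re (?u v v) \<le> 0" if "v \<in> Q" for v using Q(3) that unfolding nonpos_on_def by blast
  have inj: "v = 0" if "v \<in> Q" "T v = 0" for v
  proof -
    have "0 \<le> G (0 - t1 v) (t2 v)"
      using key[of v 0] le[OF that(1)] that(2) herm_zero_left[OF h] by simp
    then have "0 - t1 v = 0 \<and> t2 v = 0" by (rule G_0)
    then show ?thesis using that(2) unfolding T_def by simp
  qed
  obtain C where C: "dim C = dim (T ` Q)" "dim Q = dim C + dim {x \<in> Q. T x = 0}"
    by (rule linear_section[OF lT fsub_subspace[OF Q(1)] fsub_fin_dim[OF Q(1)]])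
  have "{x \<in> Q. T x = 0} \<subseteq> {0}" using inj by blast
  then have "dim {x \<in> Q. T x = 0} = 0" using fsub_dim_mono[OF fsub_zero] by fastforce
  then have dTQ: "dim (T ` Q) = dim Q" using C by simp
  have TW: "T v \<in> W" if "v \<in> W" for v
    unfolding T_def using that wW fsub_subspace[OF W] by (simp add: subspace_diff subspace_scale)
  have sTQ: "subspace (T ` Q)" by (rule T.subspace_image[OF fsub_subspace[OF Q(1)]])
  have fTQ: "fsub (T ` Q)" by (rule fsub_subset[OF W sTQ]) (use TW Q(2) in blast)
  have "w \<notin> T ` Q"
  proof
    assume "w \<in> T ` Q"
    then obtain v where v: "v \<in> Q" "w = T v" by blast
    have "T v + (- 1) *s w = 0" using v(2) by simp
    then have "0 \<le> G (- 1 - t1 v) (t2 v)"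
      using key[of v "- 1"] le[OF v(1)] herm_zero_left[OF h] by simp
    \<comment> \<open>Now \<open>T v = v + w\<close>, so that \<open>T v = w\<close> leaves only
      \<open>v = 0\<close>, where \<open>t1\<close> is 0 and not \<open>- 1\<close>.\<close>
    then have t: "t1 v = - 1" "t2 v = 0" using G_0[of "- 1 - t1 v" "t2 v"] by (auto simp: algebra_simps)
    then have "T v = v + w" unfolding T_def by simp
    then have "v = 0" using v(2) by simp
    then have "t1 v = 0" unfolding t1_def by (simp add: herm_zero_left[OF h])
    then show False using t by simp
  qed
  then have "dim (span (insert w (T ` Q))) = Suc (dim Q)"
    using dim_span_insert[OF sTQ fsub_fin_dim[OF fTQ]] dTQ by simp
  moreover have "nonpos_on h (span (insert w (T ` Q)))" unfolding nonpos_on_def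
  proof
    fix x assume "x \<in> span (insert w (T ` Q))"
    then obtain y c where "x = y + c *s w" "y \<in> T ` Q" using sTQ by (rule span_insert_cases)
    then obtain v where v: "v \<in> Q" "x = T v + c *s w" by blast
    show "Re (h x x) \<le> 0" unfolding v(2) key using le[OF v(1)] G_le by (simp add: add_nonpos_nonpos)
  qed
  moreover have "span (insert w (T ` Q)) \<subseteq> W"
    using wW(1) TW Q(2) by (intro span_minimal fsub_subspace[OF W]) auto
  ultimately have "Suc (dim Q) + posi h W \<le> dim W"
    using nonpos_dim[OF W subspace_span] by metis
  then have "posi h W < posi ?u W" using P(2) unfolding Q_def by simp
  then show ?thesis using h' by (intro bexI[of _ h']) simp_all
qed

lemma greatest_exists:
  assumes "\<And>h. h \<in> F \<Longrightarrow> \<mu> h \<le> (N::nat)"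
  obtains h where "h \<in> F" "\<And>h'. h' \<in> F \<Longrightarrow> \<mu> h' \<le> \<mu> h"
proof -
  obtain h0 where "h0 \<in> F" using nonempty by blast
  then have "\<exists>h. h \<in> F \<and> (\<forall>h'. h' \<in> F \<longrightarrow> \<mu> h' \<le> \<mu> h)"
    using assms by (intro ex_has_greatest_nat) (auto intro: le_imp_less_Suc)
  then show ?thesis using that by blast
qed

text \<open>For a form with the largest \<open>posi\<close>, failure at \<open>K\<close> yields, by
  \<open>posi_eq_codim\<close>, a negative vector in the complement of \<open>K\<close> or a radical
  vector outside \<open>K\<close>; failure at \<open>L\<close> does the same for \<open>L\<close>.
  Each of the four combinations admits an improving update.\<close>

lemma max_posi:
  "\<exists>h\<in>F. posi h W + dim K = posi h K + dim W \<or> posi h W + dim L = posi h L + dim W"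
proof -
  obtain h where hF: "h \<in> F" and max: "\<And>h'. h' \<in> F \<Longrightarrow> posi h' W \<le> posi h W"
    using greatest_exists[of "\<lambda>h. posi h W"] posi_le_dim[OF W] by blast
  have h: "herm h" by (rule herm[OF hF])
  have no: "\<not> (\<exists>h'\<in>F. posi h W < posi h' W)" using max by (auto simp: not_less)
  show ?thesis
  proof (rule ccontr)
    assume "\<not> ?thesis"
    then have nK: "posi h W + dim K \<noteq> posi h K + dim W" and nL: "posi h W + dim L \<noteq> posi h L + dim W"
      using hF by blast+
    have "(\<exists>w\<in>perp h K W. Re (h w w) < 0) \<or> \<not> radical h W \<subseteq> K"
      using posi_eq_codim[OF h W K] nK unfolding nonpos_on_def by fastforce
    moreover have "(\<exists>w\<in>perp h L W. Re (h w w) < 0) \<or> \<not> radical h W \<subseteq> L"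
      using posi_eq_codim[OF h W L] nL unfolding nonpos_on_def by fastforce
    moreover have "\<not> ((\<exists>w\<in>perp h K W. Re (h w w) < 0) \<and> (\<exists>w\<in>perp h L W. Re (h w w) < 0))"
      using combine_negative_vectors[OF hF] no by blast
    moreover have False if w: "w \<in> perp h K W" "Re (h w w) < 0" and R: "\<not> radical h W \<subseteq> L" for w
    proof -
      obtain r where "r \<in> radical h W" "r \<notin> L" using R by blast
      moreover have "h w w \<noteq> 0" using w(2) by auto
      ultimately show False using pair_radical_vector[OF hF w(1)] w(2) no by blast
    qed
    moreover have False if w: "w \<in> perp h L W" "Re (h w w) < 0" and R: "\<not> radical h W \<subseteq> K" for w
    proof -
      obtain r where "r \<in> radical h W" "r \<notin> K" using R by blast
      moreover have "h w w \<noteq> 0" using w(2) by auto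
      ultimately show False using form_family.pair_radical_vector[OF swap hF w(1)] w(2) no by blast
    qed
    moreover have False if R: "\<not> radical h W \<subseteq> K" "\<not> radical h W \<subseteq> L"
    proof -
      obtain r where "r \<in> radical h W" "r \<notin> K" "r \<notin> L"
        using subspace_union_proper[OF K(1) L(1) fsub_subspace[OF fsub_perp[OF h W]] R] .
      then show False using add_radical_vector[OF hF] no by blast
    qed
    ultimately show False by blast
  qed
qed

lemma max_negi:
  "\<exists>h\<in>F. negi h W + dim K = negi h K + dim W \<or> negi h W + dim L = negi h L + dim W"
  using form_family.max_posi[OF negate] by (simp add: negi_def)

text \<open>All members share \<open>K \<inter> L \<inter> radical h W\<close>, so the first
  alternative says that the radical is as small as possible. If instead the radical of a form of
  largest rank lies in \<open>K\<close> but not in \<open>L\<close>, then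
  \<open>pair_radical_vector\<close> leaves only isotropic vectors in the complement of
  \<open>K\<close>, and both indices attain the codimension bound there. A radical inside neither
  space is excluded by \<open>add_radical_vector\<close>.\<close>

lemma max_rank:
  "\<exists>h\<in>F. radical h W \<subseteq> K \<inter> L
    \<or> posi h W + negi h W + 2 * dim K = posi h K + negi h K + 2 * dim W
    \<or> posi h W + negi h W + 2 * dim L = posi h L + negi h L + 2 * dim W"
proof -
  have "posi h W + negi h W \<le> dim W" if "h \<in> F" for h
    using inertia_sum[OF herm[OF that] W] by simp
  then obtain h where hF: "h \<in> F"
    and max: "\<And>h'. h' \<in> F \<Longrightarrow> posi h' W + negi h' W \<le> posi h W + negi h W"
    using greatest_exists[of "\<lambda>h. posi h W + negi h W"] by blast
  have h: "herm h" by (rule herm[OF hF])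
  have no: "\<not> (\<exists>h'\<in>F. posi h W + negi h W < posi h' W + negi h' W)"
    using max by (auto simp: not_less)
  have codim: "posi h W + negi h W + 2 * dim V = posi h V + negi h V + 2 * dim W"
    if V: "subspace V" "V \<subseteq> W" and R: "radical h W \<subseteq> V" and z: "\<And>w. w \<in> perp h V W \<Longrightarrow> h w w = 0" for V
  proof -
    have "posi h W + dim V = posi h V + dim W"
      using z by (intro posi_eq_codim[OF h W V _ R]) (simp add: nonpos_on_def)
    moreover have "negi h W + dim V = negi h V + dim W"
      unfolding negi_def using z R
      by (intro posi_eq_codim[OF herm_uminus[OF h] W V]) (simp_all add: nonpos_on_def)
    ultimately show ?thesis by simp
  qed
  show ?thesis
  proof (rule ccontr)
    assume "\<not> ?thesis"
    then have nR: "\<not> radical h W \<subseteq> K \<inter> L"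
      and nK: "posi h W + negi h W + 2 * dim K \<noteq> posi h K + negi h K + 2 * dim W"
      and nL: "posi h W + negi h W + 2 * dim L \<noteq> posi h L + negi h L + 2 * dim W"
      using hF by blast+
    have "radical h W \<subseteq> K \<or> radical h W \<subseteq> L"
    proof (rule ccontr)
      assume "\<not> ?thesis"
      then obtain r where "r \<in> radical h W" "r \<notin> K" "r \<notin> L"
        using subspace_union_proper[OF K(1) L(1) fsub_subspace[OF fsub_perp[OF h W]]] by metis
      then obtain h' where "h' \<in> F" "posi h W < posi h' W" "negi h W \<le> negi h' W"
        using add_radical_vector[OF hF] by blast
      then show False using no by fastforce
    qed
    then show False
    proof
      assume R: "radical h W \<subseteq> K"
      then obtain w where w: "w \<in> perp h K W" "h w w \<noteq> 0" using codim[OF K R] nK by blast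
      obtain r where "r \<in> radical h W" "r \<notin> L" using R nR by blast
      then show False using pair_radical_vector[OF hF w] no by blast
    next
      assume R: "radical h W \<subseteq> L"
      then obtain w where w: "w \<in> perp h L W" "h w w \<noteq> 0" using codim[OF L R] nL by blast
      obtain r where "r \<in> radical h W" "r \<notin> K" using R nR by blast
      then show False using form_family.pair_radical_vector[OF swap hF w] no by blast
    qed
  qed
qed

end

section \<open>Matrices acting on finitely supported sequences\<close>

text \<open>The spaces \<open>\<complex>\<^sup>n\<close> of all dimensions are modelled inside the single vector space \<open>nat \<Rightarrow> complex\<close>,
  because the type of vectors of variable length is not a group.\<close>

definition fscale :: "complex \<Rightarrow> (nat \<Rightarrow> complex) \<Rightarrow> nat \<Rightarrow> complex" where
  "fscale c x = (\<lambda>i. c * x i)"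

lemma fscale_apply: "fscale c x i = c * x i"
  unfolding fscale_def by simp

interpretation fs: complex_vector_space fscale
  by unfold_locales (auto simp: fun_eq_iff fscale_apply algebra_simps)

definition csp :: "nat \<Rightarrow> (nat \<Rightarrow> complex) set" where
  "csp n = {x. \<forall>i\<ge>n. x i = 0}"

definition delta :: "nat \<Rightarrow> nat \<Rightarrow> complex" where
  "delta k = (\<lambda>i. if i = k then 1 else 0)"

lemma subspace_csp: "fs.subspace (csp n)"
  unfolding fs.subspace_def csp_def by (simp add: fscale_apply)

lemma csp_mono: "k \<le> n \<Longrightarrow> csp k \<subseteq> csp n"
  unfolding csp_def by auto

lemma sum_apply: "(\<Sum>i\<in>I. f i :: nat \<Rightarrow> complex) j = (\<Sum>i\<in>I. f i j)"
  by (induction I rule: infinite_finite_induct) simp_all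

lemma csp_eq_sum_delta:
  assumes "x \<in> csp n" shows "x = (\<Sum>i<n. fscale (x i) (delta i))"
proof
  fix j
  have "(\<Sum>i<n. fscale (x i) (delta i)) j = (\<Sum>i<n. if i = j then x i else 0)"
    unfolding sum_apply by (intro sum.cong) (auto simp: delta_def fscale_apply)
  also have "\<dots> = x j" using assms by (auto simp: csp_def)
  finally show "x j = (\<Sum>i<n. fscale (x i) (delta i)) j" by simp
qed

lemma csp_Suc: "csp (Suc n) = fs.span (insert (delta n) (csp n))"
proof
  show "fs.span (insert (delta n) (csp n)) \<subseteq> csp (Suc n)"
    by (rule fs.span_minimal[OF _ subspace_csp]) (auto simp: csp_def delta_def)
  show "csp (Suc n) \<subseteq> fs.span (insert (delta n) (csp n))"
  proof
    fix x assume x: "x \<in> csp (Suc n)"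
    define y where "y = x - fscale (x n) (delta n)"
    have "y i = 0" if "n \<le> i" for i
      using x that unfolding y_def csp_def delta_def by (cases "i = n") (auto simp: fscale_apply)
    then have "y \<in> csp n" unfolding csp_def by blast
    then have "y + fscale (x n) (delta n) \<in> fs.span (insert (delta n) (csp n))"
      by (intro fs.span_add fs.span_scale fs.span_base) auto
    then show "x \<in> fs.span (insert (delta n) (csp n))" unfolding y_def by simp
  qed
qed

lemma csp_0: "csp 0 = {0}"
  unfolding csp_def by auto

lemma fsub_csp: "fs.fsub (csp n)"
proof (induction n)
  case 0 then show ?case unfolding csp_0 by (rule fs.fsub_zero)
next
  case (Suc n) then show ?case unfolding csp_Suc by (rule fs.fsub_span_insert)
qed

lemma dim_csp [simp]: "fs.dim (csp n) = n"
proof (induction n)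
  case 0 then show ?case unfolding csp_0 by (rule fs.dim_zero_subspace)
next
  case (Suc n)
  have "delta n \<notin> csp n" unfolding csp_def delta_def by auto
  then show ?case unfolding csp_Suc
    using fs.dim_span_insert[OF subspace_csp fs.fsub_fin_dim[OF fsub_csp]] Suc by simp
qed

section \<open>Inner products and matrices on sequences\<close>

definition ip :: "nat \<Rightarrow> (nat \<Rightarrow> complex) \<Rightarrow> (nat \<Rightarrow> complex) \<Rightarrow> complex" where
  "ip n x y = (\<Sum>i<n. x i * cnj (y i))"

lemma herm_ip: "fs.herm (ip n)"
  by (rule fs.hermI) (simp_all add: ip_def fscale_apply sum.distrib sum_distrib_left algebra_simps)

lemmas ip_zero = fs.herm_zero_left[OF herm_ip] fs.herm_zero_right[OF herm_ip]
lemmas ip_simps = fs.herm_simps[OF herm_ip]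

lemma ip_self: "ip n x x = of_real (\<Sum>i<n. (cmod (x i))\<^sup>2)"
  unfolding ip_def of_real_sum complex_norm_square ..

lemma pos_on_ip: "fs.pos_on (ip n) (csp n)"
proof -
  have "0 < (\<Sum>i<n. (cmod (x i))\<^sup>2)" if x: "x \<in> csp n" "x \<noteq> 0" for x
  proof -
    obtain i where i: "x i \<noteq> 0" using x(2) by (auto simp: fun_eq_iff)
    then have "i < n" using x(1) unfolding csp_def by (auto simp: not_le[symmetric])
    then show ?thesis using i by (intro sum_pos2[of _ i]) auto
  qed
  then show ?thesis unfolding fs.pos_on_def ip_self by simp
qed

lemma ip_self_0: "x \<in> csp n \<Longrightarrow> ip n x x = 0 \<Longrightarrow> x = 0"
  using pos_on_ip[of n] unfolding fs.pos_on_def by force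

text \<open>Only the first \<open>dim_col M\<close> entries of \<open>x\<close> matter, just as
  \<open>ip n\<close> reads only the first \<open>n\<close>. A matrix can therefore be applied to
  the leading block of a longer sequence without truncating it.\<close>

definition mv :: "complex mat \<Rightarrow> (nat \<Rightarrow> complex) \<Rightarrow> nat \<Rightarrow> complex" where
  "mv M x = (\<lambda>i. if i < dim_row M then \<Sum>j<dim_col M. M $$ (i,j) * x j else 0)"

lemma mv_add: "mv M (x + y) = mv M x + mv M y"
  by (auto simp: mv_def fun_eq_iff sum.distrib algebra_simps)

lemma mv_scale: "mv M (fscale c x) = fscale c (mv M x)"
  by (auto simp: mv_def fun_eq_iff fscale_apply sum_distrib_left algebra_simps)

lemma linear_mv: "Vector_Spaces.linear fscale fscale (mv M)"
  by (rule fs.endo_linearI) (simp_all add: mv_add mv_scale)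

lemma mv_zero: "mv M 0 = 0"
  by (auto simp: mv_def fun_eq_iff)

lemma mv_minus: "mv M (- x) = - mv M x"
  by (auto simp: mv_def fun_eq_iff sum_negf)

lemma mv_diff: "mv M (x - y) = mv M x - mv M y"
  using mv_add[of M x "- y"] by (simp add: mv_minus)

lemma mv_csp: "mv M x \<in> csp (dim_row M)"
  unfolding csp_def mv_def by simp

lemma mv_csp': "M \<in> carrier_mat r c \<Longrightarrow> mv M x \<in> csp r"
  using mv_csp[of M x] by auto

lemma mv_cong: "(\<And>j. j < dim_col M \<Longrightarrow> x j = y j) \<Longrightarrow> mv M x = mv M y"
  unfolding mv_def by auto

lemma mv_mult:
  assumes "M \<in> carrier_mat r c" "N \<in> carrier_mat c d"
  shows "mv (M * N) x = mv M (mv N x)"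
proof
  fix i
  show "mv (M * N) x i = mv M (mv N x) i"
  proof (cases "i < r")
    case True
    have "mv (M * N) x i = (\<Sum>j<d. (\<Sum>k<c. M $$ (i,k) * N $$ (k,j)) * x j)"
      using True assms by (simp add: mv_def scalar_prod_def row_def col_def atLeast0LessThan)
    also have "\<dots> = (\<Sum>k<c. M $$ (i,k) * (\<Sum>j<d. N $$ (k,j) * x j))"
      unfolding sum_distrib_right sum_distrib_left mult.assoc by (rule sum.swap)
    also have "\<dots> = mv M (mv N x) i" using True assms by (simp add: mv_def)
    finally show ?thesis .
  qed (use assms in \<open>simp add: mv_def\<close>)
qed

lemma mv_add_mat:
  "M \<in> carrier_mat r c \<Longrightarrow> N \<in> carrier_mat r c \<Longrightarrow> mv (M + N) x = mv M x + mv N x"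
  by (auto simp: mv_def fun_eq_iff sum.distrib algebra_simps)

lemma mv_minus_mat:
  "M \<in> carrier_mat r c \<Longrightarrow> N \<in> carrier_mat r c \<Longrightarrow> mv (M - N) x = mv M x - mv N x"
  by (auto simp: mv_def fun_eq_iff sum_subtractf algebra_simps)

lemma mv_zero_mat: "mv (0\<^sub>m r c) x = 0"
  by (auto simp: mv_def fun_eq_iff)

lemma mv_one_mat: "mv (1\<^sub>m n) x = (\<lambda>i. if i < n then x i else 0)"
proof
  fix i
  have "(\<Sum>j<n. 1\<^sub>m n $$ (i,j) * x j) = (\<Sum>j<n. if j = i then x j else 0)" if "i < n"
    using that by (intro sum.cong) auto
  then show "mv (1\<^sub>m n) x i = (if i < n then x i else 0)" by (simp add: mv_def)
qed

lemma mv_one_mat_csp: "x \<in> csp n \<Longrightarrow> mv (1\<^sub>m n) x = x"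
  unfolding mv_one_mat csp_def by (auto simp: fun_eq_iff)

lemma adjoint_dim [simp]: "dim_row (mat_adjoint M) = dim_col M" "dim_col (mat_adjoint M) = dim_row M"
  unfolding mat_adjoint_def by simp_all

lemma adjoint_carrier: "M \<in> carrier_mat r c \<Longrightarrow> mat_adjoint M \<in> carrier_mat c r"
  by (intro carrier_matI) simp_all

lemma adjoint_index [simp]:
  assumes "i < dim_col M" "j < dim_row M" shows "mat_adjoint M $$ (i,j) = cnj (M $$ (j,i))"
  using assms unfolding mat_adjoint_def mat_of_rows_def by simp

lemma adjoint_adjoint [simp]: "mat_adjoint (mat_adjoint M) = (M :: complex mat)"
  by (rule eq_matI) auto

lemma adjoint_mult:
  fixes M N :: "complex mat"
  assumes "M \<in> carrier_mat r c" "N \<in> carrier_mat c d"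
  shows "mat_adjoint (M * N) = mat_adjoint N * mat_adjoint M"
  using assms by (intro eq_matI) (auto simp: scalar_prod_def row_def col_def mult.commute)

lemma ip_adjoint:
  assumes "M \<in> carrier_mat r c"
  shows "ip r (mv M x) y = ip c x (mv (mat_adjoint M) y)"
proof -
  have "ip r (mv M x) y = (\<Sum>i<r. \<Sum>j<c. M $$ (i,j) * x j * cnj (y i))"
    using assms by (simp add: ip_def mv_def sum_distrib_right)
  also have "\<dots> = (\<Sum>j<c. \<Sum>i<r. M $$ (i,j) * x j * cnj (y i))" by (rule sum.swap)
  also have "\<dots> = ip c x (mv (mat_adjoint M) y)"
    using assms by (simp add: ip_def mv_def sum_distrib_left algebra_simps)
  finally show ?thesis .
qed

lemma ip_adjoint':
  assumes "M \<in> carrier_mat r c"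
  shows "ip c (mv (mat_adjoint M) x) y = ip r x (mv M y)"
  using ip_adjoint[OF adjoint_carrier[OF assms], of x y] by simp

definition qf :: "complex mat \<Rightarrow> (nat \<Rightarrow> complex) \<Rightarrow> (nat \<Rightarrow> complex) \<Rightarrow> complex" where
  "qf M x y = ip (dim_row M) (mv M x) y"

lemma herm_qf:
  assumes M: "M \<in> carrier_mat n n" and adj: "mat_adjoint M = M"
  shows "fs.herm (qf M)"
proof (rule fs.hermI)
  show "qf M y x = cnj (qf M x y)" for x y
  proof -
    have "qf M y x = ip n y (mv M x)" unfolding qf_def using ip_adjoint[OF M, of y x] M adj by simp
    then show ?thesis unfolding qf_def using fs.herm_sym[OF herm_ip[of n], of y "mv M x"] M by simp
  qed
qed (simp_all add: qf_def mv_add mv_scale ip_simps)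

section \<open>Matrix rank as the dimension of the image\<close>

definition vec_fun :: "complex vec \<Rightarrow> nat \<Rightarrow> complex" where
  "vec_fun v = (\<lambda>i. if i < dim_vec v then v $ i else 0)"

lemma inj_on_vec_fun: "inj_on vec_fun (carrier_vec n)"
proof (rule inj_onI)
  fix v w :: "complex vec" assume vw: "v \<in> carrier_vec n" "w \<in> carrier_vec n" "vec_fun v = vec_fun w"
  have "v $ i = w $ i" if "i < n" for i
    using fun_cong[OF vw(3), of i] that vw(1,2) by (simp add: vec_fun_def)
  then show "v = w" using vw(1,2) by (intro eq_vecI) auto
qed

text \<open>A bridge from the carrier-based vector spaces in which \<open>mrank\<close> is defined
  to the type-based space of sequences: on both sides the same linear combinations vanish.\<close>

lemma lin_indpt_iff_independent:
  assumes "finite S" "S \<subseteq> carrier_vec n"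
  shows "module.lin_dep class_ring (module_vec TYPE(complex) n) S \<longleftrightarrow> fs.dependent (vec_fun ` S)"
proof -
  interpret vec_space "TYPE(complex)" n .
  have inj: "inj_on vec_fun S" using inj_on_vec_fun assms(2) by (rule inj_on_subset)
  have zero_iff: "lincomb a S = 0\<^sub>v n \<longleftrightarrow> (\<Sum>v\<in>S. fscale (a v) (vec_fun v)) = 0" for a
  proof -
    have e: "lincomb a S $ i = (\<Sum>v\<in>S. fscale (a v) (vec_fun v)) i" if "i < n" for i
    proof -
      have "(\<Sum>v\<in>S. fscale (a v) (vec_fun v)) i = (\<Sum>v\<in>S. a v * v $ i)"
        unfolding sum_apply using that assms(2) by (intro sum.cong) (auto simp: vec_fun_def fscale_apply)
      then show ?thesis using lincomb_index[OF that assms(2)] by simp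
    qed
    have z: "(\<Sum>v\<in>S. fscale (a v) (vec_fun v)) i = 0" if "\<not> i < n" for i
      unfolding sum_apply using that assms(2) by (intro sum.neutral) (auto simp: vec_fun_def fscale_apply)
    have c: "lincomb a S \<in> carrier_vec n" using assms(2) by (rule lincomb_closed)
    show ?thesis
    proof
      assume "lincomb a S = 0\<^sub>v n"
      then have "(\<Sum>v\<in>S. fscale (a v) (vec_fun v)) i = 0" for i
        using e[of i] z[of i] by (cases "i < n") auto
      then show "(\<Sum>v\<in>S. fscale (a v) (vec_fun v)) = 0" by (simp add: fun_eq_iff)
    next
      assume "(\<Sum>v\<in>S. fscale (a v) (vec_fun v)) = 0"
      then show "lincomb a S = 0\<^sub>v n" using e c by (intro eq_vecI) auto
    qed
  qed
  show ?thesis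
  proof
    assume "lin_dep S"
    then obtain a v where a: "lincomb a S = 0\<^sub>v n" "v \<in> S" "a v \<noteq> 0"
      using finite_lin_dep[OF assms(1) _ assms(2)] by (auto simp: class_ring_simps)
    define u where "u y = a (the_inv_into S vec_fun y)" for y
    have u: "u (vec_fun v) = a v" if "v \<in> S" for v unfolding u_def using the_inv_into_f_f[OF inj that] by simp
    have "(\<Sum>y\<in>vec_fun ` S. fscale (u y) y) = (\<Sum>v\<in>S. fscale (a v) (vec_fun v))"
      unfolding sum.reindex[OF inj] o_def using u by (intro sum.cong) auto
    then have "(\<Sum>y\<in>vec_fun ` S. fscale (u y) y) = 0" using zero_iff a(1) by simp
    then show "fs.dependent (vec_fun ` S)"
      using a(2,3) u assms(1) by (subst fs.dependent_finite) (auto intro!: exI[of _ u])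
  next
    assume "fs.dependent (vec_fun ` S)"
    then obtain u v where u: "v \<in> S" "u (vec_fun v) \<noteq> 0" "(\<Sum>y\<in>vec_fun ` S. fscale (u y) y) = 0"
      using fs.dependent_finite[of "vec_fun ` S"] assms(1) by auto
    have "lincomb (\<lambda>v. u (vec_fun v)) S = 0\<^sub>v n"
      using u(3) unfolding sum.reindex[OF inj] o_def by (simp add: zero_iff)
    then show "lin_dep S"
      using lin_dep_crit[OF assms(1) order_refl TrueI u(1), of "\<lambda>v. u (vec_fun v)"] u(2) by simp
  qed
qed

lemma vec_fun_col:
  assumes "M \<in> carrier_mat r c" "j < c" shows "vec_fun (col M j) = mv M (delta j)"
proof
  fix i
  have "(\<Sum>k<c. M $$ (i,k) * delta j k) = (\<Sum>k<c. if k = j then M $$ (i,k) else 0)"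
    by (intro sum.cong) (auto simp: delta_def)
  then show "vec_fun (col M j) i = mv M (delta j) i" using assms by (auto simp: vec_fun_def mv_def)
qed

lemma mv_image_span:
  assumes "M \<in> carrier_mat r c" shows "mv M ` csp c = fs.span (vec_fun ` set (cols M))"
proof -
  interpret l: Vector_Spaces.linear fscale fscale "mv M" by (rule linear_mv)
  have "vec_fun ` set (cols M) = (\<lambda>j. mv M (delta j)) ` {..<c}"
    using assms vec_fun_col[OF assms] by (simp add: cols_def image_image lessThan_atLeast0)
  moreover have "csp c = fs.span (delta ` {..<c})"
  proof
    show "fs.span (delta ` {..<c}) \<subseteq> csp c"
      by (rule fs.span_minimal[OF _ subspace_csp]) (auto simp: csp_def delta_def)
    show "csp c \<subseteq> fs.span (delta ` {..<c})"
    proof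
      fix x assume "x \<in> csp c"
      then have "x = (\<Sum>i<c. fscale (x i) (delta i))" by (rule csp_eq_sum_delta)
      moreover have "(\<Sum>i<c. fscale (x i) (delta i)) \<in> fs.span (delta ` {..<c})"
        by (intro fs.span_sum fs.span_scale fs.span_base) simp
      ultimately show "x \<in> fs.span (delta ` {..<c})" by simp
    qed
  qed
  ultimately show ?thesis using l.span_image[of "delta ` {..<c}"] by (simp add: image_image)
qed

text \<open>The rank is the size of a maximal independent set of columns, and \<open>vec_fun\<close>
  maps such a set to a basis of the image.\<close>

lemma mrank_eq_dim_image:
  assumes M: "M \<in> carrier_mat r c" shows "mrank M = fs.dim (mv M ` csp c)"
proof -
  interpret vec_space "TYPE(complex)" r .
  let ?P = "\<lambda>T. T \<subseteq> set (cols M) \<and> lin_indpt T"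
  have fin: "finite (set (cols M))" by simp
  have "lin_indpt {}" using lin_indpt_iff_independent[of "{}" r] fs.independent_empty by simp
  then obtain S where S: "finite S" "maximal S ?P"
    using maximal_exists_superset[OF fin, of ?P "{}"] by auto
  have cols: "set (cols M) \<subseteq> carrier_vec r" using M cols_dim by blast
  have S': "S \<subseteq> set (cols M)" "lin_indpt S" using S(2) unfolding maximal_def by blast+
  have ind: "fs.independent (vec_fun ` S)"
    using lin_indpt_iff_independent[OF S(1), of r] S' cols by auto
  have "vec_fun ` set (cols M) \<subseteq> fs.span (vec_fun ` S)"
  proof
    fix y assume "y \<in> vec_fun ` set (cols M)"
    then obtain v where v: "v \<in> set (cols M)" "y = vec_fun v" by blast
    show "y \<in> fs.span (vec_fun ` S)"
    proof (rule ccontr)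
      assume n: "y \<notin> fs.span (vec_fun ` S)"
      then have "fs.independent (vec_fun ` insert v S)"
        using ind fs.independent_insertI v(2) by simp
      then have "lin_indpt (insert v S)"
        using lin_indpt_iff_independent[of "insert v S" r] S(1) S'(1) v(1) cols by auto
      then have "insert v S = S" using S(2) S'(1) v(1) unfolding maximal_def by blast
      then have "y \<in> vec_fun ` S" using v(2) by blast
      then show False using n fs.span_base by blast
    qed
  qed
  then have "fs.span (vec_fun ` set (cols M)) = fs.span (vec_fun ` S)"
    using S'(1) by (intro antisym fs.span_minimal fs.span_mono) auto
  then have "fs.dim (mv M ` csp c) = card (vec_fun ` S)"
    unfolding mv_image_span[OF M] using fs.dim_span_eq_card_independent[OF ind] by simp
  also have "\<dots> = card S"
    using S'(1) cols by (intro card_image inj_on_subset[OF inj_on_vec_fun[of r]]) auto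
  also have "\<dots> = rank M" using rank_card_indpt[OF M S(2)] by simp
  finally show ?thesis unfolding mrank_def using M by simp
qed

definition ker :: "nat \<Rightarrow> complex mat \<Rightarrow> (nat \<Rightarrow> complex) set" where
  "ker n M = {x \<in> csp n. mv M x = 0}"

lemma subspace_ker: "fs.subspace (ker n M)"
  unfolding ker_def using subspace_csp[of n]
  by (auto simp: fs.subspace_def mv_add mv_scale mv_zero fun_eq_iff fscale_apply)

lemma fsub_ker: "fs.fsub (ker n M)"
  by (rule fs.fsub_subset[OF fsub_csp subspace_ker]) (auto simp: ker_def)

lemma rank_nullity:
  assumes "M \<in> carrier_mat r c" shows "mrank M + fs.dim (ker c M) = c"
proof -
  obtain C where "fs.dim C = fs.dim (mv M ` csp c)"
    "fs.dim (csp c) = fs.dim C + fs.dim {x \<in> csp c. mv M x = 0}"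
    by (rule fs.linear_section[OF linear_mv[of M] subspace_csp[of c] fs.fsub_fin_dim[OF fsub_csp[of c]]])
  then show ?thesis using mrank_eq_dim_image[OF assms] unfolding ker_def by simp
qed

lemma perp_image:
  assumes M: "M \<in> carrier_mat r c"
  shows "fs.perp (ip r) (mv M ` csp c) (csp r) = ker r (mat_adjoint M)"
proof -
  have "(\<forall>x\<in>csp c. ip r y (mv M x) = 0) \<longleftrightarrow> mv (mat_adjoint M) y = 0" if "y \<in> csp r" for y
  proof
    assume "\<forall>x\<in>csp c. ip r y (mv M x) = 0"
    moreover have z: "mv (mat_adjoint M) y \<in> csp c" by (rule mv_csp'[OF adjoint_carrier[OF M]])
    ultimately have "ip c (mv (mat_adjoint M) y) (mv (mat_adjoint M) y) = 0"
      unfolding ip_adjoint'[OF M] by blast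
    then show "mv (mat_adjoint M) y = 0" using ip_self_0[OF z] by blast
  next
    assume "mv (mat_adjoint M) y = 0"
    then show "\<forall>x\<in>csp c. ip r y (mv M x) = 0"
      unfolding ip_adjoint'[OF M, symmetric] by (simp add: ip_zero)
  qed
  then show ?thesis unfolding fs.perp_def ker_def by auto
qed

lemma radical_ip: "fs.radical (ip n) (csp n) = {0}"
  using ip_self_0 fs.subspace_0[OF subspace_csp] ip_zero
  unfolding fs.perp_def by blast

lemma rank_left_nullity:
  assumes M: "M \<in> carrier_mat r c" shows "mrank M + fs.dim (ker r (mat_adjoint M)) = r"
proof -
  interpret l: Vector_Spaces.linear fscale fscale "mv M" by (rule linear_mv)
  have s: "fs.subspace (mv M ` csp c)" by (rule l.subspace_image[OF subspace_csp])
  have sub: "mv M ` csp c \<subseteq> csp r" using mv_csp'[OF M] by blast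
  have "mv M ` csp c \<inter> {0} = {0}" using fs.subspace_0[OF s] by blast
  then show ?thesis
    using fs.dim_perp[OF herm_ip[of r] fsub_csp s sub] mrank_eq_dim_image[OF M]
    unfolding perp_image[OF M] radical_ip by simp
qed

text \<open>The radical of \<open>qf M\<close> is the kernel of \<open>M\<close>; rank-nullity and
  \<open>inertia_sum\<close> both give its dimension.\<close>

lemma rank_eq_inertia:
  assumes M: "M \<in> carrier_mat n n" and adj: "mat_adjoint M = M"
  shows "mrank M = fs.posi (qf M) (csp n) + fs.negi (qf M) (csp n)"
proof -
  have "(\<forall>y\<in>csp n. qf M x y = 0) \<longleftrightarrow> mv M x = 0" for x
  proof
    assume "\<forall>y\<in>csp n. qf M x y = 0"
    then have "ip n (mv M x) (mv M x) = 0" using mv_csp'[OF M, of x] M unfolding qf_def by auto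
    then show "mv M x = 0" by (rule ip_self_0[OF mv_csp'[OF M]])
  qed (simp add: qf_def ip_zero)
  then have "fs.radical (qf M) (csp n) = ker n M" unfolding fs.perp_def ker_def by blast
  then show ?thesis
    using fs.inertia_sum[OF herm_qf[OF assms] fsub_csp[of n]] rank_nullity[OF M] by simp
qed

section \<open>Eigenvalue counts and inertia\<close>

lemma order_linear_factors:
  fixes a :: complex
  shows "Polynomial.order a (\<Prod>e\<leftarrow>es. [:- e, 1:]) = count_list es a"
proof (induction es)
  case Nil
  show ?case by (simp add: order_0I)
next
  case (Cons e es)
  have nz: "(\<Prod>e\<leftarrow>es. [:- e, 1:]) \<noteq> (0 :: complex poly)"
    by (auto simp: prod_list_zero_iff)
  have "Polynomial.order a [:- e, 1:] = (if e = a then 1 else 0)"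
  proof (cases "e = a")
    case True
    then show ?thesis using order_power_n_n[of a 1] by simp
  next
    case False
    then show ?thesis by (simp add: order_0I)
  qed
  moreover have "Polynomial.order a ([:- e, 1:] * (\<Prod>e\<leftarrow>es. [:- e, 1:]))
      = Polynomial.order a [:- e, 1:] + Polynomial.order a (\<Prod>e\<leftarrow>es. [:- e, 1:])"
    by (intro order_mult no_zero_divisors[OF _ nz]) simp
  ultimately show ?case using Cons by simp
qed

lemma sum_count_list_filter:
  assumes "finite S"
  shows "(\<Sum>a\<in>S. count_list es a) = length (filter (\<lambda>e. e \<in> S) es)"
proof (induction es)
  case (Cons e es)
  have "(\<Sum>a\<in>S. count_list (e # es) a) = (\<Sum>a\<in>S. count_list es a) + (\<Sum>a\<in>S. if e = a then 1 else 0)"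
    unfolding sum.distrib[symmetric] by (intro sum.cong) auto
  then show ?case using Cons assms by simp
qed simp

text \<open>Turns a sum of algebraic multiplicities into a count in the list of all roots, the shape
  in which the Schur decomposition presents eigenvalues.\<close>

lemma sum_order_roots:
  assumes p: "p = (\<Prod>e\<leftarrow>es. [:- e, 1:])"
  shows "(\<Sum>a\<in>{a. poly p a = 0 \<and> Q a}. Polynomial.order a p) = length (filter Q (es :: complex list))"
proof -
  have roots: "poly p a = 0 \<longleftrightarrow> a \<in> set es" for a
    unfolding p by (induction es) auto
  have fin: "finite {a. poly p a = 0 \<and> Q a}" unfolding roots by simp
  have "(\<Sum>a\<in>{a. poly p a = 0 \<and> Q a}. Polynomial.order a p)
      = length (filter (\<lambda>e. e \<in> {a. poly p a = 0 \<and> Q a}) es)"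
    using sum_count_list_filter[OF fin] unfolding p order_linear_factors by simp
  also have "filter (\<lambda>e. e \<in> {a. poly p a = 0 \<and> Q a}) es = filter Q es"
    unfolding roots by (intro filter_cong) auto
  finally show ?thesis .
qed

text \<open>A vector \<open>q\<close> of \<open>V\<close> orthogonal to \<open>U\<close> is an
  eigenvector for \<open>l\<close>, so \<open>V\<close> is the sum of \<open>U\<close> and the line
  of \<open>q\<close>, orthogonal for the inner product and for \<open>qf H\<close>. The sign of
  \<open>l\<close> decides which index grows; for \<open>l = 0\<close> it is the radical.\<close>

lemma posi_qf_flag_step:
  assumes H: "H \<in> carrier_mat n n" and adj: "mat_adjoint H = H"
    and U: "fs.fsub U" "fs.fsub V" "U \<subseteq> V" "V \<subseteq> csp n" "fs.dim V = Suc (fs.dim U)"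
    and inv: "\<And>u. u \<in> U \<Longrightarrow> mv H u \<in> U" "\<And>v. v \<in> V \<Longrightarrow> mv H v - fscale l v \<in> U"
  shows "l \<in> \<real>"
    and "fs.posi (qf H) V = fs.posi (qf H) U + (if 0 < Re l then 1 else 0)"
    and "fs.negi (qf H) V = fs.negi (qf H) U + (if Re l < 0 then 1 else 0)"
proof -
  let ?h = "qf H"
  have h: "fs.herm ?h" by (rule herm_qf[OF H adj])
  have hi: "?h x y = ip n (mv H x) y" for x y unfolding qf_def using H by simp
  let ?Q = "fs.perp (ip n) U V"
  have fQ: "fs.fsub ?Q" by (rule fs.fsub_perp[OF herm_ip U(2)])
  have "fs.dim V \<le> fs.dim ?Q + fs.dim U" by (rule fs.dim_perp_ge[OF herm_ip U(2,1)])
  then have "fs.dim ?Q \<noteq> 0" using U(5) by simp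
  then have "?Q \<noteq> {0}" using fs.dim_zero_subspace by metis
  then obtain q where q: "q \<in> ?Q" "q \<noteq> 0" using fs.subspace_0[OF fs.fsub_subspace[OF fQ]] by blast
  have qV: "q \<in> V" "q \<in> csp n" "\<And>u. u \<in> U \<Longrightarrow> ip n q u = 0"
    using q(1) U(4) unfolding fs.perp_def by blast+
  have qq: "0 < Re (ip n q q)" using pos_on_ip[of n] qV(2) q(2) unfolding fs.pos_on_def by blast
  have qU: "q \<notin> U"
  proof
    assume "q \<in> U"
    then have "ip n q q = 0" by (rule qV(3))
    then show False using qq by simp
  qed
  define d where "d = mv H q - fscale l q"
  have dU: "d \<in> U" unfolding d_def by (rule inv(2)[OF qV(1)])
  \<comment> \<open>\<open>d\<close> lies in \<open>U\<close>, which \<open>H\<close> maps into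
    itself, and \<open>q\<close> is orthogonal to \<open>U\<close>; moving \<open>H\<close> across
    the inner product shows that \<open>d\<close> is orthogonal to itself.\<close>
  have "ip n d d = 0"
  proof -
    have "ip n (mv H q) d = ip n q (mv H d)" using ip_adjoint[OF H, of q d] adj by simp
    then have "ip n (mv H q) d = 0" using qV(3)[OF inv(1)[OF dU]] by simp
    moreover have "ip n (fscale l q) d = 0"
      using qV(3)[OF dU] by (simp add: ip_simps)
    moreover have "ip n d d = ip n (mv H q) d - ip n (fscale l q) d"
      using fs.herm_diff_left[OF herm_ip, of n "mv H q" "fscale l q" d] unfolding d_def .
    ultimately show ?thesis by simp
  qed
  then have "d = 0" using dU U(3,4) by (intro ip_self_0[of _ n]) auto
  then have eig: "mv H q = fscale l q" unfolding d_def by simp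
  have hq: "?h q x = l * ip n q x" for x unfolding hi eig by (simp add: ip_simps)
  have r: "ip n q q = of_real (Re (ip n q q))" by (rule fs.herm_self[OF herm_ip])
  have "l * ip n q q = of_real (Re (?h q q))" using fs.herm_self[OF h, of q] hq by simp
  then have "Im (l * ip n q q) = 0" by simp
  then have "Im l * Re (ip n q q) = 0" by (subst (asm) r) simp
  then have Im: "Im l = 0" using qq by simp
  then show "l \<in> \<real>" by (simp add: complex_is_Real_iff)
  have Re_hq: "Re (?h q q) = Re l * Re (ip n q q)"
    unfolding hq by (subst r) simp
  have VU: "V = fs.span (insert q U)"
  proof -
    have sub: "fs.span (insert q U) \<subseteq> V"
      using qV(1) U(3) by (intro fs.span_minimal fs.fsub_subspace[OF U(2)]) auto
    have "fs.dim (fs.span (insert q U)) = Suc (fs.dim U)"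
      by (rule fs.dim_span_insert[OF fs.fsub_subspace[OF U(1)] fs.fsub_fin_dim[OF U(1)] qU])
    then show ?thesis using fs.fsub_eq_of_dim[OF U(2) fs.subspace_span sub] U(5) by simp
  qed
  have qu: "?h q u = 0" "?h u q = 0" if "u \<in> U" for u
    using hq[of u] qV(3)[OF that] fs.herm_zero_sym[OF h, of q u] by simp_all
  have "fs.posi ?h V = fs.posi ?h U + (if 0 < Re l then 1 else 0)
    \<and> fs.negi ?h V = fs.negi ?h U + (if Re l < 0 then 1 else 0)"
  proof (cases "l = 0")
    case False
    then have "Re l \<noteq> 0" using Im by (simp add: complex_eq_iff)
    then have nz: "?h q q \<noteq> 0" using Re_hq qq by auto
    have "fs.perp ?h {q} V = U"
    proof -
      have f: "fs.fsub (fs.perp ?h {q} V)" by (rule fs.fsub_perp[OF h U(2)])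
      have sub: "U \<subseteq> fs.perp ?h {q} V" using U(3) qu unfolding fs.perp_def by blast
      have "q \<notin> fs.perp ?h {q} V" using nz unfolding fs.perp_def by blast
      then have "fs.dim (fs.perp ?h {q} V) \<noteq> fs.dim V"
        using fs.fsub_eq_of_dim[OF U(2) fs.fsub_subspace[OF f] fs.perp_subset] qV(1) by auto
      then have "fs.dim (fs.perp ?h {q} V) \<le> fs.dim U"
        using fs.fsub_dim_mono[OF U(2) fs.perp_subset, of ?h "{q}"] U(5) by simp
      then show ?thesis using fs.fsub_eq_of_dim[OF f fs.fsub_subspace[OF U(1)] sub] by simp
    qed
    moreover have "0 < Re (?h q q) \<longleftrightarrow> 0 < Re l" "Re (?h q q) < 0 \<longleftrightarrow> Re l < 0"
      unfolding Re_hq using qq by (simp_all add: zero_less_mult_iff mult_less_0_iff)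
    ultimately show ?thesis using fs.inertia_split_vector[OF h U(2) qV(1) nz] by simp
  next
    case True
    let ?R = "fs.radical ?h U"
    have fR: "fs.fsub ?R" "fs.fsub (fs.radical ?h V)" using fs.fsub_perp[OF h] U(1,2) by blast+
    have q0: "?h q x = 0" for x unfolding hq True by simp
    have "r \<in> fs.radical ?h V" if r: "r \<in> ?R" for r
    proof -
      have "?h r x = 0" if "x \<in> V" for x
      proof -
        have "x \<in> fs.span (insert q U)" using that VU by simp
        then obtain u c where uc: "x = u + fscale c q" "u \<in> U"
          by (rule fs.span_insert_cases[OF _ fs.fsub_subspace[OF U(1)]])
        have "?h r u = 0" "?h r q = 0" using r uc(2) qu unfolding fs.perp_def by blast+
        then show ?thesis by (simp add: uc(1) fs.herm_simps[OF h])
      qed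
      then show ?thesis using r U(3) unfolding fs.perp_def by blast
    qed
    moreover have "q \<in> fs.radical ?h V" using q0 qV(1) unfolding fs.perp_def by blast
    ultimately have "fs.span (insert q ?R) \<subseteq> fs.radical ?h V"
      by (intro fs.span_minimal fs.fsub_subspace[OF fR(2)]) auto
    then have "fs.dim (fs.span (insert q ?R)) \<le> fs.dim (fs.radical ?h V)"
      by (rule fs.fsub_dim_mono[OF fR(2)])
    moreover have "q \<notin> ?R" using qU unfolding fs.perp_def by blast
    then have "fs.dim (fs.span (insert q ?R)) = Suc (fs.dim ?R)"
      by (rule fs.dim_span_insert[OF fs.fsub_subspace[OF fR(1)] fs.fsub_fin_dim[OF fR(1)]])
    moreover have "fs.posi ?h U \<le> fs.posi ?h V" "fs.negi ?h U \<le> fs.negi ?h V"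
      unfolding fs.negi_def using fs.posi_mono[OF U(2,1,3)] by blast+
    ultimately show ?thesis
      using fs.inertia_sum[OF h U(1)] fs.inertia_sum[OF h U(2)] U(5) True by simp
  qed
  then show "fs.posi ?h V = fs.posi ?h U + (if 0 < Re l then 1 else 0)"
    and "fs.negi ?h V = fs.negi ?h U + (if Re l < 0 then 1 else 0)" by blast+
qed

text \<open>Triangularizing \<open>H\<close> yields a flag of invariant subspaces
  \<open>U k\<close>, the spans of the first \<open>k\<close> columns of \<open>P\<close>, and the
  diagonal lists the eigenvalues with multiplicity. Along the flag \<open>posi_qf_flag_step\<close>
  counts their signs one at a time.\<close>

lemma inertia_eq_eigenvalue_count:
  assumes H: "H \<in> carrier_mat n n" and adj: "mat_adjoint H = H"
  shows "ipos H = fs.posi (qf H) (csp n)" "ineg H = fs.negi (qf H) (csp n)"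
proof -
  obtain es where es: "char_poly H = (\<Prod>e\<leftarrow>es. [:- e, 1:])" "length es = n"
    using char_poly_factorized[OF H] by blast
  obtain B P Q where sd: "schur_decomposition H es = (B, P, Q)" by (rule prod_cases3)
  from schur_decomposition[OF H es(1) sd]
  have sim: "similar_mat_wit H B P Q" and ut: "upper_triangular B" and dg: "diag_mat B = es" by blast+
  note simD = similar_mat_witD2[OF H sim]
  have B: "B \<in> carrier_mat n n" and P: "P \<in> carrier_mat n n" and Q: "Q \<in> carrier_mat n n"
    using simD by blast+
  have QP: "mv Q (mv P x) = x" if "x \<in> csp n" for x
    using mv_mult[OF Q P, of x] simD(2) mv_one_mat_csp[OF that] by simp
  have HP: "mv H (mv P x) = mv P (mv B x)" if "x \<in> csp n" for x
  proof -
    have "mv H (mv P x) = mv (P * B) (mv Q (mv P x))"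
      using simD(3) mv_mult[OF mult_carrier_mat[OF P B] Q] by simp
    then show ?thesis using QP[OF that] mv_mult[OF P B] by simp
  qed
  have Bes: "B $$ (k,k) = es ! k" if "k < n" for k
    using that B dg[symmetric] by (simp add: diag_mat_def)
  \<comment> \<open>An upper triangular matrix preserves the space of the first \<open>k + 1\<close>
    coordinates, and subtracting the diagonal entry kills the last of them.\<close>
  have Bx: "mv B x - fscale (es ! k) x \<in> csp k" if x: "x \<in> csp (Suc k)" and k: "k < n" for x k
  proof -
    have "mv B x i = es ! k * x i" if i: "k \<le> i" for i
    proof (cases "i < n")
      case True
      have "B $$ (i,j) * x j = (if j = i then es ! k * x i else 0)" if "j < n" for j
      proof -
        have "B $$ (i,j) = 0" if "j < i" using ut True B that unfolding upper_triangular_def by auto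
        moreover have "x j = 0" if "j > k" using x that unfolding csp_def by auto
        moreover have "x i = 0" if "i \<noteq> k" using x that i unfolding csp_def by auto
        ultimately show ?thesis using i Bes[OF k] by (cases j i rule: linorder_cases) auto
      qed
      then have "mv B x i = (\<Sum>j<n. if j = i then es ! k * x i else 0)"
        using True B by (simp add: mv_def)
      then show ?thesis using True by simp
    next
      case False
      then have "x i = 0" using x k unfolding csp_def by auto
      then show ?thesis using False B by (simp add: mv_def)
    qed
    then show ?thesis unfolding csp_def by (simp add: fscale_apply)
  qed
  define U where "U k = mv P ` csp k" for k
  interpret l: Vector_Spaces.linear fscale fscale "mv P" by (rule linear_mv)
  have fU: "fs.fsub (U k)" for k
    unfolding U_def fs.fsub_def
    using l.subspace_image[OF subspace_csp] fs.fin_dim_image[OF linear_mv fs.fsub_fin_dim[OF fsub_csp]] by blast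
  have Usub: "U k \<subseteq> csp n" for k unfolding U_def using mv_csp'[OF P] by blast
  have dU: "fs.dim (U k) = k" if "k \<le> n" for k
  proof -
    obtain C where C: "fs.dim C = fs.dim (mv P ` csp k)"
      "fs.dim (csp k) = fs.dim C + fs.dim {x \<in> csp k. mv P x = 0}"
      by (rule fs.linear_section[OF linear_mv[of P] subspace_csp[of k] fs.fsub_fin_dim[OF fsub_csp[of k]]])
    have "x = 0" if "x \<in> csp k" "mv P x = 0" for x
      using QP[of x] that csp_mono[OF \<open>k \<le> n\<close>] mv_zero by auto
    then have "{x \<in> csp k. mv P x = 0} \<subseteq> {0}" by blast
    then have "fs.dim {x \<in> csp k. mv P x = 0} \<le> fs.dim {0}" by (rule fs.fsub_dim_mono[OF fs.fsub_zero])
    then show ?thesis using C unfolding U_def by simp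
  qed
  have step: "mv H v - fscale (es ! k) v \<in> U k" if k: "k < n" and v: "v \<in> U (Suc k)" for k v
  proof -
    obtain x where x: "x \<in> csp (Suc k)" "v = mv P x" using v unfolding U_def by blast
    have "mv H v = mv P (mv B x)" using HP x csp_mono[of "Suc k" n] k by auto
    then have "mv H v - fscale (es ! k) v = mv P (mv B x - fscale (es ! k) x)"
      by (simp add: x(2) mv_diff mv_scale)
    then show ?thesis using Bx[OF x(1) k] unfolding U_def by blast
  qed
  have inv: "mv H u \<in> U k" if "k \<le> n" "u \<in> U k" for k u
  proof (cases k)
    case 0
    then have "u = 0" using that(2) by (simp add: U_def csp_0 mv_zero)
    then show ?thesis using fs.subspace_0[OF fs.fsub_subspace[OF fU]] by (simp add: mv_zero)
  next
    case (Suc j)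
    have "U j \<subseteq> U k" unfolding U_def Suc using csp_mono[of j "Suc j"] by auto
    then have "mv H u - fscale (es ! j) u \<in> U k" using step[of j u] that Suc by auto
    then have "(mv H u - fscale (es ! j) u) + fscale (es ! j) u \<in> U k"
      using fs.fsub_subspace[OF fU] that(2) by (intro fs.subspace_add fs.subspace_scale)
    then show ?thesis by simp
  qed
  have main: "(\<forall>i<k. es ! i \<in> \<real>)
      \<and> fs.posi (qf H) (U k) = card {i. i < k \<and> 0 < Re (es ! i)}
      \<and> fs.negi (qf H) (U k) = card {i. i < k \<and> Re (es ! i) < 0}" if "k \<le> n" for k
    using that
  proof (induction k)
    case 0
    have "fs.posi h (U 0) = 0" for h
      using fs.posi_le_dim[OF fU[of 0], of h] dU[of 0] by simp
    then show ?case by (simp add: fs.negi_def)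
  next
    case (Suc k)
    have sub: "U k \<subseteq> U (Suc k)" unfolding U_def using csp_mono[of k "Suc k"] by auto
    have d: "fs.dim (U (Suc k)) = Suc (fs.dim (U k))" using dU Suc.prems by simp
    have kn: "k \<le> n" "k < n" using Suc.prems by auto
    note st = posi_qf_flag_step[OF H adj fU fU sub Usub d inv[OF kn(1)] step[OF kn(2)]]
    have card_step: "card {i. i < Suc k \<and> Z (es ! i)} = card {i. i < k \<and> Z (es ! i)} + (if Z (es ! k) then 1 else 0)" for Z
    proof -
      have "{i. i < Suc k \<and> Z (es ! i)} = {i. i < k \<and> Z (es ! i)} \<union> (if Z (es ! k) then {k} else {})"
        by (auto simp: less_Suc_eq)
      then show ?thesis by simp
    qed
    show ?case
      using Suc.IH[OF kn(1)] st card_step[of "\<lambda>z. 0 < Re z"] card_step[of "\<lambda>z. Re z < 0"]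
      by (auto simp: less_Suc_eq)
  qed
  have "U n = csp n" using fs.fsub_eq_of_dim[OF fsub_csp fs.fsub_subspace[OF fU] Usub] dU[of n] by simp
  then have m: "\<And>i. i < n \<Longrightarrow> es ! i \<in> \<real>"
      "fs.posi (qf H) (csp n) = card {i. i < n \<and> 0 < Re (es ! i)}"
      "fs.negi (qf H) (csp n) = card {i. i < n \<and> Re (es ! i) < 0}" using main[of n] by auto
  have len: "length (filter (\<lambda>a. a \<in> \<real> \<and> Z a) es) = card {i. i < n \<and> Z (es ! i)}" for Z
    unfolding length_filter_conv_card es(2) using m(1) by (intro arg_cong[of _ _ card]) auto
  show "ipos H = fs.posi (qf H) (csp n)"
    unfolding ipos_def m(2) len[of "\<lambda>z. 0 < Re z", symmetric] by (rule sum_order_roots[OF es(1)])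
  show "ineg H = fs.negi (qf H) (csp n)"
    unfolding ineg_def m(3) len[of "\<lambda>z. Re z < 0", symmetric] by (rule sum_order_roots[OF es(1)])
qed

section \<open>Block matrices and the linearized form\<close>

context complex_vector_space
begin

lemma dim_via_map:
  assumes "Vector_Spaces.linear scale scale f" "fsub S" "f ` S = T"
  shows "dim S = dim T + dim {x \<in> S. f x = 0}"
proof -
  obtain C where "dim C = dim (f ` S)" "dim S = dim C + dim {x \<in> S. f x = 0}"
    by (rule linear_section[OF assms(1) fsub_subspace[OF assms(2)] fsub_fin_dim[OF assms(2)]])
  then show ?thesis using assms(3) by simp
qed

lemma dim_via_bijection:
  assumes "Vector_Spaces.linear scale scale f" "fsub S" "f ` S = T" "\<And>x. x \<in> S \<Longrightarrow> f x = 0 \<Longrightarrow> x = 0"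
  shows "dim S = dim T"
proof -
  have "{x \<in> S. f x = 0} \<subseteq> {0}" using assms(4) by blast
  then have "dim {x \<in> S. f x = 0} \<le> dim {0}" by (rule fsub_dim_mono[OF fsub_zero])
  then show ?thesis using dim_via_map[OF assms(1-3)] by simp
qed

text \<open>\<open>N1\<close> and \<open>N3\<close> have a nonnegative lower right block and will be
  split along their last coordinates. On such a space the negative index is 0, so its radical
  determines the positive one.\<close>

lemma split_nonneg:
  assumes h: "herm h" and V: "fsub V" and S: "subspace S" "S \<subseteq> V"
    and nn: "nonpos_on (\<lambda>x y. - h x y) S"
  shows "posi h V + dim (S \<inter> radical h V) = dim S + posi h (perp h S V)"
    and "negi h V + dim (S \<inter> radical h V) = dim (radical h S) + negi h (perp h S V)"
proof -
  have fS: "fsub S" by (rule fsub_subset[OF V S])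
  have "negi h S = 0" unfolding negi_def by (rule posi_nonpos_on[OF fS nn])
  then show "posi h V + dim (S \<inter> radical h V) = dim S + posi h (perp h S V)"
    and "negi h V + dim (S \<inter> radical h V) = dim (radical h S) + negi h (perp h S V)"
    using posi_split[OF h V S] negi_split[OF h V S] inertia_sum[OF h fS] by simp_all
qed

lemma split_negative:
  assumes h: "herm h" and V: "fsub V" and S: "subspace S" "S \<subseteq> V"
    and neg: "pos_on (\<lambda>x y. - h x y) S"
  shows "posi h V = posi h (perp h S V)" and "negi h V = dim S + negi h (perp h S V)"
proof -
  have h': "herm (\<lambda>x y. - h x y)" by (rule herm_uminus[OF h])
  have z: "x = 0" if "x \<in> S" "h x x = 0" for x using that neg unfolding pos_on_def by force
  have fS: "fsub S" by (rule fsub_subset[OF V S])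
  have "S \<inter> radical h V \<subseteq> {0}" using z S(2) unfolding perp_def by blast
  then have 1: "dim (S \<inter> radical h V) = 0" using fsub_dim_mono[OF fsub_zero] by fastforce
  have "radical h S \<subseteq> {0}" using z unfolding perp_def by blast
  then have 2: "dim (radical h S) = 0" using fsub_dim_mono[OF fsub_zero] by fastforce
  have "nonpos_on h S"
    using pos_on_nonneg[OF h' neg] unfolding nonpos_on_def by force
  then have "nonpos_on (\<lambda>x y. - (- h x y)) S" by simp
  from split_nonneg[OF h' V S this]
  show "posi h V = posi h (perp h S V)" and "negi h V = dim S + negi h (perp h S V)"
    using 1 2 by (simp_all add: negi_def)
qed

end

section \<open>Block vectors and block matrices\<close>

definition head_part :: "nat \<Rightarrow> (nat \<Rightarrow> complex) \<Rightarrow> nat \<Rightarrow> complex" where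
  "head_part n x = (\<lambda>i. if i < n then x i else 0)"

definition tail_part :: "nat \<Rightarrow> (nat \<Rightarrow> complex) \<Rightarrow> nat \<Rightarrow> complex" where
  "tail_part n x = (\<lambda>i. x (n + i))"

definition join_parts :: "nat \<Rightarrow> (nat \<Rightarrow> complex) \<Rightarrow> (nat \<Rightarrow> complex) \<Rightarrow> nat \<Rightarrow> complex" where
  "join_parts n u v = (\<lambda>i. if i < n then u i else v (i - n))"

lemma head_part_csp: "head_part n x \<in> csp n"
  unfolding head_part_def csp_def by simp

lemma head_part_id: "x \<in> csp n \<Longrightarrow> head_part n x = x"
  unfolding head_part_def csp_def by (auto simp: fun_eq_iff)

lemma tail_part_csp: "x \<in> csp (n + k) \<Longrightarrow> tail_part n x \<in> csp k"
  unfolding tail_part_def csp_def by simp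

lemma join_parts_csp: "v \<in> csp k \<Longrightarrow> join_parts n u v \<in> csp (n + k)"
  unfolding join_parts_def csp_def by simp

lemma tail_part_join_parts [simp]: "tail_part n (join_parts n u v) = v"
  unfolding tail_part_def join_parts_def by simp

lemma head_part_join_parts: "head_part n (join_parts n u v) = head_part n u"
  unfolding head_part_def join_parts_def by auto

lemma join_parts_tail_part: "join_parts n x (tail_part n x) = x"
  unfolding join_parts_def tail_part_def by auto

lemma join_parts_head_part [simp]: "join_parts n (head_part n x) v = join_parts n x v"
  unfolding join_parts_def head_part_def by auto

lemma join_parts_join_parts [simp]: "join_parts n (join_parts n u w) v = join_parts n u v"
  unfolding join_parts_def by auto

lemma join_parts_add: "join_parts n u v + join_parts n u' v' = join_parts n (u + u') (v + v')"
  unfolding join_parts_def by (auto simp: fun_eq_iff)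

lemma join_parts_scale: "fscale c (join_parts n u v) = join_parts n (fscale c u) (fscale c v)"
  unfolding join_parts_def by (auto simp: fun_eq_iff fscale_apply)

lemma join_parts_eq_0: "join_parts n u v = 0 \<longleftrightarrow> head_part n u = 0 \<and> v = 0"
proof
  assume a: "join_parts n u v = 0"
  have "u i = 0" if "i < n" for i using fun_cong[OF a, of i] that by (simp add: join_parts_def)
  moreover have "v i = 0" for i using fun_cong[OF a, of "n + i"] by (simp add: join_parts_def)
  ultimately show "head_part n u = 0 \<and> v = 0" by (auto simp: head_part_def fun_eq_iff)
next
  assume a: "head_part n u = 0 \<and> v = 0"
  have "u i = 0" if "i < n" for i
  proof -
    have "u i = head_part n u i" using that by (simp add: head_part_def)
    then show ?thesis using a by simp
  qed
  then show "join_parts n u v = 0" using a by (auto simp: join_parts_def fun_eq_iff)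
qed

lemma head_part_tail_part_eq_0:
  assumes "head_part n x = 0" "tail_part n x = 0" shows "x = 0"
proof -
  have "join_parts n x (tail_part n x) = 0" using assms by (simp add: join_parts_eq_0)
  then show ?thesis unfolding join_parts_tail_part .
qed

lemma head_part_add: "head_part n (x + y) = head_part n x + head_part n y"
  and tail_part_add: "tail_part n (x + y) = tail_part n x + tail_part n y"
  and head_part_scale: "head_part n (fscale c x) = fscale c (head_part n x)"
  and tail_part_scale: "tail_part n (fscale c x) = fscale c (tail_part n x)"
  and head_part_zero [simp]: "head_part n 0 = 0" and tail_part_zero [simp]: "tail_part n 0 = 0"
  by (auto simp: head_part_def tail_part_def fun_eq_iff fscale_apply)

lemma linear_head_part: "Vector_Spaces.linear fscale fscale (head_part n)"
  by (rule fs.endo_linearI) (simp_all add: head_part_add head_part_scale)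

lemma linear_tail_part: "Vector_Spaces.linear fscale fscale (tail_part n)"
  by (rule fs.endo_linearI) (simp_all add: tail_part_add tail_part_scale)

lemma ip_head_part [simp]: "ip n (head_part n x) y = ip n x y" "ip n x (head_part n y) = ip n x y"
  unfolding ip_def head_part_def by simp_all

lemma ip_join_parts [simp]: "ip n (join_parts n u v) y = ip n u y" "ip n y (join_parts n u v) = ip n y u"
  unfolding ip_def join_parts_def by simp_all

lemma ip_append: "ip (n + k) x y = ip n x y + ip k (tail_part n x) (tail_part n y)"
  by (induction k) (simp_all add: ip_def tail_part_def)

lemma mv_head_part: "dim_col M = n \<Longrightarrow> mv M (head_part n x) = mv M x"
  by (rule mv_cong) (simp add: head_part_def)

lemma mv_join_parts: "dim_col M = n \<Longrightarrow> mv M (join_parts n u v) = mv M u"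
  by (rule mv_cong) (simp add: join_parts_def)

lemma hcat_carrier: "P \<in> carrier_mat r c \<Longrightarrow> Q \<in> carrier_mat r d \<Longrightarrow> hcat P Q \<in> carrier_mat r (c + d)"
  unfolding hcat_def by auto

lemma hcat_dim [simp]: "dim_row (hcat P Q) = dim_row P" "dim_col (hcat P Q) = dim_col P + dim_col Q"
  unfolding hcat_def by simp_all

lemma hcat_index:
  "i < dim_row P \<Longrightarrow> j < dim_col P + dim_col Q \<Longrightarrow>
    hcat P Q $$ (i,j) = (if j < dim_col P then P $$ (i,j) else Q $$ (i, j - dim_col P))"
  unfolding hcat_def by simp

lemma append_rows_dim [simp]: "dim_row (P @\<^sub>r Q) = dim_row P + dim_row Q" "dim_col (P @\<^sub>r Q) = dim_col P"
  unfolding append_rows_def by simp_all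

lemma append_rows_index:
  "i < dim_row P + dim_row Q \<Longrightarrow> j < dim_col P \<Longrightarrow> dim_col Q = dim_col P \<Longrightarrow>
    (P @\<^sub>r Q) $$ (i,j) = (if i < dim_row P then P $$ (i,j) else Q $$ (i - dim_row P, j))"
  unfolding append_rows_def by (simp add: index_mat_four_block)

lemma adjoint_hcat:
  fixes P Q :: "complex mat"
  assumes "dim_row P = dim_row Q"
  shows "mat_adjoint (hcat P Q) = mat_adjoint P @\<^sub>r mat_adjoint Q"
  using assms by (intro eq_matI) (auto simp: append_rows_index hcat_index)

lemma adjoint_append_rows:
  fixes P Q :: "complex mat"
  assumes "dim_col P = dim_col Q"
  shows "mat_adjoint (P @\<^sub>r Q) = hcat (mat_adjoint P) (mat_adjoint Q)"
  using assms by (intro eq_matI) (auto simp: append_rows_index hcat_index)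

lemma hcat_append_rows:
  assumes "dim_row P = dim_row Q" "dim_row P' = dim_row Q'" "dim_col P = dim_col P'" "dim_col Q = dim_col Q'"
  shows "hcat (P @\<^sub>r P') (Q @\<^sub>r Q') = hcat P Q @\<^sub>r hcat P' Q'"
  using assms by (intro eq_matI) (auto simp: append_rows_index hcat_index)

lemma mv_hcat:
  assumes "P \<in> carrier_mat r c" "Q \<in> carrier_mat r d"
  shows "mv (hcat P Q) x = mv P x + mv Q (tail_part c x)"
proof
  fix i
  have s: "(\<Sum>j<c + d. f j) = (\<Sum>j<c. f j) + (\<Sum>j<d. f (c + j))" for f :: "nat \<Rightarrow> complex"
    by (induction d) (simp_all add: add.assoc)
  show "mv (hcat P Q) x i = (mv P x + mv Q (tail_part c x)) i"
    using assms by (simp add: mv_def s hcat_index tail_part_def)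
qed

lemma mv_append_rows:
  assumes "P \<in> carrier_mat r c" "Q \<in> carrier_mat s c"
  shows "mv (P @\<^sub>r Q) x = join_parts r (mv P x) (mv Q x)"
proof
  fix i
  show "mv (P @\<^sub>r Q) x i = join_parts r (mv P x) (mv Q x) i"
    using assms by (auto simp: mv_def join_parts_def append_rows_index)
qed

lemma csp_orthogonal: "d \<in> csp n \<Longrightarrow> (\<And>u. u \<in> csp n \<Longrightarrow> ip n d u = 0) \<Longrightarrow> d = 0"
  using ip_self_0 by blast

text \<open>The Fredholm alternative: the double orthogonal complement of the range is the range, as
  the inner product has trivial radical.\<close>

lemma range_of_orthogonal_kernel:
  assumes M: "M \<in> carrier_mat n p" and d: "d \<in> csp n" "\<And>u. u \<in> ker n (mat_adjoint M) \<Longrightarrow> ip n d u = 0"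
  obtains \<eta> where "\<eta> \<in> csp p" "d = mv M \<eta>"
proof -
  interpret l: Vector_Spaces.linear fscale fscale "mv M" by (rule linear_mv)
  let ?I = "mv M ` csp p"
  have s: "fs.subspace ?I" by (rule l.subspace_image[OF subspace_csp])
  have sub: "?I \<subseteq> csp n" using mv_csp'[OF M] by blast
  have "d \<in> fs.perp (ip n) (fs.perp (ip n) ?I (csp n)) (csp n)"
    unfolding perp_image[OF M] using d unfolding fs.perp_def by blast
  then have "d \<in> fs.span (?I \<union> {0})"
    unfolding fs.perp_perp[OF herm_ip fsub_csp s sub] radical_ip .
  moreover have "?I \<union> {0} = ?I" using fs.subspace_0[OF s] by blast
  moreover have "fs.span ?I = ?I" using s by (simp only: fs.span_eq_iff)
  ultimately show ?thesis using that by auto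
qed

text \<open>\<open>f\<close> factors through \<open>T\<close>, and on the image of \<open>S\<close>
  it is represented, as in the Riesz theorem, by a vector orthogonal to the image of the kernel of
  \<open>f\<close>. Functionals that vanish on \<open>K\<close> or \<open>L\<close> thus become
  vectors from which a matrix can be built.\<close>

lemma functional_factor:
  assumes T: "Vector_Spaces.linear fscale fscale T" and S: "fs.fsub S" and TS: "\<And>x. x \<in> S \<Longrightarrow> T x \<in> csp p"
    and f: "fs.functional f" and ker: "\<And>x. x \<in> S \<Longrightarrow> T x = 0 \<Longrightarrow> f x = 0"
  obtains \<xi> where "\<xi> \<in> csp p" "\<And>x. x \<in> S \<Longrightarrow> f x = ip p (T x) \<xi>"
proof (cases "\<exists>x\<in>S. f x \<noteq> 0")
  case False
  then show ?thesis
    using that[of 0] fs.subspace_0[OF subspace_csp] ip_zero by auto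
next
  case True
  interpret T: Vector_Spaces.linear fscale fscale T by fact
  obtain x1 where x1: "x1 \<in> S" "f x1 \<noteq> 0" using True by blast
  let ?S0 = "{x \<in> S. f x = 0}"
  have sS: "fs.subspace S" by (rule fs.fsub_subspace[OF S])
  have s0: "fs.subspace ?S0" by (rule fs.subspace_kernel[OF f sS])
  have sT: "fs.subspace (T ` S)" "fs.subspace (T ` ?S0)"
    using T.subspace_image[OF sS] T.subspace_image[OF s0] .
  have fT: "fs.fsub (T ` S)" using TS by (intro fs.fsub_subset[OF fsub_csp sT(1)]) blast
  have fT0: "fs.fsub (T ` ?S0)" by (rule fs.fsub_subset[OF fT sT(2)]) blast
  have "T x1 \<notin> T ` ?S0"
  proof
    assume "T x1 \<in> T ` ?S0"
    then obtain s where s: "s \<in> S" "f s = 0" "T x1 = T s" by blast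
    have "f (x1 - s) = 0"
      using s x1(1) fs.subspace_diff[OF sS] by (intro ker) (auto simp: T.diff)
    then show False using x1(2) s(2) by (simp add: fs.functional_diff[OF f])
  qed
  then have "T ` ?S0 \<noteq> T ` S" using x1(1) by blast
  moreover have "T ` ?S0 \<subseteq> T ` S" by blast
  ultimately have "fs.dim (T ` ?S0) < fs.dim (T ` S)"
    using fs.fsub_eq_of_dim[OF fT sT(2)] by (meson linorder_not_le)
  moreover have fP: "fs.fsub (fs.perp (ip p) (T ` ?S0) (T ` S))" by (rule fs.fsub_perp[OF herm_ip fT])
  moreover have "fs.dim (T ` S) \<le> fs.dim (fs.perp (ip p) (T ` ?S0) (T ` S)) + fs.dim (T ` ?S0)"
    by (rule fs.dim_perp_ge[OF herm_ip fT fT0])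
  ultimately have "fs.dim (fs.perp (ip p) (T ` ?S0) (T ` S)) \<noteq> 0" by simp
  then have "fs.perp (ip p) (T ` ?S0) (T ` S) \<noteq> {0}" using fs.dim_zero_subspace by metis
  then obtain u where "u \<in> fs.perp (ip p) (T ` ?S0) (T ` S)" and u0: "u \<noteq> 0"
    using fs.subspace_0[OF fs.fsub_subspace[OF fP]] by blast
  then obtain x0 where x0: "x0 \<in> S" "u = T x0" and u: "\<And>s. s \<in> ?S0 \<Longrightarrow> ip p u (T s) = 0"
    unfolding fs.perp_def by blast
  have uc: "u \<in> csp p" using TS x0 by blast
  have uu: "ip p u u \<noteq> 0" using ip_self_0[OF uc] u0 by blast
  have fx0: "f x0 \<noteq> 0" using u[of x0] x0 uu by blast
  \<comment> \<open>Scaled so that the representation is right at \<open>x0\<close>; any other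
    \<open>x\<close> differs from a multiple of \<open>x0\<close> by a vector in the kernel of
    \<open>f\<close>.\<close>
  define \<xi> where "\<xi> = fscale (cnj (f x0 / ip p u u)) u"
  have "\<xi> \<in> csp p" unfolding \<xi>_def by (rule fs.subspace_scale[OF subspace_csp uc])
  moreover have "f x = ip p (T x) \<xi>" if x: "x \<in> S" for x
  proof -
    define c where "c = f x / f x0"
    define s where "s = x - fscale c x0"
    have "s \<in> ?S0" unfolding s_def c_def using x x0(1) fx0 sS
      by (simp add: fs.functional_diff[OF f] fs.functional_scale[OF f] fs.subspace_diff fs.subspace_scale)
    then have "ip p (T s) u = 0" using u fs.herm_zero_sym[OF herm_ip] by blast
    moreover have "T x = T s + fscale c u" unfolding s_def x0(2) by (simp add: T.diff T.scale)
    ultimately have "ip p (T x) u = c * ip p u u" by (simp add: ip_simps)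
    then show ?thesis using uu fx0 by (simp add: \<xi>_def ip_simps c_def)
  qed
  ultimately show ?thesis using that by blast
qed

section \<open>Product subspaces and the linearized form\<close>

definition csp_prod :: "nat \<Rightarrow> nat \<Rightarrow> (nat \<Rightarrow> complex) set \<Rightarrow> (nat \<Rightarrow> complex) set \<Rightarrow> (nat \<Rightarrow> complex) set" where
  "csp_prod n k V1 V2 = {x \<in> csp (n + k). head_part n x \<in> V1 \<and> tail_part n x \<in> V2}"

lemma subspace_csp_prod: "fs.subspace V1 \<Longrightarrow> fs.subspace V2 \<Longrightarrow> fs.subspace (csp_prod n k V1 V2)"
  using subspace_csp[of "n + k"] unfolding fs.subspace_def csp_prod_def
  by (simp add: head_part_add tail_part_add head_part_scale tail_part_scale)

lemma csp_prod_subset: "csp_prod n k V1 V2 \<subseteq> csp (n + k)"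
  unfolding csp_prod_def by blast

lemma fsub_csp_prod: "fs.subspace V1 \<Longrightarrow> fs.subspace V2 \<Longrightarrow> fs.fsub (csp_prod n k V1 V2)"
  by (rule fs.fsub_subset[OF fsub_csp subspace_csp_prod csp_prod_subset])

lemma csp_prod_full: "csp_prod n k (csp n) (csp k) = csp (n + k)"
  unfolding csp_prod_def using head_part_csp tail_part_csp by auto

lemma join_parts_in_csp_prod: "u \<in> V1 \<Longrightarrow> v \<in> V2 \<Longrightarrow> V1 \<subseteq> csp n \<Longrightarrow> V2 \<subseteq> csp k \<Longrightarrow> join_parts n u v \<in> csp_prod n k V1 V2"
  unfolding csp_prod_def using join_parts_csp[of v k n u] head_part_id[of u n] by (auto simp: head_part_join_parts)

lemma dim_csp_prod_zero:
  assumes "fs.subspace V" "V \<subseteq> csp k" shows "fs.dim (csp_prod n k {0} V) = fs.dim V"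
proof (rule fs.dim_via_bijection[OF linear_tail_part[of n]])
  show "fs.fsub (csp_prod n k {0} V)" using assms(1) by (intro fsub_csp_prod fs.subspace_single_0)
  show "tail_part n ` csp_prod n k {0} V = V"
  proof
    show "tail_part n ` csp_prod n k {0} V \<subseteq> V" unfolding csp_prod_def by blast
    show "V \<subseteq> tail_part n ` csp_prod n k {0} V"
    proof
      fix v assume "v \<in> V"
      then have "join_parts n 0 v \<in> csp_prod n k {0} V"
        using assms(2) fs.subspace_0[OF subspace_csp[of n]] by (intro join_parts_in_csp_prod) auto
      then have "tail_part n (join_parts n 0 v) \<in> tail_part n ` csp_prod n k {0} V" by (rule imageI)
      then show "v \<in> tail_part n ` csp_prod n k {0} V" by simp
    qed
  qed
qed (auto simp: csp_prod_def intro: head_part_tail_part_eq_0)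

definition block_form :: "nat \<Rightarrow> nat \<Rightarrow> complex mat \<Rightarrow> (nat \<Rightarrow> complex) \<Rightarrow> (nat \<Rightarrow> complex) \<Rightarrow> complex" where
  "block_form n q M x y = ip n (mv M (tail_part n x)) y + ip n x (mv M (tail_part n y)) - ip n x y - ip q (tail_part n x) (tail_part n y)"

lemma herm_block_form: "fs.herm (block_form n q M)"
proof (rule fs.hermI)
  show "block_form n q M y x = cnj (block_form n q M x y)" for x y
    using fs.herm_sym[OF herm_ip[of n]] fs.herm_sym[OF herm_ip[of q]]
    unfolding block_form_def by (metis (no_types, lifting) add.commute complex_cnj_add complex_cnj_diff)
qed (simp_all add: block_form_def tail_part_add tail_part_scale mv_add mv_scale ip_simps algebra_simps)

lemma block_form_eq:
  assumes "M \<in> carrier_mat n q"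
  shows "block_form n q M x y = ip n (mv M (tail_part n x) - head_part n x) y + ip q (mv (mat_adjoint M) x - tail_part n x) (tail_part n y)"
  unfolding block_form_def
  by (simp add: fs.herm_diff_left[OF herm_ip] ip_adjoint'[OF assms])

text \<open>Testing against vectors with one coordinate zero separates the two residuals, which
  later describe every orthogonal complement and radical of the block form.\<close>

lemma block_form_perp:
  assumes M: "M \<in> carrier_mat n q" and V: "fs.subspace V1" "fs.subspace V2" "V1 \<subseteq> csp n" "V2 \<subseteq> csp q"
  shows "(\<forall>y\<in>csp_prod n q V1 V2. block_form n q M x y = 0) \<longleftrightarrow>
    (\<forall>u\<in>V1. ip n (mv M (tail_part n x) - head_part n x) u = 0) \<and> (\<forall>v\<in>V2. ip q (mv (mat_adjoint M) x - tail_part n x) v = 0)"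
proof
  assume a: "\<forall>y\<in>csp_prod n q V1 V2. block_form n q M x y = 0"
  have "ip n (mv M (tail_part n x) - head_part n x) u = 0" if "u \<in> V1" for u
  proof -
    have "join_parts n u 0 \<in> csp_prod n q V1 V2" using that V fs.subspace_0 by (intro join_parts_in_csp_prod) auto
    then have "block_form n q M x (join_parts n u 0) = 0" using a by blast
    then show ?thesis unfolding block_form_eq[OF M] by (simp add: ip_zero)
  qed
  moreover have "ip q (mv (mat_adjoint M) x - tail_part n x) v = 0" if "v \<in> V2" for v
  proof -
    have "join_parts n 0 v \<in> csp_prod n q V1 V2" using that V fs.subspace_0 by (intro join_parts_in_csp_prod) auto
    then have "block_form n q M x (join_parts n 0 v) = 0" using a by blast
    then show ?thesis unfolding block_form_eq[OF M] by (simp add: ip_zero)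
  qed
  ultimately show "(\<forall>u\<in>V1. ip n (mv M (tail_part n x) - head_part n x) u = 0)
      \<and> (\<forall>v\<in>V2. ip q (mv (mat_adjoint M) x - tail_part n x) v = 0)" by blast
next
  assume a: "(\<forall>u\<in>V1. ip n (mv M (tail_part n x) - head_part n x) u = 0)
      \<and> (\<forall>v\<in>V2. ip q (mv (mat_adjoint M) x - tail_part n x) v = 0)"
  show "\<forall>y\<in>csp_prod n q V1 V2. block_form n q M x y = 0"
  proof
    fix y assume "y \<in> csp_prod n q V1 V2"
    then have "head_part n y \<in> V1" "tail_part n y \<in> V2" unfolding csp_prod_def by blast+
    then have "ip n (mv M (tail_part n x) - head_part n x) (head_part n y) = 0" "ip q (mv (mat_adjoint M) x - tail_part n x) (tail_part n y) = 0"
      using a by blast+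
    then show "block_form n q M x y = 0" unfolding block_form_eq[OF M] by simp
  qed
qed

lemma block_form_negative:
  assumes x: "x \<in> csp (n + q)" "head_part n x = 0" "x \<noteq> 0"
  shows "0 < Re (- block_form n q M x x)"
proof -
  have z: "ip n x y = 0" "ip n y x = 0" for y
    using ip_head_part[of n x y] ip_head_part[of n y x] x(2)
    by (simp_all add: ip_zero)
  have "tail_part n x \<noteq> 0" using head_part_tail_part_eq_0[OF x(2)] x(3) by blast
  then have "0 < Re (ip q (tail_part n x) (tail_part n x))"
    using pos_on_ip[of q] tail_part_csp[OF x(1)] unfolding fs.pos_on_def by blast
  then show ?thesis unfolding block_form_def by (simp add: z)
qed

lemma gram_hermitian:
  fixes M :: "complex mat"
  assumes M: "M \<in> carrier_mat n q"
  shows "M * mat_adjoint M - 1\<^sub>m n \<in> carrier_mat n n"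
    and "mat_adjoint (M * mat_adjoint M - 1\<^sub>m n) = M * mat_adjoint M - 1\<^sub>m n"
proof -
  have c: "M * mat_adjoint M \<in> carrier_mat n n" using M adjoint_carrier[OF M] by simp
  show "M * mat_adjoint M - 1\<^sub>m n \<in> carrier_mat n n" by (rule minus_carrier_mat[OF one_carrier_mat])
  have a: "mat_adjoint (M * mat_adjoint M) = M * mat_adjoint M"
    using adjoint_mult[OF M adjoint_carrier[OF M]] by simp
  have "cnj ((M * mat_adjoint M) $$ (j,i)) = (M * mat_adjoint M) $$ (i,j)" if "i < n" "j < n" for i j
  proof -
    have "mat_adjoint (M * mat_adjoint M) $$ (i,j) = cnj ((M * mat_adjoint M) $$ (j,i))"
      using that c by (intro adjoint_index) auto
    then show ?thesis using a by simp
  qed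
  then show "mat_adjoint (M * mat_adjoint M - 1\<^sub>m n) = M * mat_adjoint M - 1\<^sub>m n"
    using c by (intro eq_matI) auto
qed

lemma mv_gram:
  assumes M: "M \<in> carrier_mat n q"
  shows "mv (M * mat_adjoint M - 1\<^sub>m n) x = mv M (mv (mat_adjoint M) x) - head_part n x"
proof -
  have c: "M * mat_adjoint M \<in> carrier_mat n n" using M adjoint_carrier[OF M] by simp
  show ?thesis
    using mv_minus_mat[OF c one_carrier_mat, of x] mv_mult[OF M adjoint_carrier[OF M], of x] mv_one_mat[of n x]
    by (simp add: head_part_def)
qed

lemma qf_gram:
  assumes M: "M \<in> carrier_mat n q"
  shows "qf (M * mat_adjoint M - 1\<^sub>m n) x y
    = ip q (mv (mat_adjoint M) x) (mv (mat_adjoint M) y) - ip n x y"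
  unfolding qf_def mv_gram[OF M] using gram_hermitian(1)[OF M] M
  by (simp add: fs.herm_diff_left[OF herm_ip] ip_adjoint[OF M])

text \<open>The Schur complement of the block \<open>- I\<^sub>q\<close> in \<open>block_form n q M\<close> is \<open>M M\<^sup>* - I\<^sub>n\<close>.\<close>

lemma inertia_block_form:
  assumes M: "M \<in> carrier_mat n q" and V: "fs.subspace V" "V \<subseteq> csp n"
  defines "G \<equiv> M * mat_adjoint M - 1\<^sub>m n"
  shows "fs.posi (block_form n q M) (csp_prod n q V (csp q)) = fs.posi (qf G) V"
    and "fs.negi (block_form n q M) (csp_prod n q V (csp q)) = q + fs.negi (qf G) V"
proof -
  let ?h = "block_form n q M" and ?V = "csp_prod n q V (csp q)" and ?S = "csp_prod n q {0} (csp q)"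
  have h: "fs.herm ?h" by (rule herm_block_form)
  have fV: "fs.fsub ?V" using V(1) subspace_csp by (rule fsub_csp_prod)
  have S: "fs.subspace ?S" "?S \<subseteq> ?V"
    using subspace_csp_prod[OF fs.subspace_single_0 subspace_csp] fs.subspace_0[OF V(1)]
    by (auto simp: csp_prod_def)
  have neg: "fs.pos_on (\<lambda>x y. - ?h x y) ?S"
    unfolding fs.pos_on_def using block_form_negative by (auto simp: csp_prod_def)
  have dS: "fs.dim ?S = q" using dim_csp_prod_zero[OF subspace_csp order_refl] by simp
  let ?P = "fs.perp ?h ?S ?V"
  have fP: "fs.fsub ?P" by (rule fs.fsub_perp[OF h fV])
  \<comment> \<open>The complement of the second coordinate space is the graph of
    \<open>M\<^sup>*\<close> over \<open>V\<close>, so the first coordinate alone determines the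
    form there.\<close>
  have P: "x \<in> ?P \<longleftrightarrow> x \<in> ?V \<and> mv (mat_adjoint M) x = tail_part n x" for x
  proof -
    have "(\<forall>v\<in>csp q. ip q (mv (mat_adjoint M) x - tail_part n x) v = 0) \<longleftrightarrow> mv (mat_adjoint M) x = tail_part n x"
      if "x \<in> ?V"
    proof -
      have "mv (mat_adjoint M) x - tail_part n x \<in> csp q"
        using that tail_part_csp mv_csp'[OF adjoint_carrier[OF M]] fs.subspace_diff[OF subspace_csp]
        unfolding csp_prod_def by blast
      then show ?thesis using csp_orthogonal[of "mv (mat_adjoint M) x - tail_part n x" q]
        by (auto simp: ip_zero)
    qed
    then show ?thesis
      using block_form_perp[OF M fs.subspace_single_0 subspace_csp _ order_refl, of x] fs.subspace_0[OF subspace_csp]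
      by (auto simp: fs.perp_def ip_zero)
  qed
  have im: "head_part n ` ?P = V"
  proof
    show "head_part n ` ?P \<subseteq> V" unfolding P[abs_def] using P by (auto simp: csp_prod_def)
    show "V \<subseteq> head_part n ` ?P"
    proof
      fix u assume u: "u \<in> V"
      let ?x = "join_parts n u (mv (mat_adjoint M) u)"
      have "?x \<in> ?V"
        using u V(2) mv_csp'[OF adjoint_carrier[OF M]] by (intro join_parts_in_csp_prod) auto
      then have "?x \<in> ?P" unfolding P using mv_join_parts[of "mat_adjoint M" n] M by simp
      moreover have "u = head_part n ?x" using u V(2) head_part_id by (auto simp: head_part_join_parts)
      ultimately show "u \<in> head_part n ` ?P" by blast
    qed
  qed
  have eq: "?h x x = qf G (head_part n x) (head_part n x)" if "x \<in> ?P" for x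
  proof -
    have "mv (mat_adjoint M) (head_part n x) = tail_part n x" using that mv_head_part[of "mat_adjoint M" n x] M unfolding P by simp
    then show ?thesis
      using that unfolding block_form_eq[OF M] G_def qf_gram[OF M] P
      by (simp add: fs.herm_diff_left[OF herm_ip] ip_zero ip_adjoint[OF M])
  qed
  have g: "fs.herm (qf G)" unfolding G_def by (rule herm_qf[OF gram_hermitian[OF M]])
  show "fs.posi ?h ?V = fs.posi (qf G) V"
    using fs.split_negative(1)[OF h fV S neg] fs.posi_pullback[where h = "qf G" and h' = ?h, OF linear_head_part fP im g eq] by simp
  show "fs.negi ?h ?V = q + fs.negi (qf G) V"
    using fs.split_negative(2)[OF h fV S neg] fs.negi_pullback[where h = "qf G" and h' = ?h, OF linear_head_part fP im g eq] dS by simp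
qed

section \<open>The four block matrices\<close>

locale affine_gram =
  fixes A B C :: "complex mat" and n p m q :: nat
  assumes A: "A \<in> carrier_mat n p" and B: "B \<in> carrier_mat m q" and C: "C \<in> carrier_mat n q"
begin

definition G where "G = C * mat_adjoint C - 1\<^sub>m n"
definition W where "W = csp (n + q)"
definition KA where "KA = ker n (mat_adjoint A)"
definition KB where "KB = ker q B"
definition K where "K = csp_prod n q KA (csp q)"
definition L where "L = csp_prod n q (csp n) KB"
definition F where "F = {block_form n q (A * X * B + C) |X. X \<in> carrier_mat p m}"
definition h0 where "h0 = block_form n q C"

lemma adj: "mat_adjoint A \<in> carrier_mat p n" "mat_adjoint B \<in> carrier_mat q m" "mat_adjoint C \<in> carrier_mat q n"
  using A B C adjoint_carrier by blast+

lemma G_carrier: "G \<in> carrier_mat n n" and G_adjoint: "mat_adjoint G = G"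
  unfolding G_def using gram_hermitian[OF C] .

lemma sub: "fs.subspace KA" "KA \<subseteq> csp n" "fs.subspace KB" "KB \<subseteq> csp q"
  unfolding KA_def KB_def by (auto simp: subspace_ker) (auto simp: ker_def)

lemma fsub_W: "fs.fsub W" and K_sub: "fs.subspace K" "K \<subseteq> W" and L_sub: "fs.subspace L" "L \<subseteq> W"
  unfolding W_def K_def L_def
  using fsub_csp subspace_csp_prod[OF sub(1) subspace_csp] subspace_csp_prod[OF subspace_csp sub(3)] csp_prod_subset
  by auto

lemma fsub_K: "fs.fsub K" and fsub_L: "fs.fsub L"
  by (rule fs.fsub_subset[OF fsub_W K_sub], rule fs.fsub_subset[OF fsub_W L_sub])

lemma W_prod: "W = csp_prod n q (csp n) (csp q)"
  unfolding W_def csp_prod_full ..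

lemma K_iff: "x \<in> K \<longleftrightarrow> x \<in> W \<and> mv (mat_adjoint A) x = 0"
  unfolding K_def csp_prod_def KA_def ker_def W_def
  using head_part_csp tail_part_csp mv_head_part[of "mat_adjoint A" n x] A by auto

lemma L_iff: "x \<in> L \<longleftrightarrow> x \<in> W \<and> mv B (tail_part n x) = 0"
  unfolding L_def csp_prod_def KB_def ker_def W_def using head_part_csp tail_part_csp by auto

lemma mv_AXB:
  assumes X: "X \<in> carrier_mat p m"
  shows "mv (A * X * B + C) z = mv A (mv X (mv B z)) + mv C z"
proof -
  have "A * X \<in> carrier_mat n m" "A * X * B \<in> carrier_mat n q" using A B X by auto
  then show ?thesis using mv_add_mat[OF _ C] mv_mult[OF _ B] mv_mult[OF A X] by simp
qed

lemma block_form_AXB: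
  assumes X: "X \<in> carrier_mat p m"
  shows "block_form n q (A * X * B + C) x y = h0 x y + ip p (mv X (mv B (tail_part n x))) (mv (mat_adjoint A) y)
    + ip p (mv (mat_adjoint A) x) (mv X (mv B (tail_part n y)))"
  unfolding block_form_def h0_def mv_AXB[OF X]
  by (simp add: ip_simps ip_adjoint[OF A] ip_adjoint'[OF A])

lemma AXB_C_carrier: "X \<in> carrier_mat p m \<Longrightarrow> A * X * B + C \<in> carrier_mat n q"
  using A B C by auto

lemma h0_F: "h0 \<in> F"
proof -
  have "A * 0\<^sub>m p m * B + C = C" using A B C by simp
  then show ?thesis unfolding F_def h0_def by (intro CollectI exI[of _ "0\<^sub>m p m"]) auto
qed

lemma F_herm: "h \<in> F \<Longrightarrow> fs.herm h"
  unfolding F_def using herm_block_form by blast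

lemma rank_one_mat: "\<xi> \<in> csp p \<Longrightarrow> mv (mat p m (\<lambda>(i,j). \<xi> i * cnj (\<zeta> j))) z = fscale (ip m z \<zeta>) \<xi>"
  by (auto simp: mv_def fun_eq_iff fscale_apply ip_def csp_def sum_distrib_left sum_distrib_right algebra_simps intro!: sum.cong)

text \<open>On \<open>W\<close>, functionals that vanish on \<open>K\<close> factor through
  \<open>A\<^sup>*\<close>, and those that vanish on \<open>L\<close> through \<open>B\<close> in
  the second coordinate. With the representing vectors \<open>\<xi>\<close> and
  \<open>\<zeta>\<close>, the update amounts to adding the rank-one matrix
  \<open>\<xi> \<zeta>\<^sup>*\<close> to \<open>X\<close>.\<close>

lemma closed:
  assumes h: "h \<in> F" and f: "fs.functional f" "\<And>x. x \<in> K \<Longrightarrow> f x = 0"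
    and g: "fs.functional g" "\<And>x. x \<in> L \<Longrightarrow> g x = 0"
  shows "\<exists>h'\<in>F. \<forall>x\<in>W. \<forall>y\<in>W. h' x y = fs.rank_two_update h f g x y"
proof -
  obtain X where X: "X \<in> carrier_mat p m" "h = block_form n q (A * X * B + C)" using h unfolding F_def by blast
  obtain \<xi> where \<xi>: "\<xi> \<in> csp p" "\<And>x. x \<in> W \<Longrightarrow> f x = ip p (mv (mat_adjoint A) x) \<xi>"
    by (rule functional_factor[OF linear_mv[of "mat_adjoint A"] fsub_W _ f(1), of p])
      (use f(2) K_iff mv_csp'[OF adj(1)] in auto)
  have lB: "Vector_Spaces.linear fscale fscale (\<lambda>x. mv B (tail_part n x))"
    by (rule fs.endo_linearI) (simp_all add: mv_add mv_scale tail_part_add tail_part_scale)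
  obtain \<zeta> where \<zeta>: "\<zeta> \<in> csp m" "\<And>x. x \<in> W \<Longrightarrow> g x = ip m (mv B (tail_part n x)) \<zeta>"
    by (rule functional_factor[OF lB fsub_W _ g(1), of m]) (use g(2) L_iff mv_csp'[OF B] in auto)
  define X1 where "X1 = mat p m (\<lambda>(i,j). \<xi> i * cnj (\<zeta> j))"
  have X1: "X1 \<in> carrier_mat p m" unfolding X1_def by simp
  have mX1: "mv X1 z = fscale (ip m z \<zeta>) \<xi>" for z unfolding X1_def by (rule rank_one_mat[OF \<xi>(1)])
  have XX: "X + X1 \<in> carrier_mat p m" using X(1) X1 by simp
  have "block_form n q (A * (X + X1) * B + C) x y = fs.rank_two_update h f g x y" if xy: "x \<in> W" "y \<in> W" for x y
  proof -
    have "cnj (f y) = ip p \<xi> (mv (mat_adjoint A) y)"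
      unfolding \<xi>(2)[OF xy(2)] using fs.herm_sym[OF herm_ip[of p], of \<xi>] by simp
    then show ?thesis
      unfolding fs.rank_two_update_def X(2) block_form_AXB[OF X(1)] block_form_AXB[OF XX]
      by (simp add: mv_add_mat[OF X(1) X1] mX1 ip_simps \<xi>(2)[OF xy(1)] \<zeta>(2)[OF xy(1)] \<zeta>(2)[OF xy(2)])
  qed
  then show ?thesis using XX unfolding F_def by blast
qed

lemma family: "form_family fscale F K L W"
proof unfold_locales
  show "F \<noteq> {}" using h0_F by blast
  show "\<exists>h'\<in>F. \<forall>x\<in>W. \<forall>y\<in>W. h' x y = fs.rank_two_update h f g x y"
    if "h \<in> F" "fs.functional f" "fs.functional g" "\<And>x. x \<in> K \<Longrightarrow> f x = 0" "\<And>x. x \<in> L \<Longrightarrow> g x = 0" for h f g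
    using closed that by blast
  have z: "ip k 0 y = 0" "ip k y 0 = 0" for k y
    by (simp_all add: ip_zero)
  have K0: "h x y = h0 x y" if "h \<in> F" "x \<in> K" "y \<in> K" for h x y
    using that unfolding F_def K_iff by (auto simp: block_form_AXB z)
  have L0: "h x y = h0 x y" if "h \<in> F" "x \<in> L" "y \<in> L" for h x y
    using that unfolding F_def L_iff by (auto simp: block_form_AXB z mv_zero)
  have KL0: "h x y = h0 x y" if "h \<in> F" "x \<in> K" "x \<in> L" for h x y
    using that unfolding F_def K_iff L_iff by (auto simp: block_form_AXB z mv_zero)
  show "h x y = h' x y" if "h \<in> F" "h' \<in> F" "x \<in> K" "y \<in> K" for h h' x y using K0[OF that(1,3,4)] K0[OF that(2,3,4)] by simp
  show "h x y = h' x y" if "h \<in> F" "h' \<in> F" "x \<in> L" "y \<in> L" for h h' x y using L0[OF that(1,3,4)] L0[OF that(2,3,4)] by simp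
  show "h x y = h' x y" if "h \<in> F" "h' \<in> F" "x \<in> K" "x \<in> L" "y \<in> W" for h h' x y using KL0[OF that(1,3,4)] KL0[OF that(2,3,4)] by simp
qed (use fsub_W K_sub L_sub F_herm in auto)

text \<open>The block \<open>- I\<^sub>q\<close> that was added for the linearization contributes
  \<open>q\<close> to the negative index and hence to the rank.\<close>

lemma inertia_phi:
  assumes X: "X \<in> carrier_mat p m"
  defines "M \<equiv> A * X * B + C"
  defines "P \<equiv> M * mat_adjoint M - 1\<^sub>m n"
  shows "ipos P = fs.posi (block_form n q M) W" "ineg P + q = fs.negi (block_form n q M) W"
    "mrank P + q = fs.posi (block_form n q M) W + fs.negi (block_form n q M) W"
proof -
  have M: "M \<in> carrier_mat n q" unfolding M_def by (rule AXB_C_carrier[OF X])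
  note g = gram_hermitian[OF M, folded P_def]
  have "fs.posi (block_form n q M) W = fs.posi (qf P) (csp n)" "fs.negi (block_form n q M) W = q + fs.negi (qf P) (csp n)"
    unfolding W_prod P_def using inertia_block_form[OF M subspace_csp order_refl] by blast+
  then show "ipos P = fs.posi (block_form n q M) W" "ineg P + q = fs.negi (block_form n q M) W"
    "mrank P + q = fs.posi (block_form n q M) W + fs.negi (block_form n q M) W"
    using inertia_eq_eigenvalue_count[OF g] rank_eq_inertia[OF g] by simp_all
qed

lemma inertia_K: "fs.posi h0 K = fs.posi (qf G) KA" "fs.negi h0 K = q + fs.negi (qf G) KA"
  unfolding h0_def K_def G_def using inertia_block_form[OF C sub(1,2)] by blast+

lemma dim_KA: "fs.dim KA + mrank A = n" and dim_ker_A: "fs.dim (ker p A) + mrank A = p"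
  unfolding KA_def using rank_left_nullity[OF A] rank_nullity[OF A] by simp_all

lemma dim_KB: "fs.dim KB + mrank B = q" and dim_ker_adjoint_B: "fs.dim (ker m (mat_adjoint B)) + mrank B = m"
  unfolding KB_def using rank_left_nullity[OF B] rank_nullity[OF B] by simp_all

lemma dim_codim: "fs.dim K + mrank A = fs.dim W" "fs.dim L + mrank B = fs.dim W"
proof -
  have dprod: "fs.dim (csp_prod n q V1 V2) = fs.dim V1 + fs.dim V2"
    if V: "fs.subspace V1" "V1 \<subseteq> csp n" "fs.subspace V2" "V2 \<subseteq> csp q" for V1 V2
  proof -
    have im: "head_part n ` csp_prod n q V1 V2 = V1"
    proof
      show "head_part n ` csp_prod n q V1 V2 \<subseteq> V1" unfolding csp_prod_def by blast
      show "V1 \<subseteq> head_part n ` csp_prod n q V1 V2"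
      proof
        fix u assume u: "u \<in> V1"
        then have "join_parts n u 0 \<in> csp_prod n q V1 V2" using V fs.subspace_0 by (intro join_parts_in_csp_prod) auto
        moreover have "u = head_part n (join_parts n u 0)" using u V(2) head_part_id by (auto simp: head_part_join_parts)
        ultimately show "u \<in> head_part n ` csp_prod n q V1 V2" by blast
      qed
    qed
    have "{x \<in> csp_prod n q V1 V2. head_part n x = 0} = csp_prod n q {0} V2"
      using fs.subspace_0[OF V(1)] unfolding csp_prod_def by auto
    then show ?thesis
      using fs.dim_via_map[OF linear_head_part fsub_csp_prod[OF V(1,3)] im] dim_csp_prod_zero[OF V(3,4)] by simp
  qed
  show "fs.dim K + mrank A = fs.dim W"
    unfolding K_def W_def using dprod[OF sub(1,2) subspace_csp order_refl] dim_KA by simp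
  show "fs.dim L + mrank B = fs.dim W"
    unfolding L_def W_def using dprod[OF subspace_csp order_refl sub(3,4)] dim_KB by simp
qed

section \<open>Inertia of \<open>N1\<close> and \<open>N3\<close>\<close>

definition N1 where "N1 = hcat G A @\<^sub>r hcat (mat_adjoint A) (0\<^sub>m p p)"

lemma N1_carrier: "N1 \<in> carrier_mat (n + p) (n + p)" and N1_adjoint: "mat_adjoint N1 = N1"
proof -
  show "N1 \<in> carrier_mat (n + p) (n + p)"
    unfolding N1_def using G_carrier A adj by (intro carrier_append_rows hcat_carrier) auto
  have "mat_adjoint (0\<^sub>m p p) = (0\<^sub>m p p :: complex mat)" by (rule eq_matI) auto
  then show "mat_adjoint N1 = N1"
    unfolding N1_def using G_carrier A
    by (simp add: adjoint_append_rows adjoint_hcat G_adjoint hcat_append_rows)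
qed

lemma qf_N1: "qf N1 x y = ip n (mv G x) y + ip n (mv A (tail_part n x)) y + ip p (mv (mat_adjoint A) x) (tail_part n y)"
proof -
  have "mv N1 x = join_parts n (mv G x + mv A (tail_part n x)) (mv (mat_adjoint A) x)"
    unfolding N1_def
    using mv_append_rows[OF hcat_carrier[OF G_carrier A] hcat_carrier[OF adj(1) zero_carrier_mat]]
      mv_hcat[OF G_carrier A] mv_hcat[OF adj(1) zero_carrier_mat, of p x]
    by (simp add: mv_zero_mat)
  then show ?thesis
    unfolding qf_def using N1_carrier by (simp add: ip_append ip_simps)
qed

text \<open>The last \<open>p\<close> coordinates form an isotropic space \<open>?S\<close> whose
  part in the radical is the kernel of \<open>A\<close>, so it contributes \<open>mrank A\<close> to
  each index. Its complement maps onto \<open>KA\<close>, where the form is that of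
  \<open>G\<close>; \<open>inertia_K\<close> passes from there to \<open>h0\<close> on
  \<open>K\<close>.\<close>

lemma inertia_N1:
  "ipos N1 = mrank A + fs.posi h0 K" "ineg N1 + q = mrank A + fs.negi h0 K"
proof -
  let ?h = "qf N1" and ?V = "csp (n + p)" and ?S = "csp_prod n p {0} (csp p)"
  have h: "fs.herm ?h" by (rule herm_qf[OF N1_carrier N1_adjoint])
  have S: "fs.subspace ?S" "?S \<subseteq> ?V"
    using subspace_csp_prod[OF fs.subspace_single_0 subspace_csp] csp_prod_subset by auto
  have dS: "fs.dim ?S = p" using dim_csp_prod_zero[OF subspace_csp order_refl] by simp
  have z: "mv G x = 0" "mv (mat_adjoint A) x = 0" "ip n x y = 0" "ip n y x = 0" if "x \<in> ?S" for x y
  proof -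
    have t: "head_part n x = 0" using that unfolding csp_prod_def by blast
    show "mv G x = 0" using mv_head_part[of G n x] G_carrier t by (simp add: mv_zero)
    show "mv (mat_adjoint A) x = 0" using mv_head_part[of "mat_adjoint A" n x] A t by (simp add: mv_zero)
    show "ip n x y = 0" using ip_head_part(1)[of n x y] t by (simp add: ip_zero)
    show "ip n y x = 0" using ip_head_part(2)[of n y x] t by (simp add: ip_zero)
  qed
  have hS: "?h x y = ip n (mv A (tail_part n x)) y" if "x \<in> ?S" for x y
    unfolding qf_N1 using z[OF that] by (simp add: ip_zero)
  have hSS: "?h x y = 0" if "x \<in> ?S" "y \<in> ?S" for x y using hS[OF that(1)] z(4)[OF that(2)] by simp
  have rS: "fs.radical ?h ?S = ?S" unfolding fs.perp_def using hSS by blast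
  have nn: "fs.nonpos_on (\<lambda>x y. - ?h x y) ?S" unfolding fs.nonpos_on_def using hSS by simp
  have SR: "?S \<inter> fs.radical ?h ?V = csp_prod n p {0} (ker p A)"
  proof -
    have "(\<forall>y\<in>?V. ?h x y = 0) \<longleftrightarrow> mv A (tail_part n x) = 0" if x: "x \<in> ?S" for x
    proof
      assume a: "\<forall>y\<in>?V. ?h x y = 0"
      have "ip n (mv A (tail_part n x)) u = 0" if "u \<in> csp n" for u
        using a that csp_mono[of n "n + p"] hS[OF x] by fastforce
      then show "mv A (tail_part n x) = 0" by (rule csp_orthogonal[OF mv_csp'[OF A]])
    qed (simp add: hS[OF x] ip_zero)
    then show ?thesis
      using S(2) tail_part_csp unfolding fs.perp_def ker_def csp_prod_def by blast
  qed
  have dSR: "fs.dim (?S \<inter> fs.radical ?h ?V) + mrank A = p"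
    unfolding SR using dim_csp_prod_zero[OF subspace_ker, of p A p n] dim_ker_A by (auto simp: ker_def)
  let ?P = "fs.perp ?h ?S ?V"
  have fP: "fs.fsub ?P" by (rule fs.fsub_perp[OF h fsub_csp])
  have P: "x \<in> ?P \<longleftrightarrow> x \<in> ?V \<and> mv (mat_adjoint A) x = 0" for x
  proof -
    have e: "?h x y = ip p (mv (mat_adjoint A) x) (tail_part n y)" if "y \<in> ?S" for y
      unfolding qf_N1 using z(4)[OF that] by simp
    have "(\<forall>y\<in>?S. ?h x y = 0) \<longleftrightarrow> mv (mat_adjoint A) x = 0"
    proof
      assume a: "\<forall>y\<in>?S. ?h x y = 0"
      have "ip p (mv (mat_adjoint A) x) v = 0" if "v \<in> csp p" for v
      proof -
        have "join_parts n 0 v \<in> ?S" using that fs.subspace_0[OF subspace_csp[of n]] by (intro join_parts_in_csp_prod) auto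
        then show ?thesis using a e[of "join_parts n 0 v"] by simp
      qed
      then show "mv (mat_adjoint A) x = 0" by (rule csp_orthogonal[OF mv_csp'[OF adj(1)]])
    next
      assume "mv (mat_adjoint A) x = 0"
      then show "\<forall>y\<in>?S. ?h x y = 0" using e by (simp add: ip_zero)
    qed
    then show ?thesis unfolding fs.perp_def by blast
  qed
  have im: "head_part n ` ?P = KA"
  proof
    show "head_part n ` ?P \<subseteq> KA"
      unfolding KA_def ker_def using P mv_head_part[of "mat_adjoint A" n] A head_part_csp by auto
    show "KA \<subseteq> head_part n ` ?P"
    proof
      fix u assume u: "u \<in> KA"
      then have "u \<in> ?P" unfolding P using csp_mono[of n "n + p"] by (auto simp: KA_def ker_def)
      moreover have "u = head_part n u" using u sub(2) head_part_id by auto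
      ultimately show "u \<in> head_part n ` ?P" by blast
    qed
  qed
  have eq: "?h x x = qf G (head_part n x) (head_part n x)" if "x \<in> ?P" for x
  proof -
    have "mv (mat_adjoint A) x = 0" using that P by blast
    moreover have "ip n (mv A (tail_part n x)) x = ip p (tail_part n x) (mv (mat_adjoint A) x)" by (rule ip_adjoint[OF A])
    moreover have "mv G (head_part n x) = mv G x" using mv_head_part[of G n x] G_carrier by simp
    ultimately show ?thesis
      unfolding qf_N1 using G_carrier
      by (simp add: qf_def ip_zero)
  qed
  have g: "fs.herm (qf G)" by (rule herm_qf[OF G_carrier G_adjoint])
  have "fs.posi ?h ?P = fs.posi (qf G) KA"
    by (rule fs.posi_pullback[where h = "qf G" and h' = ?h, OF linear_head_part fP im g eq])
  moreover have "fs.negi ?h ?P = fs.negi (qf G) KA"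
    by (rule fs.negi_pullback[where h = "qf G" and h' = ?h, OF linear_head_part fP im g eq])
  ultimately show "ipos N1 = mrank A + fs.posi h0 K" "ineg N1 + q = mrank A + fs.negi h0 K"
    using fs.split_nonneg[OF h fsub_csp S nn] dS dSR rS inertia_K
      inertia_eq_eigenvalue_count[OF N1_carrier N1_adjoint] by simp_all
qed

definition N3 where "N3 = hcat G (C * mat_adjoint B) @\<^sub>r hcat (B * mat_adjoint C) (B * mat_adjoint B)"

lemma block_carriers: "C * mat_adjoint B \<in> carrier_mat n m" "B * mat_adjoint C \<in> carrier_mat m n"
    "B * mat_adjoint B \<in> carrier_mat m m"
  using B C adj by auto

lemma block_adjoints: "mat_adjoint (C * mat_adjoint B) = B * mat_adjoint C"
    "mat_adjoint (B * mat_adjoint C) = C * mat_adjoint B" "mat_adjoint (B * mat_adjoint B) = B * mat_adjoint B"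
  using adjoint_mult[OF C adj(2)] adjoint_mult[OF B adj(3)] adjoint_mult[OF B adj(2)] by simp_all

lemma mv_blocks: "mv (C * mat_adjoint B) x = mv C (mv (mat_adjoint B) x)"
    "mv (B * mat_adjoint C) x = mv B (mv (mat_adjoint C) x)" "mv (B * mat_adjoint B) x = mv B (mv (mat_adjoint B) x)"
  using mv_mult[OF C adj(2)] mv_mult[OF B adj(3)] mv_mult[OF B adj(2)] by simp_all

lemma N3_carrier: "N3 \<in> carrier_mat (n + m) (n + m)" and N3_adjoint: "mat_adjoint N3 = N3"
proof -
  show "N3 \<in> carrier_mat (n + m) (n + m)"
    unfolding N3_def using G_carrier block_carriers by (intro carrier_append_rows hcat_carrier) auto
  show "mat_adjoint N3 = N3"
    unfolding N3_def using G_carrier block_carriers B C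
    by (simp add: adjoint_append_rows adjoint_hcat G_adjoint block_adjoints hcat_append_rows)
qed

text \<open>The row block \<open>[C\<^sup>*, B\<^sup>*]\<close> applied to \<open>x\<close>.
  \<open>N3\<close> is the Gram matrix of this row minus the identity on the first \<open>n\<close>
  coordinates.\<close>

definition ce where "ce x = mv (mat_adjoint C) x + mv (mat_adjoint B) (tail_part n x)"

lemma ce_csp: "ce x \<in> csp q"
  unfolding ce_def using mv_csp'[OF adj(3)] mv_csp'[OF adj(2)] by (rule fs.subspace_add[OF subspace_csp])

lemma qf_N3: "qf N3 x y = ip q (ce x) (ce y) - ip n x y"
proof -
  have "mv N3 x = join_parts n (mv G x + mv C (mv (mat_adjoint B) (tail_part n x))) (mv B (ce x))"
    unfolding N3_def
    using mv_append_rows[OF hcat_carrier[OF G_carrier block_carriers(1)] hcat_carrier[OF block_carriers(2,3)]]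
      mv_hcat[OF G_carrier block_carriers(1)] mv_hcat[OF block_carriers(2,3)]
    by (simp add: mv_blocks ce_def mv_add)
  then have "qf N3 x y = ip n (mv G x) y + ip n (mv C (mv (mat_adjoint B) (tail_part n x))) y + ip m (mv B (ce x)) (tail_part n y)"
    unfolding qf_def using N3_carrier by (simp add: ip_append ip_simps)
  moreover have "ip n (mv G x) y = ip q (mv (mat_adjoint C) x) (mv (mat_adjoint C) y) - ip n x y"
    using qf_gram[OF C, of x y] G_carrier unfolding qf_def G_def by simp
  ultimately show ?thesis
    by (simp add: ce_def ip_adjoint[OF C] ip_adjoint[OF B] ip_simps mv_add)
qed

lemma linear_join_parts_ce: "Vector_Spaces.linear fscale fscale (\<lambda>x. join_parts n x (ce x))"
  by (rule fs.endo_linearI)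
    (simp_all add: ce_def join_parts_add join_parts_scale mv_add mv_scale tail_part_add tail_part_scale fs.scale_right_distrib algebra_simps)

lemma ker_join_parts_ce: "join_parts n x (ce x) = 0 \<longleftrightarrow> head_part n x = 0 \<and> mv (mat_adjoint B) (tail_part n x) = 0"
proof -
  have "head_part n x = 0 \<Longrightarrow> mv (mat_adjoint C) x = 0"
    using mv_head_part[of "mat_adjoint C" n x] C by (simp add: mv_zero)
  then show ?thesis unfolding join_parts_eq_0 ce_def by auto
qed

lemma ker_adjoint_B_csp_prod:
  "{x \<in> csp (n + m). head_part n x = 0 \<and> mv (mat_adjoint B) (tail_part n x) = 0} = csp_prod n m {0} (ker m (mat_adjoint B))"
  unfolding csp_prod_def ker_def using tail_part_csp by auto

lemma dim_ker_adjoint_B_csp_prod: "fs.dim (csp_prod n m {0} (ker m (mat_adjoint B))) + mrank B = m"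
  using dim_csp_prod_zero[OF subspace_ker, of m "mat_adjoint B" m n] dim_ker_adjoint_B by (auto simp: ker_def)

text \<open>Both forms are cut down until they match. In \<open>N3\<close> the last \<open>m\<close>
  coordinates form a nonnegative space with the kernel of \<open>B\<^sup>*\<close> as radical; in
  \<open>L\<close> the vectors with first coordinate 0 form a negative definite space of dimension
  \<open>q - mrank B\<close>. The map from \<open>x\<close> to \<open>join_parts n x (ce x)\<close>
  carries the first complement onto the second and preserves the forms.\<close>

lemma inertia_N3:
  "ipos N3 = mrank B + fs.posi h0 L" "ineg N3 + q = mrank B + fs.negi h0 L"
proof -
  let ?h = "qf N3" and ?V = "csp (n + m)" and ?S = "csp_prod n m {0} (csp m)"
  have h: "fs.herm ?h" by (rule herm_qf[OF N3_carrier N3_adjoint])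
  have S: "fs.subspace ?S" "?S \<subseteq> ?V"
    using subspace_csp_prod[OF fs.subspace_single_0 subspace_csp] csp_prod_subset by auto
  have dS: "fs.dim ?S = m" using dim_csp_prod_zero[OF subspace_csp order_refl] by simp
  have t: "head_part n x = 0" if "x \<in> ?S" for x using that unfolding csp_prod_def by blast
  have zi: "ip n x y = 0" "ip n y x = 0" if "x \<in> ?S" for x y
    using ip_head_part(1)[of n x y] ip_head_part(2)[of n y x] t[OF that]
    by (simp_all add: ip_zero)
  have ceS: "ce x = mv (mat_adjoint B) (tail_part n x)" if "x \<in> ?S" for x
    unfolding ce_def using mv_head_part[of "mat_adjoint C" n x] C t[OF that] by (simp add: mv_zero)
  have hS: "?h x y = ip q (ce x) (ce y)" if "y \<in> ?S" for x y unfolding qf_N3 using zi[OF that] by simp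
  have hS': "?h x y = ip q (ce x) (ce y)" if "x \<in> ?S" for x y unfolding qf_N3 using zi[OF that] by simp
  have nn: "fs.nonpos_on (\<lambda>x y. - ?h x y) ?S"
    unfolding fs.nonpos_on_def by (auto simp: hS ip_self sum_nonneg)
  have ker: "{x \<in> ?S. ce x = 0} = csp_prod n m {0} (ker m (mat_adjoint B))"
    using ceS tail_part_csp unfolding csp_prod_def ker_def by auto
  have rad: "x \<in> ?S \<Longrightarrow> (\<forall>y\<in>V'. ?h x y = 0) \<longleftrightarrow> ce x = 0" if "?S \<subseteq> V'" for x V'
  proof
    assume x: "x \<in> ?S" and a: "\<forall>y\<in>V'. ?h x y = 0"
    then have "ip q (ce x) (ce x) = 0" using that hS[OF x, of x] by auto
    then show "ce x = 0" by (rule ip_self_0[OF ce_csp])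
  next
    assume "x \<in> ?S" "ce x = 0"
    then show "\<forall>y\<in>V'. ?h x y = 0" using hS' by (simp add: ip_zero)
  qed
  have rS: "fs.radical ?h ?S = csp_prod n m {0} (ker m (mat_adjoint B))"
    unfolding ker[symmetric] fs.perp_def using rad[OF order_refl] by blast
  have SR: "?S \<inter> fs.radical ?h ?V = csp_prod n m {0} (ker m (mat_adjoint B))"
    unfolding ker[symmetric] fs.perp_def using rad[OF S(2)] S(2) by blast
  let ?P = "fs.perp ?h ?S ?V"
  have fP: "fs.fsub ?P" by (rule fs.fsub_perp[OF h fsub_csp])
  have P: "x \<in> ?P \<longleftrightarrow> x \<in> ?V \<and> mv B (ce x) = 0" for x
  proof -
    have e: "?h x y = ip m (mv B (ce x)) (tail_part n y)" if "y \<in> ?S" for y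
      unfolding hS[OF that] ceS[OF that] by (rule ip_adjoint[OF B, symmetric])
    have "(\<forall>y\<in>?S. ?h x y = 0) \<longleftrightarrow> mv B (ce x) = 0"
    proof
      assume a: "\<forall>y\<in>?S. ?h x y = 0"
      have "ip m (mv B (ce x)) v = 0" if "v \<in> csp m" for v
      proof -
        have "join_parts n 0 v \<in> ?S" using that fs.subspace_0[OF subspace_csp[of n]] by (intro join_parts_in_csp_prod) auto
        then show ?thesis using a e[of "join_parts n 0 v"] by simp
      qed
      then show "mv B (ce x) = 0" by (rule csp_orthogonal[OF mv_csp'[OF B]])
    next
      assume "mv B (ce x) = 0"
      then show "\<forall>y\<in>?S. ?h x y = 0" using e by (simp add: ip_zero)
    qed
    then show ?thesis unfolding fs.perp_def by blast
  qed
  let ?T = "csp_prod n q {0} KB"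
  have T: "fs.subspace ?T" "?T \<subseteq> L"
    using subspace_csp_prod[OF fs.subspace_single_0 sub(3)] fs.subspace_0[OF subspace_csp[of n]]
    unfolding L_def csp_prod_def by auto
  have neg: "fs.pos_on (\<lambda>x y. - h0 x y) ?T"
    unfolding fs.pos_on_def h0_def using block_form_negative by (auto simp: csp_prod_def)
  have dT: "fs.dim ?T + mrank B = q" using dim_csp_prod_zero[OF sub(3,4)] dim_KB by simp
  let ?R = "fs.perp h0 ?T L"
  have R: "z \<in> ?R \<longleftrightarrow> z \<in> L \<and> (\<forall>v\<in>KB. ip q (mv (mat_adjoint C) z - tail_part n z) v = 0)" for z
    unfolding fs.perp_def h0_def
    using block_form_perp[OF C fs.subspace_single_0 sub(3) _ sub(4), of z] fs.subspace_0[OF subspace_csp[of n]]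
    by (auto simp: ip_zero)
  have im: "(\<lambda>x. join_parts n x (ce x)) ` ?P = ?R"
  proof
    show "(\<lambda>x. join_parts n x (ce x)) ` ?P \<subseteq> ?R"
    proof
      fix z assume "z \<in> (\<lambda>x. join_parts n x (ce x)) ` ?P"
      then obtain x where x: "x \<in> ?P" "z = join_parts n x (ce x)" by blast
      have "z \<in> L" unfolding L_iff W_def using x ce_csp join_parts_csp P by auto
      moreover have "mv (mat_adjoint C) z = mv (mat_adjoint C) x"
        unfolding x(2) using mv_join_parts[of "mat_adjoint C" n] C by simp
      then have "mv (mat_adjoint C) z - tail_part n z = - mv (mat_adjoint B) (tail_part n x)"
        unfolding x(2) by (simp add: ce_def)
      moreover have "ip q (- mv (mat_adjoint B) (tail_part n x)) v = 0" if "v \<in> KB" for v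
        using that ip_adjoint'[OF B, of "tail_part n x" v] unfolding KB_def ker_def
        by (simp add: ip_simps)
      ultimately show "z \<in> ?R" unfolding R by simp
    qed
    show "?R \<subseteq> (\<lambda>x. join_parts n x (ce x)) ` ?P"
    proof
      fix z assume "z \<in> ?R"
      then have z: "z \<in> L" "\<And>v. v \<in> KB \<Longrightarrow> ip q (mv (mat_adjoint C) z - tail_part n z) v = 0" using R by blast+
      have zc: "z \<in> csp (n + q)" "mv B (tail_part n z) = 0" using z(1) L_iff unfolding W_def by blast+
      have "mv (mat_adjoint C) z - tail_part n z \<in> csp q"
        using tail_part_csp[OF zc(1)] mv_csp'[OF adj(3)] by (intro fs.subspace_diff[OF subspace_csp])
      \<comment> \<open>Orthogonality to \<open>KB\<close>, the kernel of \<open>B\<close>, says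
        that the residual is a value of \<open>B\<^sup>*\<close>; this provides the last
        \<open>m\<close> coordinates of the preimage.\<close>
      then obtain \<eta> where \<eta>: "\<eta> \<in> csp m" "mv (mat_adjoint C) z - tail_part n z = mv (mat_adjoint B) \<eta>"
        using range_of_orthogonal_kernel[OF adj(2)] z(2) unfolding KB_def by (metis adjoint_adjoint)
      define x where "x = join_parts n z (- \<eta>)"
      have "ce x = mv (mat_adjoint C) z - mv (mat_adjoint B) \<eta>"
        unfolding ce_def x_def using mv_join_parts[of "mat_adjoint C" n] C by (simp add: mv_minus)
      then have ce: "ce x = tail_part n z" unfolding \<eta>(2)[symmetric] by simp
      have "- \<eta> \<in> csp m" using \<eta>(1) unfolding csp_def by simp
      then have "x \<in> csp (n + m)" unfolding x_def by (rule join_parts_csp)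
      then have "x \<in> ?P" unfolding P ce using zc(2) by blast
      moreover have "join_parts n x (ce x) = z"
        unfolding ce unfolding x_def by (simp add: join_parts_tail_part)
      ultimately show "z \<in> (\<lambda>x. join_parts n x (ce x)) ` ?P" by (metis imageI)
    qed
  qed
  have eq: "?h x x = h0 (join_parts n x (ce x)) (join_parts n x (ce x))" if "x \<in> ?P" for x
  proof -
    let ?e = "ce x"
    \<comment> \<open>\<open>B\<close> annihilates \<open>?e\<close>, so only the
      \<open>C\<^sup>*\<close> part of \<open>?e\<close> pairs with \<open>?e\<close>. The two mixed
      terms of \<open>h0\<close> then give twice \<open>ip q ?e ?e\<close>, and the block
      \<open>- I\<^sub>q\<close> takes one of them away.\<close>
    have "mv B ?e = 0" using that P by blast
    then have "ip q (mv (mat_adjoint B) (tail_part n x)) ?e = 0"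
      using ip_adjoint'[OF B, of "tail_part n x" ?e] by (simp add: ip_zero)
    then have a: "ip q (mv (mat_adjoint C) x) ?e = ip q ?e ?e"
      by (simp add: ce_def fs.herm_add_left[OF herm_ip])
    then have b: "ip q ?e (mv (mat_adjoint C) x) = ip q ?e ?e"
      using fs.herm_sym[OF herm_ip[of q], of ?e] by metis
    show ?thesis
      unfolding qf_N3 h0_def block_form_def
      using a b by (simp add: ip_adjoint[OF C] ip_adjoint'[OF C, symmetric])
  qed
  have h0: "fs.herm h0" unfolding h0_def by (rule herm_block_form)
  have "fs.posi ?h ?P = fs.posi h0 ?R"
    by (rule fs.posi_pullback[where h = h0 and h' = ?h, OF linear_join_parts_ce fP im h0 eq])
  moreover have "fs.negi ?h ?P = fs.negi h0 ?R"
    by (rule fs.negi_pullback[where h = h0 and h' = ?h, OF linear_join_parts_ce fP im h0 eq])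
  ultimately show "ipos N3 = mrank B + fs.posi h0 L" "ineg N3 + q = mrank B + fs.negi h0 L"
    using fs.split_nonneg[OF h fsub_csp S nn] dS rS SR dim_ker_adjoint_B_csp_prod
      fs.split_negative[OF h0 fsub_L T neg] dT
      inertia_eq_eigenvalue_count[OF N3_carrier N3_adjoint] by simp_all
qed

end

lemma join_parts_eq_0_csp: "u \<in> csp n \<Longrightarrow> join_parts n u v = 0 \<longleftrightarrow> u = 0 \<and> v = 0"
  by (simp add: join_parts_eq_0 head_part_id)

lemma adjoint_zero_mat: "mat_adjoint (0\<^sub>m r c) = (0\<^sub>m c r :: complex mat)"
  by (rule eq_matI) auto

context affine_gram
begin

section \<open>Radicals and the ranks of \<open>N2\<close>, \<open>N4\<close> and the row
  block\<close>

text \<open>\<open>rad_K\<close>, \<open>rad_L\<close> and \<open>rad_KL\<close> supply the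
  dimensions that complete the lower bounds. Each is computed as the left kernel of a block matrix,
  for \<open>rad_K\<close> and \<open>rad_L\<close> modulo a copy of the kernel of \<open>A\<close>
  or of \<open>B\<^sup>*\<close>.\<close>

definition rad_K where "rad_K = L \<inter> fs.radical h0 K"
definition rad_L where "rad_L = K \<inter> fs.radical h0 L"
definition rad_KL where "rad_KL = K \<inter> L \<inter> fs.radical h0 W"

lemma herm_h0: "fs.herm h0"
  unfolding h0_def by (rule herm_block_form)

lemma fsub_rads: "fs.fsub rad_L" "fs.fsub rad_K" "fs.fsub rad_KL"
proof -
  note r = fs.fsub_subspace[OF fs.fsub_perp[OF herm_h0]]
  show "fs.fsub rad_L" unfolding rad_L_def by (rule fs.fsub_Int[OF fsub_K r[OF fsub_L]])
  show "fs.fsub rad_K" unfolding rad_K_def by (rule fs.fsub_Int[OF fsub_L r[OF fsub_K]])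
  show "fs.fsub rad_KL" unfolding rad_KL_def
    by (rule fs.fsub_Int[OF fs.fsub_Int[OF fsub_K L_sub(1)] r[OF fsub_W]])
qed

lemma orthogonal_to_all: "d \<in> csp k \<Longrightarrow> (\<forall>u\<in>csp k. ip k d u = 0) \<longleftrightarrow> d = 0"
  using csp_orthogonal[of d k] by (auto simp: ip_zero)

lemma residuals_csp:
  assumes "x \<in> W"
  shows "mv C (tail_part n x) - head_part n x \<in> csp n" "mv (mat_adjoint C) x - tail_part n x \<in> csp q"
  using assms tail_part_csp[of x n q] mv_csp'[OF C] mv_csp'[OF adj(3)] head_part_csp unfolding W_def
  by (auto intro!: fs.subspace_diff[OF subspace_csp])

lemma rad_KL_iff: "x \<in> rad_KL \<longleftrightarrow> x \<in> K \<and> x \<in> L \<and> mv C (tail_part n x) = head_part n x \<and> mv (mat_adjoint C) x = tail_part n x"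
proof (cases "x \<in> W")
  case True
  show ?thesis
    using block_form_perp[OF C subspace_csp subspace_csp order_refl order_refl, of x, folded W_prod]
      orthogonal_to_all[OF residuals_csp(1)[OF True]] orthogonal_to_all[OF residuals_csp(2)[OF True]] True
    unfolding rad_KL_def fs.perp_def h0_def by auto
qed (auto simp: rad_KL_def K_iff)

lemma rad_K_iff: "x \<in> rad_K \<longleftrightarrow> x \<in> K \<and> x \<in> L \<and> (\<forall>u\<in>KA. ip n (mv C (tail_part n x) - head_part n x) u = 0)
    \<and> mv (mat_adjoint C) x = tail_part n x"
proof (cases "x \<in> W")
  case True
  show ?thesis
    using block_form_perp[OF C sub(1) subspace_csp sub(2) order_refl, of x, folded K_def]
      orthogonal_to_all[OF residuals_csp(2)[OF True]]
    unfolding rad_K_def fs.perp_def h0_def by auto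
qed (auto simp: rad_K_def K_iff L_iff)

lemma rad_L_iff: "x \<in> rad_L \<longleftrightarrow> x \<in> K \<and> x \<in> L \<and> mv C (tail_part n x) = head_part n x
    \<and> (\<forall>v\<in>KB. ip q (mv (mat_adjoint C) x - tail_part n x) v = 0)"
proof (cases "x \<in> W")
  case True
  show ?thesis
    using block_form_perp[OF C subspace_csp sub(3) order_refl sub(4), of x, folded L_def]
      orthogonal_to_all[OF residuals_csp(1)[OF True]]
    unfolding rad_L_def fs.perp_def h0_def by auto
qed (auto simp: rad_L_def K_iff L_iff)

definition R where "R = hcat (hcat G (C * mat_adjoint B)) A"
definition N2 where "N2 = R @\<^sub>r hcat (hcat (mat_adjoint A) (0\<^sub>m p m)) (0\<^sub>m p p)"
definition N4 where "N4 = R @\<^sub>r hcat (hcat (B * mat_adjoint C) (B * mat_adjoint B)) (0\<^sub>m m p)"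

lemma R_carrier: "R \<in> carrier_mat n (n + m + p)"
  unfolding R_def by (intro hcat_carrier G_carrier block_carriers A)

lemma N2_carrier: "N2 \<in> carrier_mat (n + p) (n + m + p)"
  unfolding N2_def by (intro carrier_append_rows R_carrier hcat_carrier adj zero_carrier_mat)

lemma N4_carrier: "N4 \<in> carrier_mat (n + m) (n + m + p)"
  unfolding N4_def by (intro carrier_append_rows R_carrier hcat_carrier block_carriers zero_carrier_mat)

lemma mv_columns:
  assumes "P1 \<in> carrier_mat n k" "P2 \<in> carrier_mat m k" "P3 \<in> carrier_mat p k"
  shows "mv ((P1 @\<^sub>r P2) @\<^sub>r P3) x = join_parts (n + m) (join_parts n (mv P1 x) (mv P2 x)) (mv P3 x)"
  using mv_append_rows[OF carrier_append_rows[OF assms(1,2)] assms(3)] mv_append_rows[OF assms(1,2)] by simp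

lemma columns_eq_0:
  assumes "u \<in> csp n" "v \<in> csp m"
  shows "join_parts (n + m) (join_parts n u v) w = 0 \<longleftrightarrow> u = 0 \<and> v = 0 \<and> w = 0"
  using join_parts_eq_0_csp[OF join_parts_csp[OF assms(2)]] join_parts_eq_0_csp[OF assms(1)] by simp

lemma mv_adjoint_R:
  "mv (mat_adjoint R) x = join_parts (n + m) (join_parts n (mv G x) (mv B (mv (mat_adjoint C) x))) (mv (mat_adjoint A) x)"
proof -
  have "mat_adjoint R = (G @\<^sub>r (B * mat_adjoint C)) @\<^sub>r mat_adjoint A"
    unfolding R_def using G_carrier A block_carriers C by (simp add: adjoint_hcat G_adjoint block_adjoints)
  then show ?thesis using mv_columns[OF G_carrier block_carriers(2) adj(1)] by (simp add: mv_blocks)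
qed

lemma adjoint_R_carrier: "mat_adjoint R \<in> carrier_mat (n + m + p) n"
  by (rule adjoint_carrier[OF R_carrier])

lemma csps: "mv G x \<in> csp n" "mv A z \<in> csp n" "mv B w \<in> csp m" "mv C w \<in> csp n"
  using mv_csp' G_carrier A B C by blast+

lemma ker_R: "ker n (mat_adjoint R)
  = {w \<in> csp n. mv G w = 0 \<and> mv B (mv (mat_adjoint C) w) = 0 \<and> mv (mat_adjoint A) w = 0}"
  unfolding ker_def mv_adjoint_R columns_eq_0[OF csps(1,3)] ..

lemma ker_N2: "ker (n + p) (mat_adjoint N2) = {w \<in> csp (n + p). mv G w + mv A (tail_part n w) = 0
  \<and> mv B (mv (mat_adjoint C) w) = 0 \<and> mv (mat_adjoint A) w = 0}"
proof -
  let ?Q = "(A @\<^sub>r 0\<^sub>m m p) @\<^sub>r 0\<^sub>m p p"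
  have "mat_adjoint N2 = hcat (mat_adjoint R) ?Q"
    unfolding N2_def using R_carrier A by (simp add: adjoint_append_rows adjoint_hcat adjoint_zero_mat)
  moreover have "?Q \<in> carrier_mat (n + m + p) p"
    by (intro carrier_append_rows A zero_carrier_mat)
  ultimately have "mv (mat_adjoint N2) w = mv (mat_adjoint R) w + mv ?Q (tail_part n w)" for w
    using mv_hcat[OF adjoint_R_carrier] by simp
  then have "mv (mat_adjoint N2) w = join_parts (n + m) (join_parts n (mv G w + mv A (tail_part n w)) (mv B (mv (mat_adjoint C) w)))
      (mv (mat_adjoint A) w)" for w
    unfolding mv_adjoint_R mv_columns[OF A zero_carrier_mat zero_carrier_mat] join_parts_add by (simp add: mv_zero_mat)
  then show ?thesis
    unfolding ker_def using columns_eq_0[OF fs.subspace_add[OF subspace_csp csps(1,2)] csps(3)] by simp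
qed

lemma ker_N4: "ker (n + m) (mat_adjoint N4) = {w \<in> csp (n + m). mv C (ce w) = head_part n w
  \<and> mv B (ce w) = 0 \<and> mv (mat_adjoint A) w = 0}"
proof -
  let ?Q = "((C * mat_adjoint B) @\<^sub>r (B * mat_adjoint B)) @\<^sub>r 0\<^sub>m p m"
  have "mat_adjoint N4 = hcat (mat_adjoint R) ?Q"
    unfolding N4_def using R_carrier B C block_carriers
    by (simp add: adjoint_append_rows adjoint_hcat adjoint_zero_mat block_adjoints)
  moreover have "?Q \<in> carrier_mat (n + m + p) m"
    by (intro carrier_append_rows block_carriers zero_carrier_mat)
  ultimately have "mv (mat_adjoint N4) w = mv (mat_adjoint R) w + mv ?Q (tail_part n w)" for w
    using mv_hcat[OF adjoint_R_carrier] by simp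
  then have "mv (mat_adjoint N4) w = join_parts (n + m) (join_parts n (mv C (ce w) - head_part n w) (mv B (ce w))) (mv (mat_adjoint A) w)" for w
    unfolding mv_adjoint_R mv_columns[OF block_carriers(1,3) zero_carrier_mat] join_parts_add
    using mv_gram[OF C, of w] by (simp add: mv_zero_mat mv_blocks ce_def mv_add G_def diff_add_eq)
  then show ?thesis
    unfolding ker_def using columns_eq_0[OF fs.subspace_diff[OF subspace_csp csps(4) head_part_csp] csps(3)] by simp
qed

lemma mv_C_head_part: "mv (mat_adjoint C) (head_part n x) = mv (mat_adjoint C) x" "mv (mat_adjoint A) (head_part n x) = mv (mat_adjoint A) x"
    "mv (mat_adjoint C) (join_parts n x y) = mv (mat_adjoint C) x" "mv (mat_adjoint A) (join_parts n x y) = mv (mat_adjoint A) x"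
  using mv_head_part[of "mat_adjoint C" n x] mv_head_part[of "mat_adjoint A" n x] mv_join_parts[of "mat_adjoint C" n x] mv_join_parts[of "mat_adjoint A" n x] A C
  by simp_all

lemma mv_G: "mv G x = mv C (mv (mat_adjoint C) x) - head_part n x"
  unfolding G_def by (rule mv_gram[OF C])

lemma head_part_head_part [simp]: "head_part n (head_part n x) = head_part n x"
  by (rule head_part_id[OF head_part_csp])

text \<open>A vector of \<open>rad_KL\<close> is determined by its first coordinate
  \<open>w\<close>, the second being \<open>C\<^sup>* w\<close>; the remaining conditions place
  \<open>w\<close> in the left kernel of the row block.\<close>

lemma dim_rad_KL: "mrank R + fs.dim rad_KL = n"
proof -
  have "head_part n ` rad_KL = ker n (mat_adjoint R)"
  proof
    show "head_part n ` rad_KL \<subseteq> ker n (mat_adjoint R)"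
      unfolding ker_R using head_part_csp by (auto simp: rad_KL_iff K_iff L_iff mv_G mv_C_head_part)
    show "ker n (mat_adjoint R) \<subseteq> head_part n ` rad_KL"
    proof
      fix w assume w: "w \<in> ker n (mat_adjoint R)"
      let ?x = "join_parts n w (mv (mat_adjoint C) w)"
      have "?x \<in> rad_KL"
        using w join_parts_csp[OF mv_csp'[OF adj(3)]] unfolding ker_R rad_KL_iff K_iff L_iff W_def
        by (simp add: mv_G mv_C_head_part head_part_join_parts)
      moreover have "head_part n ?x = w" using w head_part_id unfolding ker_R by (simp add: head_part_join_parts)
      ultimately show "w \<in> head_part n ` rad_KL" by (metis imageI)
    qed
  qed
  moreover have "x = 0" if "x \<in> rad_KL" "head_part n x = 0" for x
  proof -
    have "tail_part n x = mv (mat_adjoint C) (head_part n x)" using that(1) unfolding rad_KL_iff by (simp add: mv_C_head_part)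
    then show ?thesis using head_part_tail_part_eq_0[OF that(2)] that(2) by (simp add: mv_zero)
  qed
  ultimately have "fs.dim rad_KL = fs.dim (ker n (mat_adjoint R))"
    by (intro fs.dim_via_bijection[OF linear_head_part fsub_rads(3)])
  then show ?thesis using rank_left_nullity[OF R_carrier] by simp
qed

text \<open>The last \<open>p\<close> coordinates of a vector in the left kernel of
  \<open>N2\<close> witness that \<open>G w\<close> lies in the range of \<open>A\<close>, that is,
  that it is orthogonal to \<open>KA\<close>, as \<open>rad_K\<close> demands. Two witnesses differ
  by an element of the kernel of \<open>A\<close>, which explains the term
  \<open>mrank A\<close>.\<close>

lemma dim_rad_K: "mrank N2 + fs.dim rad_K = n + mrank A"
proof -
  let ?f = "\<lambda>w. join_parts n w (mv (mat_adjoint C) w)" and ?N = "ker (n + p) (mat_adjoint N2)"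
  have lf: "Vector_Spaces.linear fscale fscale ?f"
    by (rule fs.endo_linearI) (simp_all add: join_parts_add join_parts_scale mv_add mv_scale)
  have im: "?f ` ?N = rad_K"
  proof
    show "?f ` ?N \<subseteq> rad_K"
    proof
      fix x assume "x \<in> ?f ` ?N"
      then obtain w where w: "w \<in> ?N" "x = ?f w" by blast
      have "mv C (mv (mat_adjoint C) w) - head_part n w = - mv A (tail_part n w)"
        using w(1) unfolding ker_N2 by (simp add: mv_G add_eq_0_iff2)
      moreover have "ip n (- mv A (tail_part n w)) u = 0" if "u \<in> KA" for u
        using that ip_adjoint[OF A, of "tail_part n w" u] unfolding KA_def ker_def
        by (simp add: ip_simps)
      ultimately show "x \<in> rad_K"
        using w join_parts_csp[OF mv_csp'[OF adj(3)]] unfolding rad_K_iff K_iff L_iff W_def ker_N2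
        by (simp add: mv_C_head_part head_part_join_parts)
    qed
    show "rad_K \<subseteq> ?f ` ?N"
    proof
      fix x assume x: "x \<in> rad_K"
      then have xW: "x \<in> W" unfolding rad_K_iff K_iff by blast
      obtain \<eta> where \<eta>: "\<eta> \<in> csp p" "mv C (tail_part n x) - head_part n x = mv A \<eta>"
        using range_of_orthogonal_kernel[OF A residuals_csp(1)[OF xW]] x unfolding rad_K_iff KA_def by metis
      let ?w = "join_parts n x (- \<eta>)"
      have "- \<eta> \<in> csp p" using \<eta>(1) unfolding csp_def by simp
      then have "?w \<in> csp (n + p)" by (rule join_parts_csp)
      moreover have "mv G ?w + mv A (tail_part n ?w) = 0"
        using x \<eta>(2) unfolding rad_K_iff by (simp add: mv_G mv_C_head_part head_part_join_parts mv_minus)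
      ultimately have "?w \<in> ?N"
        using x unfolding ker_N2 rad_K_iff K_iff L_iff by (simp add: mv_C_head_part)
      moreover have "?f ?w = x"
        using x unfolding rad_K_iff by (simp add: mv_C_head_part join_parts_tail_part)
      ultimately show "x \<in> ?f ` ?N" by (metis imageI)
    qed
  qed
  have "?f w = 0 \<longleftrightarrow> head_part n w = 0" for w
    unfolding join_parts_eq_0 using mv_C_head_part(1)[of w] mv_zero by (metis (no_types, lifting))
  moreover have "w \<in> ?N \<longleftrightarrow> w \<in> csp (n + p) \<and> mv A (tail_part n w) = 0" if t: "head_part n w = 0" for w
  proof -
    have "mv (mat_adjoint C) w = 0" "mv (mat_adjoint A) w = 0"
      using mv_C_head_part(1,2)[of w] t by (simp_all add: mv_zero)
    then show ?thesis unfolding ker_N2 mv_G using t by (simp add: mv_zero)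
  qed
  ultimately have "{w \<in> ?N. ?f w = 0} = csp_prod n p {0} (ker p A)"
    unfolding csp_prod_def ker_def using tail_part_csp by auto
  then have "fs.dim ?N = fs.dim rad_K + fs.dim (ker p A)"
    using fs.dim_via_map[OF lf fsub_ker im] dim_csp_prod_zero[OF subspace_ker, of p A p n]
    by (auto simp: ker_def)
  then show ?thesis using rank_left_nullity[OF N2_carrier] dim_ker_A by simp
qed

text \<open>In \<open>rad_L\<close> the residual of the second coordinate is orthogonal to
  \<open>KB\<close>, hence a value of \<open>B\<^sup>*\<close>. The negative of a preimage gives the
  last \<open>m\<close> coordinates of a vector in the left kernel of \<open>N4\<close>, determined
  up to the kernel of \<open>B\<^sup>*\<close>.\<close>

lemma dim_rad_L: "mrank N4 + fs.dim rad_L = n + mrank B"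
proof -
  let ?f = "\<lambda>w. join_parts n w (ce w)" and ?N = "ker (n + m) (mat_adjoint N4)"
  have im: "?f ` ?N = rad_L"
  proof
    show "?f ` ?N \<subseteq> rad_L"
    proof
      fix x assume "x \<in> ?f ` ?N"
      then obtain w where w: "w \<in> ?N" "x = ?f w" by blast
      have "mv (mat_adjoint C) w - ce w = - mv (mat_adjoint B) (tail_part n w)" by (simp add: ce_def)
      moreover have "ip q (- mv (mat_adjoint B) (tail_part n w)) v = 0" if "v \<in> KB" for v
        using that ip_adjoint'[OF B, of "tail_part n w" v] unfolding KB_def ker_def
        by (simp add: ip_simps)
      ultimately show "x \<in> rad_L"
        using w join_parts_csp[OF ce_csp] unfolding rad_L_iff K_iff L_iff W_def ker_N4
        by (simp add: mv_C_head_part head_part_join_parts)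
    qed
    show "rad_L \<subseteq> ?f ` ?N"
    proof
      fix x assume x: "x \<in> rad_L"
      then have xW: "x \<in> W" unfolding rad_L_iff K_iff by blast
      obtain \<eta> where \<eta>: "\<eta> \<in> csp m" "mv (mat_adjoint C) x - tail_part n x = mv (mat_adjoint B) \<eta>"
        using range_of_orthogonal_kernel[OF adj(2) residuals_csp(2)[OF xW]] x
        unfolding rad_L_iff KB_def by (metis adjoint_adjoint)
      let ?w = "join_parts n x (- \<eta>)"
      have "- \<eta> \<in> csp m" using \<eta>(1) unfolding csp_def by simp
      then have wc: "?w \<in> csp (n + m)" by (rule join_parts_csp)
      have "ce ?w = mv (mat_adjoint C) x - mv (mat_adjoint B) \<eta>"
        unfolding ce_def by (simp add: mv_C_head_part mv_minus)
      then have ce: "ce ?w = tail_part n x" unfolding \<eta>(2)[symmetric] by simp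
      have "?w \<in> ?N"
        using x wc unfolding ker_N4 rad_L_iff K_iff L_iff by (simp add: ce mv_C_head_part head_part_join_parts)
      moreover have "?f ?w = x" unfolding ce by (simp add: join_parts_tail_part)
      ultimately show "x \<in> ?f ` ?N" by (metis imageI)
    qed
  qed
  have "w \<in> ?N \<longleftrightarrow> w \<in> csp (n + m)" if t: "head_part n w = 0" "mv (mat_adjoint B) (tail_part n w) = 0" for w
  proof -
    have "mv (mat_adjoint C) w = 0" "mv (mat_adjoint A) w = 0"
      using mv_C_head_part(1,2)[of w] t by (simp_all add: mv_zero)
    then show ?thesis unfolding ker_N4 ce_def using t by (simp add: mv_zero)
  qed
  then have "{w \<in> ?N. ?f w = 0} = csp_prod n m {0} (ker m (mat_adjoint B))"
    unfolding ker_join_parts_ce ker_adjoint_B_csp_prod[symmetric] by auto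
  then have "fs.dim ?N + mrank B = fs.dim rad_L + m"
    using fs.dim_via_map[OF linear_join_parts_ce fsub_ker im] dim_ker_adjoint_B_csp_prod by simp
  then show ?thesis using rank_left_nullity[OF N4_carrier] by simp
qed

section \<open>Transfer from the family of forms to the matrix function\<close>

definition \<phi> where "\<phi> X = (A * X * B + C) * mat_adjoint (A * X * B + C) - 1\<^sub>m n"

lemma phi_form:
  assumes "X \<in> carrier_mat p m"
  obtains h where "h \<in> F" "ipos (\<phi> X) = fs.posi h W" "ineg (\<phi> X) + q = fs.negi h W"
    "mrank (\<phi> X) = ipos (\<phi> X) + ineg (\<phi> X)"
proof -
  have "block_form n q (A * X * B + C) \<in> F" using assms unfolding F_def by blast
  then show ?thesis using inertia_phi[OF assms] that unfolding \<phi>_def by fastforce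
qed

lemma form_phi:
  assumes "h \<in> F"
  obtains X where "X \<in> carrier_mat p m" "ipos (\<phi> X) = fs.posi h W" "ineg (\<phi> X) + q = fs.negi h W"
    "mrank (\<phi> X) = ipos (\<phi> X) + ineg (\<phi> X)"
proof -
  obtain X where X: "X \<in> carrier_mat p m" "h = block_form n q (A * X * B + C)" using assms unfolding F_def by blast
  then show ?thesis using inertia_phi[OF X(1)] that unfolding \<phi>_def by fastforce
qed

text \<open>\<open>invariants\<close> replaces the quantities on \<open>K\<close>, on
  \<open>L\<close> and in the common radical by their values at \<open>h0\<close>, which makes the
  bounds uniform over the family.\<close>

lemma form_bounds:
  assumes hF: "h \<in> F"
  shows "fs.posi h W \<le> fs.posi h0 K + mrank A" "fs.posi h W \<le> fs.posi h0 L + mrank B"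
    "fs.negi h W \<le> fs.negi h0 K + mrank A" "fs.negi h W \<le> fs.negi h0 L + mrank B"
    "fs.posi h W + fs.negi h W + fs.dim rad_KL \<le> n + q"
    "fs.posi h0 K + fs.dim rad_K \<le> fs.posi h W + fs.dim rad_KL" "fs.posi h0 L + fs.dim rad_L \<le> fs.posi h W + fs.dim rad_KL"
    "fs.negi h0 K + fs.dim rad_K \<le> fs.negi h W + fs.dim rad_KL" "fs.negi h0 L + fs.dim rad_L \<le> fs.negi h W + fs.dim rad_KL"
proof -
  have h: "fs.herm h" by (rule F_herm[OF hF])
  note i = form_family.invariants[OF family hF h0_F]
  have iZ: "K \<inter> L \<inter> fs.radical h W = rad_KL" "L \<inter> K \<inter> fs.radical h W = rad_KL"
    unfolding rad_KL_def using i(7) by (simp_all add: Int_commute)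
  show "fs.posi h W \<le> fs.posi h0 K + mrank A" "fs.posi h W \<le> fs.posi h0 L + mrank B"
    using fs.posi_le_codim[OF fsub_W K_sub, of h] fs.posi_le_codim[OF fsub_W L_sub, of h] i dim_codim by simp_all
  show "fs.negi h W \<le> fs.negi h0 K + mrank A" "fs.negi h W \<le> fs.negi h0 L + mrank B"
    using fs.posi_le_codim[OF fsub_W K_sub, of "\<lambda>x y. - h x y"]
      fs.posi_le_codim[OF fsub_W L_sub, of "\<lambda>x y. - h x y"] i dim_codim
    unfolding fs.negi_def[symmetric] by simp_all
  have "fs.dim rad_KL \<le> fs.dim (fs.radical h W)"
    unfolding iZ(1)[symmetric] by (rule fs.fsub_dim_mono[OF fs.fsub_perp[OF h fsub_W]]) blast
  then show "fs.posi h W + fs.negi h W + fs.dim rad_KL \<le> n + q"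
    using fs.inertia_sum[OF h fsub_W] by (simp add: W_def)
  note lb = fs.posi_lower_bound[OF _ fsub_W]
  show "fs.posi h0 K + fs.dim rad_K \<le> fs.posi h W + fs.dim rad_KL" "fs.posi h0 L + fs.dim rad_L \<le> fs.posi h W + fs.dim rad_KL"
    using lb[OF h K_sub L_sub(1)] lb[OF h L_sub K_sub(1)] i unfolding iZ rad_L_def rad_K_def by simp_all
  show "fs.negi h0 K + fs.dim rad_K \<le> fs.negi h W + fs.dim rad_KL" "fs.negi h0 L + fs.dim rad_L \<le> fs.negi h W + fs.dim rad_KL"
    using lb[OF fs.herm_uminus[OF h] K_sub L_sub(1)] lb[OF fs.herm_uminus[OF h] L_sub K_sub(1)] i
    unfolding fs.perp_uminus iZ rad_L_def rad_K_def fs.negi_def[symmetric] by simp_all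
qed

lemma block_ranks:
  "ipos N1 = mrank A + fs.posi h0 K" "ineg N1 + q = mrank A + fs.negi h0 K"
  "ipos N3 = mrank B + fs.posi h0 L" "ineg N3 + q = mrank B + fs.negi h0 L"
  "mrank N1 = ipos N1 + ineg N1" "mrank N3 = ipos N3 + ineg N3"
  using inertia_N1 inertia_N3 rank_eq_inertia[OF N1_carrier N1_adjoint] rank_eq_inertia[OF N3_carrier N3_adjoint]
    inertia_eq_eigenvalue_count[OF N1_carrier N1_adjoint] inertia_eq_eigenvalue_count[OF N3_carrier N3_adjoint]
  by simp_all

lemma phi_bounds:
  assumes "X \<in> carrier_mat p m"
  shows "mrank (\<phi> X) \<le> min (mrank R) (min (mrank N1) (mrank N3))"
    "ipos (\<phi> X) \<le> min (ipos N1) (ipos N3)" "ineg (\<phi> X) \<le> min (ineg N1) (ineg N3)"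
    "int (mrank R) + max (int (ipos N1) - int (mrank N2)) (int (ipos N3) - int (mrank N4)) \<le> int (ipos (\<phi> X))"
    "int (mrank R) + max (int (ineg N1) - int (mrank N2)) (int (ineg N3) - int (mrank N4)) \<le> int (ineg (\<phi> X))"
    "mrank (\<phi> X) = ipos (\<phi> X) + ineg (\<phi> X)"
proof -
  obtain h where h: "h \<in> F" "ipos (\<phi> X) = fs.posi h W" "ineg (\<phi> X) + q = fs.negi h W"
    "mrank (\<phi> X) = ipos (\<phi> X) + ineg (\<phi> X)" by (rule phi_form[OF assms])
  \<comment> \<open>All shifts cancel: \<open>q\<close> in the negative indices,
    \<open>mrank A\<close> between \<open>N1\<close> and \<open>N2\<close>, and
    \<open>mrank B\<close> between \<open>N3\<close> and \<open>N4\<close>.\<close>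
  show "mrank (\<phi> X) \<le> min (mrank R) (min (mrank N1) (mrank N3))"
    "ipos (\<phi> X) \<le> min (ipos N1) (ipos N3)" "ineg (\<phi> X) \<le> min (ineg N1) (ineg N3)"
    "int (mrank R) + max (int (ipos N1) - int (mrank N2)) (int (ipos N3) - int (mrank N4)) \<le> int (ipos (\<phi> X))"
    "int (mrank R) + max (int (ineg N1) - int (mrank N2)) (int (ineg N3) - int (mrank N4)) \<le> int (ineg (\<phi> X))"
    "mrank (\<phi> X) = ipos (\<phi> X) + ineg (\<phi> X)"
    using h form_bounds[OF h(1)] block_ranks dim_rad_L dim_rad_K dim_rad_KL by linarith+
qed

text \<open>A single \<open>X\<close>, taken from an optimal form, attains both minima; only this
  makes the minimal rank the sum of the minimal indices.\<close>

lemma phi_min: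
  obtains X where "X \<in> carrier_mat p m"
    "int (ipos (\<phi> X)) = int (mrank R) + max (int (ipos N1) - int (mrank N2)) (int (ipos N3) - int (mrank N4))"
    "int (ineg (\<phi> X)) = int (mrank R) + max (int (ineg N1) - int (mrank N2)) (int (ineg N3) - int (mrank N4))"
proof -
  obtain h where opt: "form_family.optimal fscale F K L W h"
    using form_family.optimal_exists[OF family] by blast
  then have hF: "h \<in> F" unfolding form_family.optimal_def[OF family] by blast
  note i = form_family.invariants[OF family hF h0_F]
  have o: "fs.posi h W + fs.dim rad_KL = max (fs.posi h0 K + fs.dim rad_K) (fs.posi h0 L + fs.dim rad_L)"
      "fs.negi h W + fs.dim rad_KL = max (fs.negi h0 K + fs.dim rad_K) (fs.negi h0 L + fs.dim rad_L)"
    using form_family.optimal_posi[OF family opt] form_family.optimal_negi[OF family opt] i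
    unfolding rad_L_def rad_K_def rad_KL_def by simp_all
  obtain X where X: "X \<in> carrier_mat p m" "ipos (\<phi> X) = fs.posi h W" "ineg (\<phi> X) + q = fs.negi h W"
    by (rule form_phi[OF hF]) (use that in blast)
  show ?thesis
  proof (rule that[OF X(1)])
    show "int (ipos (\<phi> X)) = int (mrank R) + max (int (ipos N1) - int (mrank N2)) (int (ipos N3) - int (mrank N4))"
      "int (ineg (\<phi> X)) = int (mrank R) + max (int (ineg N1) - int (mrank N2)) (int (ineg N3) - int (mrank N4))"
      using o X(2,3) block_ranks dim_rad_L dim_rad_K dim_rad_KL by linarith+
  qed
qed

lemma phi_max_ipos: "\<exists>X\<in>carrier_mat p m. ipos (\<phi> X) = min (ipos N1) (ipos N3)"
proof -
  obtain h where h: "h \<in> F" "fs.posi h W + fs.dim K = fs.posi h K + fs.dim W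
      \<or> fs.posi h W + fs.dim L = fs.posi h L + fs.dim W"
    using form_family.max_posi[OF family] by blast
  note i = form_family.invariants[OF family h(1) h0_F]
  obtain X where X: "X \<in> carrier_mat p m" "ipos (\<phi> X) = fs.posi h W" by (rule form_phi[OF h(1)]) (use that in blast)
  then have "ipos (\<phi> X) = min (ipos N1) (ipos N3)"
    using h(2) i(1-4) dim_codim block_ranks phi_bounds(2)[OF X(1)] by linarith
  then show ?thesis using X(1) by blast
qed

lemma phi_max_ineg: "\<exists>X\<in>carrier_mat p m. ineg (\<phi> X) = min (ineg N1) (ineg N3)"
proof -
  obtain h where h: "h \<in> F" "fs.negi h W + fs.dim K = fs.negi h K + fs.dim W
      \<or> fs.negi h W + fs.dim L = fs.negi h L + fs.dim W"
    using form_family.max_negi[OF family] by blast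
  note i = form_family.invariants[OF family h(1) h0_F]
  obtain X where X: "X \<in> carrier_mat p m" "ineg (\<phi> X) + q = fs.negi h W"
    by (rule form_phi[OF h(1)]) (use that in blast)
  then have "ineg (\<phi> X) = min (ineg N1) (ineg N3)"
    using h(2) i(1-4) dim_codim block_ranks phi_bounds(3)[OF X(1)] by linarith
  then show ?thesis using X(1) by blast
qed

text \<open>The three alternatives of \<open>max_rank\<close> match the three terms of the minimum:
  a radical inside \<open>K \<inter> L\<close> gives the rank of the row block, and codimension
  equality at \<open>K\<close> or at \<open>L\<close> gives that of \<open>N1\<close> or
  \<open>N3\<close>.\<close>

lemma phi_max_rank: "\<exists>X\<in>carrier_mat p m. mrank (\<phi> X) = min (mrank R) (min (mrank N1) (mrank N3))"
proof -
  obtain h where h: "h \<in> F" "fs.radical h W \<subseteq> K \<inter> L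
      \<or> fs.posi h W + fs.negi h W + 2 * fs.dim K = fs.posi h K + fs.negi h K + 2 * fs.dim W
      \<or> fs.posi h W + fs.negi h W + 2 * fs.dim L = fs.posi h L + fs.negi h L + 2 * fs.dim W"
    using form_family.max_rank[OF family] by blast
  note i = form_family.invariants[OF family h(1) h0_F]
  have "fs.posi h W + fs.negi h W + fs.dim rad_KL = n + q" if "fs.radical h W \<subseteq> K \<inter> L"
  proof -
    have "rad_KL = fs.radical h W" unfolding rad_KL_def i(7)[symmetric] using that by blast
    then show ?thesis using fs.inertia_sum[OF F_herm[OF h(1)] fsub_W] by (simp add: W_def)
  qed
  moreover obtain X where X: "X \<in> carrier_mat p m" "ipos (\<phi> X) = fs.posi h W" "ineg (\<phi> X) + q = fs.negi h W"
    by (rule form_phi[OF h(1)]) (use that in blast)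
  ultimately have "mrank (\<phi> X) = min (mrank R) (min (mrank N1) (mrank N3))"
    using h(2) i(1-4) dim_codim block_ranks dim_rad_KL phi_bounds(1,6)[OF X(1)] by linarith
  then show ?thesis using X(1) by blast
qed

end

section \<open>Extrema over all matrices\<close>

lemma Max_image_eqI:
  fixes f :: "'a \<Rightarrow> nat"
  assumes "\<And>x. x \<in> S \<Longrightarrow> f x \<le> v" "\<exists>x\<in>S. f x = v"
  shows "Max {f x |x. x \<in> S} = v"
  using assms by (intro Max_eqI) (auto intro: finite_subset[of _ "{..v}"])

text \<open>The value is an integer because the formulas for the minima contain differences; the
  upper bound \<open>N\<close> provides the finiteness that \<open>Min\<close> requires.\<close>

lemma Min_image_eqI:
  fixes f :: "'a \<Rightarrow> nat"
  assumes "\<And>x. x \<in> S \<Longrightarrow> v \<le> int (f x)" "x \<in> S" "int (f x) = v" "\<And>x. x \<in> S \<Longrightarrow> f x \<le> N"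
  shows "int (Min {f x |x. x \<in> S}) = v"
proof -
  have "f x \<le> f y" if "y \<in> S" for y using assms(1)[OF that] assms(3) by simp
  moreover have "finite {f x |x. x \<in> S}"
    by (rule finite_subset[of _ "{..N}"]) (use assms(4) in auto)
  ultimately have "Min {f x |x. x \<in> S} = f x" using assms(2) by (intro Min_eqI) auto
  then show ?thesis using assms(3) by simp
qed

theorem theorem4p3:
  fixes A B C :: "complex mat" and n p m q :: nat
  assumes A: "A \<in> carrier_mat n p" and B: "B \<in> carrier_mat m q" and C: "C \<in> carrier_mat n q"
  defines "\<phi> \<equiv> \<lambda>X. (A * X * B + C) * mat_adjoint (A * X * B + C) - 1\<^sub>m n"
    and "N1 \<equiv> hcat (C * mat_adjoint C - 1\<^sub>m n) A @\<^sub>r hcat (mat_adjoint A) (0\<^sub>m p p)"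
    and "N2 \<equiv> hcat (hcat (C * mat_adjoint C - 1\<^sub>m n) (C * mat_adjoint B)) A
              @\<^sub>r hcat (hcat (mat_adjoint A) (0\<^sub>m p m)) (0\<^sub>m p p)"
    and "N3 \<equiv> hcat (C * mat_adjoint C - 1\<^sub>m n) (C * mat_adjoint B)
              @\<^sub>r hcat (B * mat_adjoint C) (B * mat_adjoint B)"
    and "N4 \<equiv> hcat (hcat (C * mat_adjoint C - 1\<^sub>m n) (C * mat_adjoint B)) A
              @\<^sub>r hcat (hcat (B * mat_adjoint C) (B * mat_adjoint B)) (0\<^sub>m m p)"
    and "R \<equiv> mrank (hcat (hcat (C * mat_adjoint C - 1\<^sub>m n) (C * mat_adjoint B)) A)"
  shows "(Max {mrank (\<phi> X) | X. X \<in> carrier_mat p m} = min R (min (mrank N1) (mrank N3)))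
    \<and> (int (Min {mrank (\<phi> X) | X. X \<in> carrier_mat p m}) = 2 * int R + max (max (int (mrank N1) - 2 * int (mrank N2)) (int (mrank N3) - 2 * int (mrank N4)))
               (max (int (ipos N1) + int (ineg N3) - int (mrank N2) - int (mrank N4))
                    (int (ineg N1) + int (ipos N3) - int (mrank N2) - int (mrank N4))))
    \<and> (Max {ipos (\<phi> X) | X. X \<in> carrier_mat p m} = min (ipos N1) (ipos N3))
    \<and> (Max {ineg (\<phi> X) | X. X \<in> carrier_mat p m} = min (ineg N1) (ineg N3))
    \<and> (int (Min {ipos (\<phi> X) | X. X \<in> carrier_mat p m})
           = int R + max (int (ipos N1) - int (mrank N2)) (int (ipos N3) - int (mrank N4)))
    \<and> (int (Min {ineg (\<phi> X) | X. X \<in> carrier_mat p m})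
           = int R + max (int (ineg N1) - int (mrank N2)) (int (ineg N3) - int (mrank N4)))"
proof -
  interpret g: affine_gram A B C n p m q by unfold_locales (fact A, fact B, fact C)
  have eqs: "\<phi> = g.\<phi>" "N1 = g.N1" "N2 = g.N2" "N3 = g.N3" "N4 = g.N4" "R = mrank g.R"
    unfolding \<phi>_def N1_def N2_def N3_def N4_def R_def g.N1_def g.N2_def g.N3_def g.N4_def g.R_def g.G_def
    by (auto simp: g.\<phi>_def fun_eq_iff)
  note bd = g.phi_bounds
  obtain X0 where X0: "X0 \<in> carrier_mat p m"
    "int (ipos (g.\<phi> X0)) = int (mrank g.R) + max (int (ipos g.N1) - int (mrank g.N2)) (int (ipos g.N3) - int (mrank g.N4))"
    "int (ineg (g.\<phi> X0)) = int (mrank g.R) + max (int (ineg g.N1) - int (mrank g.N2)) (int (ineg g.N3) - int (mrank g.N4))"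
    by (rule g.phi_min)
  let ?v = "2 * int (mrank g.R) + max (max (int (mrank g.N1) - 2 * int (mrank g.N2)) (int (mrank g.N3) - 2 * int (mrank g.N4)))
               (max (int (ipos g.N1) + int (ineg g.N3) - int (mrank g.N2) - int (mrank g.N4))
                    (int (ineg g.N1) + int (ipos g.N3) - int (mrank g.N2) - int (mrank g.N4)))"
  \<comment> \<open>A sum of two maxima of two terms is the maximum of the four sums. As the rank of
    \<open>N1\<close> and of \<open>N3\<close> is the sum of its two indices, these are the four
    numbers s_1, ..., s_4.\<close>
  have v: "?v = (int (mrank g.R) + max (int (ipos g.N1) - int (mrank g.N2)) (int (ipos g.N3) - int (mrank g.N4)))
      + (int (mrank g.R) + max (int (ineg g.N1) - int (mrank g.N2)) (int (ineg g.N3) - int (mrank g.N4)))"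
    using g.block_ranks(5,6) by linarith
  have "?v \<le> int (mrank (g.\<phi> X))" if "X \<in> carrier_mat p m" for X
    using bd(4-6)[OF that] unfolding v by linarith
  moreover have "int (mrank (g.\<phi> X0)) = ?v" using bd(6)[OF X0(1)] X0(2,3) unfolding v by linarith
  ultimately have "int (Min {mrank (g.\<phi> X) | X. X \<in> carrier_mat p m}) = ?v"
    using X0(1) bd(1) by (intro Min_image_eqI) auto
  moreover have "Max {mrank (g.\<phi> X) | X. X \<in> carrier_mat p m} = min (mrank g.R) (min (mrank g.N1) (mrank g.N3))"
    by (rule Max_image_eqI[where f = "\<lambda>X. mrank (g.\<phi> X)", OF bd(1) g.phi_max_rank])
  moreover have "Max {ipos (g.\<phi> X) | X. X \<in> carrier_mat p m} = min (ipos g.N1) (ipos g.N3)"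
    by (rule Max_image_eqI[where f = "\<lambda>X. ipos (g.\<phi> X)", OF bd(2) g.phi_max_ipos])
  moreover have "Max {ineg (g.\<phi> X) | X. X \<in> carrier_mat p m} = min (ineg g.N1) (ineg g.N3)"
    by (rule Max_image_eqI[where f = "\<lambda>X. ineg (g.\<phi> X)", OF bd(3) g.phi_max_ineg])
  moreover have "int (Min {ipos (g.\<phi> X) | X. X \<in> carrier_mat p m})
      = int (mrank g.R) + max (int (ipos g.N1) - int (mrank g.N2)) (int (ipos g.N3) - int (mrank g.N4))"
    by (rule Min_image_eqI[where f = "\<lambda>X. ipos (g.\<phi> X)", OF bd(4) X0(1,2) bd(2)])
  moreover have "int (Min {ineg (g.\<phi> X) | X. X \<in> carrier_mat p m})
      = int (mrank g.R) + max (int (ineg g.N1) - int (mrank g.N2)) (int (ineg g.N3) - int (mrank g.N4))"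
    by (rule Min_image_eqI[where f = "\<lambda>X. ineg (g.\<phi> X)", OF bd(5) X0(1,3) bd(3)])
  ultimately show ?thesis unfolding eqs by blast
qed

end
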